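(* For all $n\ge 1$ and all types $A_1,\dots,A_n,B$ of $\mathrm{L}^{\circledcirc}$: the sequent $A_1,\dots,A_n\to B$ is derivable in $\mathrm{L}^{\circledcirc}$ if and only if the hypergraph sequent $\mathrm{SG}(tr(A_1)\dots tr(A_n))\to tr(B)$ is derivable in $\mathrm{HL}^{WI}$.
   Context: **The calculus $\mathrm{L}^{\circledcirc}$ (Lambek calculus with the bracelet operation).** Types are built from primitive types using binary connectives $\backslash$, $/$, $\cdot$ and unary connectives $A\mapsto A^{\mathrm{R}}$, $A\mapsto A^{\circledcirc}$. A sequent is $A_1,\dots,A_n\to B$ with $n\ge1$. Capital Latin letters denote types, $\Gamma,\Delta$ finite (possibly empty) sequences of types, $\Pi,\Psi$ nonempty finite sequences of types. Axioms and rules: - $(\mathrm{Ax})$: $A\to A$. - $(\backslash\to)$: from $\Gamma,B,\Delta\to C$ and $\Pi\to A$ infer $\Gamma,\Pi,A\backslash B,\Delta\to C$. - $(\to\backslash)$: from $A,\Pi\to B$ infer $\Pi\to A\backslash B$. - $(/\to)$: from $\Gamma,B,\Delta\to C$ and $\Pi\to A$ infer $\Gamma,B/A,\Pi,\Delta\to C$. - $(\to/)$: from $\Pi,A\to B$ infer $\Pi\to B/A$. - $(\cdot\to)$: from $\Gamma,A,B,\Delta\to C$ infer $\Gamma,A\cdot B,\Delta\to C$. - $(\to\cdot)$: from $\Pi\to A$ and $\Psi\to B$ infer $\Pi,\Psi\to A\cdot B$. - $(\mathrm{cut})$: from $\Pi\to A$ and $\Gamma,A,\Delta\to B$ infer $\Gamma,\Pi,\Delta\to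 B$. - $(^{\mathrm{R}}\to^{\mathrm{R}})$: from $A_1,A_2,\dots,A_n\to B$ infer $A_n^{\mathrm{R}},\dots,A_2^{\mathrm{R}},A_1^{\mathrm{R}}\to B^{\mathrm{R}}$. - $(^{\mathrm{RR}}\to)$: from $\Gamma,A,\Delta\to B$ infer $\Gamma,A^{\mathrm{RR}},\Delta\to B$. - $(\to^{\mathrm{RR}})$: from $\Pi\to A$ infer $\Pi\to A^{\mathrm{RR}}$. - $(\to^{\circledcirc})$: from $\Pi\to A$ infer $\Pi\to A^{\circledcirc}$. - $(^{\circledcirc}\to)$: from $B\to A^{\circledcirc}$ infer $B^{\circledcirc}\to A^{\circledcirc}$. - $(\circledcirc)$: from $\Pi,\Psi\to A^{\circledcirc}$ infer $\Psi,\Pi\to A^{\circledcirc}$. - $(\mathrm{Ax}^{\mathrm{R}\circledcirc})$: the axiom $A^{\mathrm{R}}\to A^{\circledcirc}$. **Hypergraphs.** Let $C$ be a set of labels with $rank:C\to\mathbb{N}$ ($0\in\mathbb{N}$). A hypergraph over $C$ is $G=\langle V_G,E_G,att_G,lab_G,ext_G\rangle$ with finite sets $V_G$ of nodes and $E_G$ of hyperedges, $att_G:E_G\to V_G^*$ (attachment nodes may repeat), $lab_G:E_G\to C$ with $rank(lab_G(e))=|att_G(e)|$, and $ext_G$ a string of pairwise distinct nodes (external nodes). $rank(G)=|ext_G|$. Isomorphic hypergraphs are identified. For a label $a$ of rank $n$, $a^\bullet$ is the hypergraph with nodes $v_1,\dots,v_n$, one hyperedge $e_0$ labeled $a$, $att(e_0)=ext=v_1\dots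 v_n$. For a string $a_1\dots a_n$ of labels of rank 2, the string graph $\mathrm{SG}(a_1\dots a_n)$ has nodes $v_0,\dots,v_n$, hyperedges $e_1,\dots,e_n$ with $att(e_i)=v_{i-1}v_i$, $lab(e_i)=a_i$, and $ext=v_0v_n$. Replacement $G[e/H]$ (for $|att_G(e)|=rank(H)$): remove $e$ from $G$, add a disjoint copy of $H$, fuse the $i$-th external node of $H$ with the $i$-th attachment node of $e$ for all $i$; the external nodes are those of $G$. **The hypergraph Lambek calculus $\mathrm{HL}$.** Fix a set $Pr$ of primitive types with $rank:Pr\to\mathbb{N}$ such that each rank is attained infinitely often, and special labels $\$_n$ ($n\in\mathbb{N}$), $rank(\$_n)=n$, not occurring elsewhere. Types: each $p\in Pr$ is a type; if $N$ is a type and $D$ is a hypergraph with exactly one hyperedge $e^{\$}_D$ labeled by $\$_d$ for some $d$, all other hyperedges labeled by types, and $rank(N)=rank(D)$, then $N\div D$ is a type with $rank(N\div D)=d$; if $M$ is a hypergraph labeled by types, then $\times(M)$ is a type with $rank(\times(M))=rank(M)$. A sequent is $H\to A$ with $H$ a hypergraph labeled by types and $A$ a type. Axioms: $p^\bullet\to p$ for $p\in Pr$. Rules: - $(\div\to)$: let $N\div D$ be a type, $E_D=\{e^{\$}_D,d_1,\dots,d_k\}$, and let $e\in E_H$ be labeled by $N$. From $H\to A$, $H_1\to lab(d_1)$, …, $H_k\to lab(d_k)$ infer $H[e/D][e^{\$}_D/(N\div D)^\bullet][d_1/H_1]\dots[d_k/H_k]\to A$. - $(\to\div)$: from $D[e^{\$}_D/F]\to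 N$ infer $F\to N\div D$. - $(\times\to)$: if $e\in E_G$ is labeled by $\times(F)$, from $G[e/F]\to A$ infer $G\to A$. - $(\to\times)$: if $E_M=\{m_1,\dots,m_l\}$, from $H_1\to lab(m_1)$, …, $H_l\to lab(m_l)$ infer $M[m_1/H_1]\dots[m_l/H_l]\to\times(M)$. **$\mathrm{HL}^{WI}$** is the variant of $\mathrm{HL}$ in which all hypergraphs (those occurring inside types and those in antecedents of sequents) are required to have no isolated nodes (nodes attached to no hyperedge); everything else is the same. **Translation $tr$.** The primitive types of $\mathrm{L}^{\circledcirc}$ are identified with the primitive types of $\mathrm{HL}$ of rank 2. For a label $A$ of rank 2, $Loop(A)$ is the hypergraph with one node $v$, one hyperedge $e$ with $att(e)=vv$ and $lab(e)=A$, and no external nodes; for a type $A$ of $\mathrm{HL}$ of rank 2, $\circlearrowleft_{\mathrm{H}}(A)=\times(Loop(A))\div Loop(\$_2)$. Then: $tr(p)=p$; $tr(A/B)=tr(A)\div\mathrm{SG}(\$_2\,tr(B))$; $tr(B\backslash A)=tr(A)\div\mathrm{SG}(tr(B)\,\$_2)$; $tr(A\cdot B)=\times(\mathrm{SG}(tr(A)\,tr(B)))$; $tr(A^{\circledcirc})=\circlearrowleft_{\mathrm{H}}(tr(A))$; $tr(A^{\mathrm{R}})=\times(R_A)$, where $R_A$ has nodes $v_0,v_1$, one hyperedge $e_0$ with $att(e_0)=v_0v_1$, $lab(e_0)=tr(A)$, and $ext=v_1v_0$. *)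

theory Defs
  imports Main
begin

section \<open>The Lambek calculus with the bracelet operation\<close>

text \<open>\<^term>\<open>Under A B\<close> is $A \backslash B$, \<^term>\<open>Over B A\<close> is $B / A$,
  \<^term>\<open>Rev A\<close> is $A^{R}$ and \<^term>\<open>Brace A\<close> is the bracelet type over $A$.\<close>

datatype 'q ltype =
    LPrim 'q
  | Under "'q ltype" "'q ltype"
  | Over "'q ltype" "'q ltype"
  | Prod "'q ltype" "'q ltype"
  | Rev "'q ltype"
  | Brace "'q ltype"

inductive lbr :: "'q ltype list \<Rightarrow> 'q ltype \<Rightarrow> bool" where
  Ax: "lbr [A] A"
| UnderL: "\<lbrakk>lbr (\<Gamma> @ [B] @ \<Delta>) C; \<Pi> \<noteq> []; lbr \<Pi> A\<rbrakk>
    \<Longrightarrow> lbr (\<Gamma> @ \<Pi> @ [Under A B] @ \<Delta>) C"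
| UnderR: "\<lbrakk>\<Pi> \<noteq> []; lbr ([A] @ \<Pi>) B\<rbrakk> \<Longrightarrow> lbr \<Pi> (Under A B)"
| OverL: "\<lbrakk>lbr (\<Gamma> @ [B] @ \<Delta>) C; \<Pi> \<noteq> []; lbr \<Pi> A\<rbrakk>
    \<Longrightarrow> lbr (\<Gamma> @ [Over B A] @ \<Pi> @ \<Delta>) C"
| OverR: "\<lbrakk>\<Pi> \<noteq> []; lbr (\<Pi> @ [A]) B\<rbrakk> \<Longrightarrow> lbr \<Pi> (Over B A)"
| ProdL: "lbr (\<Gamma> @ [A, B] @ \<Delta>) C \<Longrightarrow> lbr (\<Gamma> @ [Prod A B] @ \<Delta>) C"
| ProdR: "\<lbrakk>\<Pi> \<noteq> []; \<Psi> \<noteq> []; lbr \<Pi> A; lbr \<Psi> B\<rbrakk> \<Longrightarrow> lbr (\<Pi> @ \<Psi>) (Prod A B)"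
| Cut: "\<lbrakk>\<Pi> \<noteq> []; lbr \<Pi> A; lbr (\<Gamma> @ [A] @ \<Delta>) B\<rbrakk> \<Longrightarrow> lbr (\<Gamma> @ \<Pi> @ \<Delta>) B"
| RevRev: "\<lbrakk>\<Pi> \<noteq> []; lbr \<Pi> B\<rbrakk> \<Longrightarrow> lbr (rev (map Rev \<Pi>)) (Rev B)"
| RRL: "lbr (\<Gamma> @ [A] @ \<Delta>) B \<Longrightarrow> lbr (\<Gamma> @ [Rev (Rev A)] @ \<Delta>) B"
| RRR: "\<lbrakk>\<Pi> \<noteq> []; lbr \<Pi> A\<rbrakk> \<Longrightarrow> lbr \<Pi> (Rev (Rev A))"
| BraceR: "\<lbrakk>\<Pi> \<noteq> []; lbr \<Pi> A\<rbrakk> \<Longrightarrow> lbr \<Pi> (Brace A)"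
| BraceL: "lbr [B] (Brace A) \<Longrightarrow> lbr [Brace B] (Brace A)"
| Rotate: "\<lbrakk>\<Pi> \<noteq> []; \<Psi> \<noteq> []; lbr (\<Pi> @ \<Psi>) (Brace A)\<rbrakk> \<Longrightarrow> lbr (\<Psi> @ \<Pi>) (Brace A)"
| AxRevBrace: "lbr [Rev A] (Brace A)"


section \<open>Hypergraphs\<close>

text \<open>Nodes and hyperedges are natural numbers, which is no restriction as hypergraphs are finite
  and only considered up to isomorphism. The values of \<open>att\<close> and \<open>lab\<close> outside
  \<open>edges\<close> are irrelevant. Finiteness and the constraints on \<open>att\<close>, \<open>lab\<close> and \<open>ext\<close>
  are imposed by \<open>hypergraph\<close> below.\<close>

datatype 'l hgraph =
  HGraph (nodes: "nat set") (edges: "nat set")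
    (att: "nat \<Rightarrow> nat list") (lab: "nat \<Rightarrow> 'l") (ext: "nat list")

definition no_isolated :: "'l hgraph \<Rightarrow> bool" where
  "no_isolated G \<longleftrightarrow> (\<forall>v\<in>nodes G. \<exists>e\<in>edges G. v \<in> set (att G e))"

text \<open>Isomorphism of hypergraphs, with labels compared by \<open>R\<close>.\<close>

definition hg_iso :: "('l \<Rightarrow> 'l \<Rightarrow> bool) \<Rightarrow> 'l hgraph \<Rightarrow> 'l hgraph \<Rightarrow> bool" where
  "hg_iso R G H \<longleftrightarrow> (\<exists>f g. bij_betw f (nodes G) (nodes H) \<and> bij_betw g (edges G) (edges H) \<and>
     (\<forall>e\<in>edges G. att H (g e) = map f (att G e) \<and> R (lab G e) (lab H (g e))) \<and>
     ext H = map f (ext G))"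

lemma hg_iso_mono [mono]:
  assumes "\<And>x y. R x y \<longrightarrow> S x y"
  shows "hg_iso R G H \<longrightarrow> hg_iso S G H"
  unfolding hg_iso_def using assms by meson

definition fresh :: "nat set \<Rightarrow> nat" where
  "fresh A = Suc (Max (insert 0 A))"

text \<open>The disjoint copy of \<open>H\<close> in \<open>replace G e H\<close> is made by shifting nodes and hyperedges past
  those of \<open>G\<close>. The external nodes of \<open>H\<close> are pairwise distinct, so fusing amounts to sending
  the \<open>i\<close>-th external node of \<open>H\<close> to the \<open>i\<close>-th attachment node of \<open>e\<close>. The hyperedge \<open>d\<close> of
  \<open>H\<close> becomes the hyperedge \<open>edge_copy G d\<close> of the result; the hyperedges of \<open>G\<close>
  keep their names. Only meaningful if \<open>length (att G e) = length (ext H)\<close>.\<close>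

definition node_copy :: "'l hgraph \<Rightarrow> nat \<Rightarrow> 'l hgraph \<Rightarrow> nat \<Rightarrow> nat" where
  "node_copy G e H v =
     (case map_of (zip (ext H) (att G e)) v of Some u \<Rightarrow> u | None \<Rightarrow> v + fresh (nodes G))"

definition edge_copy :: "'l hgraph \<Rightarrow> nat \<Rightarrow> nat" where
  "edge_copy G d = d + fresh (edges G)"

definition replace :: "'l hgraph \<Rightarrow> nat \<Rightarrow> 'l hgraph \<Rightarrow> 'l hgraph" where
  "replace G e H = HGraph
     (nodes G \<union> node_copy G e H ` nodes H)
     ((edges G - {e}) \<union> edge_copy G ` edges H)
     (\<lambda>d. if d < fresh (edges G) then att G d
          else map (node_copy G e H) (att H (d - fresh (edges G))))
     (\<lambda>d. if d < fresh (edges G) then lab G d else lab H (d - fresh (edges G)))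
     (ext G)"

text \<open>\<open>G[e\<^sub>1/H\<^sub>1]\<dots>[e\<^sub>k/H\<^sub>k]\<close>\<close>

definition replaces :: "'l hgraph \<Rightarrow> (nat \<times> 'l hgraph) list \<Rightarrow> 'l hgraph" where
  "replaces G xs = foldl (\<lambda>G (e, H). replace G e H) G xs"

text \<open>Only meaningful for a nonempty string: otherwise the two external nodes coincide.\<close>

definition string_graph :: "'l list \<Rightarrow> 'l hgraph" where
  "string_graph as =
     HGraph {..length as} {..<length as} (\<lambda>i. [i, Suc i]) (\<lambda>i. as ! i) [0, length as]"

definition loop :: "'l \<Rightarrow> 'l hgraph" where
  "loop a = HGraph {0} {0} (\<lambda>_. [0, 0]) (\<lambda>_. a) []"


section \<open>Types of the hypergraph Lambek calculus\<close>

text \<open>Raw labels; \<^term>\<open>Dollar n\<close> is the special label $\$_n$. The types are singled out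
  by \<open>hl_type\<close> below.\<close>

datatype 'p label =
    Prim 'p
  | Dollar nat
  | Div "'p label" "'p label hgraph"
  | Times "'p label hgraph"

text \<open>Isomorphic hypergraphs are identified, also those occurring inside types. Hence two labels
  count as the same if they are related by the following relation.\<close>

inductive label_iso :: "'p label \<Rightarrow> 'p label \<Rightarrow> bool" where
  "label_iso (Prim p) (Prim p)"
| "label_iso (Dollar n) (Dollar n)"
| "\<lbrakk>label_iso N N'; hg_iso label_iso D D'\<rbrakk> \<Longrightarrow> label_iso (Div N D) (Div N' D')"
| "hg_iso label_iso M M' \<Longrightarrow> label_iso (Times M) (Times M')"

fun rank :: "('p \<Rightarrow> nat) \<Rightarrow> 'p label \<Rightarrow> nat" where
  "rank rk (Prim p) = rk p"
| "rank rk (Dollar n) = n"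
| "rank rk (Div N D) = (THE d. \<exists>e\<in>edges D. lab D e = Dollar d)"
| "rank rk (Times M) = length (ext M)"

definition hypergraph :: "('p \<Rightarrow> nat) \<Rightarrow> 'p label hgraph \<Rightarrow> bool" where
  "hypergraph rk G \<longleftrightarrow> finite (nodes G) \<and> finite (edges G) \<and>
     (\<forall>e\<in>edges G. set (att G e) \<subseteq> nodes G \<and> length (att G e) = rank rk (lab G e)) \<and>
     set (ext G) \<subseteq> nodes G \<and> distinct (ext G)"

text \<open>The parameter \<open>ok\<close> restricts the hypergraphs that may occur in types and in antecedents of
  sequents: it is trivial for HL and \<^const>\<open>no_isolated\<close> for \<open>HL\<^sup>W\<^sup>I\<close>.\<close>

inductive hl_type :: "('p label hgraph \<Rightarrow> bool) \<Rightarrow> ('p \<Rightarrow> nat) \<Rightarrow> 'p label \<Rightarrow> bool"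
  for ok :: "'p label hgraph \<Rightarrow> bool" and rk :: "'p \<Rightarrow> nat" where
  "hl_type ok rk (Prim p)"
| "\<lbrakk>hl_type ok rk N; hypergraph rk D; ok D; s \<in> edges D; lab D s = Dollar d;
    \<forall>e\<in>edges D - {s}. hl_type ok rk (lab D e); rank rk N = length (ext D)\<rbrakk>
    \<Longrightarrow> hl_type ok rk (Div N D)"
| "\<lbrakk>hypergraph rk M; ok M; \<forall>e\<in>edges M. hl_type ok rk (lab M e)\<rbrakk>
    \<Longrightarrow> hl_type ok rk (Times M)"

definition hl_sequent ::
  "('p label hgraph \<Rightarrow> bool) \<Rightarrow> ('p \<Rightarrow> nat) \<Rightarrow> 'p label hgraph \<Rightarrow> 'p label \<Rightarrow> bool" where
  "hl_sequent ok rk H A \<longleftrightarrow> hypergraph rk H \<and> ok H \<and>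
     (\<forall>e\<in>edges H. hl_type ok rk (lab H e)) \<and> hl_type ok rk A"

definition bullet :: "('p \<Rightarrow> nat) \<Rightarrow> 'p label \<Rightarrow> 'p label hgraph" where
  "bullet rk a =
     HGraph {..<rank rk a} {0} (\<lambda>_. [0..<rank rk a]) (\<lambda>_. a) [0..<rank rk a]"


section \<open>Derivability\<close>

text \<open>The rules are stated for representatives of isomorphism classes; \<open>Iso\<close> implements the
  identification of isomorphic hypergraphs. A function \<open>F\<close> assigns to each (non-\<open>$\<close>)
  hyperedge the antecedent of the corresponding premise. The equations between
  lengths say that the replacements are defined.\<close>

inductive hl ::
  "('p label hgraph \<Rightarrow> bool) \<Rightarrow> ('p \<Rightarrow> nat) \<Rightarrow> 'p label hgraph \<Rightarrow> 'p label \<Rightarrow> bool"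
  for ok :: "'p label hgraph \<Rightarrow> bool" and rk :: "'p \<Rightarrow> nat" where
  Iso: "\<lbrakk>hl ok rk H A; hg_iso label_iso H H'; label_iso A A'; hl_sequent ok rk H' A'\<rbrakk>
    \<Longrightarrow> hl ok rk H' A'"
| Ax: "hl_sequent ok rk (bullet rk (Prim p)) (Prim p) \<Longrightarrow> hl ok rk (bullet rk (Prim p)) (Prim p)"
| DivL: "\<lbrakk>hl_type ok rk (Div N D); s \<in> edges D; lab D s = Dollar n;
    distinct ds; set ds = edges D - {s};
    e \<in> edges H; lab H e = N;
    hl ok rk H A;
    \<forall>d\<in>set ds. hl ok rk (F d) (lab D d) \<and> length (att D d) = length (ext (F d));
    K = replaces H ([(e, D), (edge_copy H s, bullet rk (Div N D))]
          @ map (\<lambda>d. (edge_copy H d, F d)) ds);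
    hl_sequent ok rk K A\<rbrakk>
    \<Longrightarrow> hl ok rk K A"
| DivR: "\<lbrakk>hl_type ok rk (Div N D); s \<in> edges D; lab D s = Dollar n;
    length (att D s) = length (ext F);
    hl ok rk (replace D s F) N;
    hl_sequent ok rk F (Div N D)\<rbrakk>
    \<Longrightarrow> hl ok rk F (Div N D)"
| TimesL: "\<lbrakk>e \<in> edges G; lab G e = Times F;
    hl ok rk (replace G e F) A;
    hl_sequent ok rk G A\<rbrakk>
    \<Longrightarrow> hl ok rk G A"
| TimesR: "\<lbrakk>distinct ms; set ms = edges M;
    \<forall>m\<in>set ms. hl ok rk (F m) (lab M m) \<and> length (att M m) = length (ext (F m));
    K = replaces M (map (\<lambda>m. (m, F m)) ms);
    hl_sequent ok rk K (Times M)\<rbrakk>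
    \<Longrightarrow> hl ok rk K (Times M)"

definition HL :: "('p \<Rightarrow> nat) \<Rightarrow> 'p label hgraph \<Rightarrow> 'p label \<Rightarrow> bool" where
  "HL = hl (\<lambda>_. True)"

definition HL_WI :: "('p \<Rightarrow> nat) \<Rightarrow> 'p label hgraph \<Rightarrow> 'p label \<Rightarrow> bool" where
  "HL_WI = hl no_isolated"


section \<open>The translation\<close>

definition bracelet :: "'p label \<Rightarrow> 'p label" where
  "bracelet A = Div (Times (loop A)) (loop (Dollar 2))"

definition reversal :: "'p label \<Rightarrow> 'p label hgraph" where
  "reversal A = HGraph {0, 1} {0} (\<lambda>_. [0, 1]) (\<lambda>_. A) [1, 0]"

text \<open>The injection \<open>\<iota>\<close> identifies the primitive types of the Lambek calculus with the
  primitive types of rank 2.\<close>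

fun tr :: "('q \<Rightarrow> 'p) \<Rightarrow> 'q ltype \<Rightarrow> 'p label" where
  "tr \<iota> (LPrim q) = Prim (\<iota> q)"
| "tr \<iota> (Over A B) = Div (tr \<iota> A) (string_graph [Dollar 2, tr \<iota> B])"
| "tr \<iota> (Under B A) = Div (tr \<iota> A) (string_graph [tr \<iota> B, Dollar 2])"
| "tr \<iota> (Prod A B) = Times (string_graph [tr \<iota> A, tr \<iota> B])"
| "tr \<iota> (Brace A) = bracelet (tr \<iota> A)"
| "tr \<iota> (Rev A) = Times (reversal (tr \<iota> A))"

end

theory Submission
  imports Defs "HOL-Library.Multiset"
begin

text \<open>From HL to the Lambek calculus: by induction on a derivation all of whose labels are
  isomorphic to types \<open>tr A\<close> or \<open>\<times>(Loop(tr A))\<close>, the antecedent is a simple path, with hyperedges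
  traversed in either direction, if the succedent is \<open>tr B\<close>, and a cycle or a single hyperedge of
  rank 0 if it is \<open>\<times>(Loop(tr B))\<close>; reading a backward hyperedge as a reversed type, the sequent
  read off from it is derivable. Isolated nodes must be excluded in the case of \<open>(\<rightarrow>\<div>)\<close> for the
  bracelet: otherwise a cycle could be cut open at a node without separating its two hyperedges.

  In the other direction the cut rule is the difficulty. It is absorbed semantically: a type is
  interpreted as a set of signed words that is closed, i.e. an intersection of sets of all words
  that complete some fixed graph with a gap to a cut-free derivable sequent. All rules of the
  Lambek calculus are sound, and by induction on \<open>A\<close> the one-letter word \<open>A\<close> belongs to the
  interpretation of \<open>A\<close>, all of whose elements label derivable paths with succedent \<open>tr A\<close>. The
  bracelet of \<open>A\<close> is interpreted as the intersection of the sets of words labelling derivable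
  cycles with succedent \<open>\<times>(Loop(tr D))\<close> that contain the interpretation of \<open>A\<close>.\<close>

section \<open>Isomorphism of labels\<close>

text \<open>The rules of \<open>hl\<close> contain no cut, so read upwards a derivation of a
  translated sequent only meets translations of subtypes and, inside bracelets, types
  \<open>Times (loop (tr \<iota> A))\<close>; hence an induction can carry a labelling by Lambek
  types along. What makes both directions awkward is replacement, which copies, renumbers and fuses
  nodes. Sequents are therefore handled as multisets of labelled edges over node names: replacement
  becomes multiset addition, and everything delicate is concentrated in the renaming of nodes. A
  renaming is either injective or, for a bracelet, fuses just the two ends of a path. A cycle
  remembers neither its starting point nor its direction. On the Lambek side this is matched by
  \<open>Rotate\<close> and by the sequent from \<open>Rev (Brace A)\<close> to
  \<open>Brace A\<close>, derivable from \<open>AxRevBrace\<close> and \<open>BraceL\<close>; on the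
  semantic side, by admitting only cycle conditions in the clause for \<open>Brace\<close>.\<close>

lemma label_iso_refl: "label_iso L L"
proof (induction L)
  case (Div N D)
  then have "hg_iso label_iso D D"
    unfolding hg_iso_def by (intro exI[of _ id]) (cases D; auto)
  then show ?case using Div by (auto intro: label_iso.intros)
next
  case (Times M)
  then have "hg_iso label_iso M M"
    unfolding hg_iso_def by (intro exI[of _ id]) (cases M; auto)
  then show ?case by (auto intro: label_iso.intros)
qed (auto intro: label_iso.intros)

text \<open>Three relations are kept apart because in \<open>label_iso_trans\<close> the first
  isomorphism compares labels by the conjunction of \<open>label_iso\<close> and the induction
  hypothesis.\<close>

lemma hg_iso_trans:
  assumes "hg_iso R G H" "hg_iso S H K" "\<And>x y z. R x y \<Longrightarrow> S y z \<Longrightarrow> T x z"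
  shows "hg_iso T G K"
proof -
  obtain f g where 1: "bij_betw f (nodes G) (nodes H)" "bij_betw g (edges G) (edges H)"
    "\<And>e. e \<in> edges G \<Longrightarrow> att H (g e) = map f (att G e) \<and> R (lab G e) (lab H (g e))"
    "ext H = map f (ext G)"
    using assms(1) unfolding hg_iso_def by blast
  obtain f' g' where 2: "bij_betw f' (nodes H) (nodes K)" "bij_betw g' (edges H) (edges K)"
    "\<And>e. e \<in> edges H \<Longrightarrow> att K (g' e) = map f' (att H e) \<and> S (lab H e) (lab K (g' e))"
    "ext K = map f' (ext H)"
    using assms(2) unfolding hg_iso_def by blast
  have g: "g e \<in> edges H" if "e \<in> edges G" for e
    using 1(2) that bij_betwE by blast
  have "T (lab G e) (lab K (g' (g e)))" if "e \<in> edges G" for e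
    using 1(3)[OF that] 2(3)[OF g[OF that]] assms(3) by blast
  with g show ?thesis
    unfolding hg_iso_def using 1 2
    by - (rule exI[of _ "f' \<circ> f"], rule exI[of _ "g' \<circ> g"], auto intro: bij_betw_trans)
qed

lemma label_iso_trans:
  assumes "label_iso L L'" "label_iso L' L''"
  shows "label_iso L L''"
  using assms
proof (induction arbitrary: L'' rule: label_iso.induct)
  case (3 N N' D D')
  from 3(4) obtain N'' D'' where "L'' = Div N'' D''" "label_iso N' N''" "hg_iso label_iso D' D''"
    by (cases rule: label_iso.cases) auto
  moreover have "hg_iso label_iso D D''"
    by (rule hg_iso_trans[OF 3(3) \<open>hg_iso label_iso D' D''\<close>]) blast
  ultimately show ?case using 3 by (auto intro: label_iso.intros)
next
  case (4 M M')
  from 4(2) obtain M'' where "L'' = Times M''" "hg_iso label_iso M' M''"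
    by (cases rule: label_iso.cases) auto
  moreover have "hg_iso label_iso M M''"
    by (rule hg_iso_trans[OF 4(1) \<open>hg_iso label_iso M' M''\<close>]) blast
  ultimately show ?case by (auto intro: label_iso.intros)
qed auto

inductive_cases label_iso_PrimE: "label_iso (Prim p) L"
inductive_cases label_iso_DivE: "label_iso (Div N D) L"
inductive_cases label_iso_TimesE: "label_iso (Times M) L"


section \<open>Hypergraphs as multisets of named hyperedges\<close>

text \<open>A hypergraph without isolated nodes is determined, up to isomorphism, by this multiset and
  the external nodes, provided the naming \<open>f\<close> of the nodes is injective.\<close>

definition edge_mset :: "(nat \<Rightarrow> 'c) \<Rightarrow> (nat \<Rightarrow> nat) \<Rightarrow> 'l hgraph \<Rightarrow> ('c \<times> nat list) multiset" where
  "edge_mset \<alpha> f G = {# (\<alpha> e, map f (att G e)). e \<in># mset_set (edges G) #}"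

definition names :: "('c \<times> nat list) multiset \<Rightarrow> nat set" where
  "names M = (\<Union>x\<in>set_mset M. set (snd x))"

definition rename :: "(nat \<Rightarrow> nat) \<Rightarrow> ('c \<times> nat list) multiset \<Rightarrow> ('c \<times> nat list) multiset" where
  "rename f M = image_mset (map_prod id (map f)) M"

text \<open>Isolates in \<open>edge_mset\<close> the part of a graph that a replacement leaves
  alone. The nodes are kept, so the result may have isolated nodes and is not meant as an
  antecedent.\<close>

definition delete_edge :: "'l hgraph \<Rightarrow> nat \<Rightarrow> 'l hgraph" where
  "delete_edge G e = HGraph (nodes G) (edges G - {e}) (att G) (lab G) (ext G)"

lemma delete_edge_simps [simp]:
  "nodes (delete_edge G e) = nodes G" "edges (delete_edge G e) = edges G - {e}"
  "att (delete_edge G e) = att G" "lab (delete_edge G e) = lab G" "ext (delete_edge G e) = ext G"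
  by (auto simp: delete_edge_def)

lemma names_simps [simp]:
  "names {#} = {}" "names (add_mset s M) = set (snd s) \<union> names M"
  "names (M + N) = names M \<union> names N"
  by (auto simp: names_def)

lemma names_rename [simp]: "names (rename f M) = f ` names M"
  by (auto simp: names_def rename_def)

lemma finite_names [simp]: "finite (names M)"
  by (auto simp: names_def)

lemma rename_simps [simp]:
  "rename f {#} = {#}" "rename f (add_mset (c, a) M) = add_mset (c, map f a) (rename f M)"
  "rename f (M + N) = rename f M + rename f N"
  by (auto simp: rename_def)

lemma rename_cong: "(\<And>x. x \<in> names M \<Longrightarrow> f x = g x) \<Longrightarrow> rename f M = rename g M"
  unfolding rename_def names_def by (intro image_mset_cong) force

lemma rename_comp: "rename f (rename g M) = rename (f \<circ> g) M"
  by (simp add: rename_def image_mset.compositionality comp_def map_prod_def case_prod_unfold)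

lemma rename_ident: "(\<And>x. x \<in> names M \<Longrightarrow> f x = x) \<Longrightarrow> rename f M = M"
  by (subst rename_cong[of M f id]) (auto simp: rename_def map_prod_def case_prod_unfold)

lemma rename_edge_mset: "rename f (edge_mset \<alpha> g G) = edge_mset \<alpha> (f \<circ> g) G"
  by (simp add: rename_def edge_mset_def image_mset.compositionality comp_def)

lemma edge_mset_cong:
  assumes "\<And>e. e \<in> edges G \<Longrightarrow> \<alpha> e = \<beta> e" "\<And>e. e \<in> edges G \<Longrightarrow> map f (att G e) = map g (att G e)"
  shows "edge_mset \<alpha> f G = edge_mset \<beta> g G"
  unfolding edge_mset_def
  by (cases "finite (edges G)") (auto intro!: image_mset_cong simp: assms)

lemma edge_mset_delete:
  assumes "finite (edges G)" "e \<in> edges G"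
  shows "edge_mset \<alpha> f G = add_mset (\<alpha> e, map f (att G e)) (edge_mset \<alpha> f (delete_edge G e))"
  unfolding edge_mset_def using assms by (simp add: mset_set.remove)

lemma in_edge_mset:
  "finite (edges G) \<Longrightarrow> x \<in># edge_mset \<alpha> f G \<longleftrightarrow> (\<exists>e\<in>edges G. x = (\<alpha> e, map f (att G e)))"
  by (auto simp: edge_mset_def)

lemma names_edge_mset:
  "finite (edges G) \<Longrightarrow> names (edge_mset \<alpha> f G) = f ` (\<Union>e\<in>edges G. set (att G e))"
  by (auto simp: edge_mset_def names_def)

abbreviation "internal G \<equiv> nodes G - set (ext G)"

text \<open>The part of \<open>hypergraph\<close> that does not mention ranks. Incidence arguments
  rest on this part alone; the equation of lengths that makes a replacement meaningful is passed as
  a separate hypothesis.\<close>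

definition wf_graph :: "'l hgraph \<Rightarrow> bool" where
  "wf_graph G \<longleftrightarrow> finite (nodes G) \<and> finite (edges G) \<and> (\<forall>e\<in>edges G. set (att G e) \<subseteq> nodes G) \<and>
     set (ext G) \<subseteq> nodes G \<and> distinct (ext G)"

lemma hypergraph_wf: "hypergraph rk G \<Longrightarrow> wf_graph G"
  by (auto simp: hypergraph_def wf_graph_def)

lemma names_edge_mset_nodes:
  assumes "wf_graph G" "no_isolated G"
  shows "names (edge_mset \<alpha> f G) = f ` nodes G"
  using assms by (auto simp: names_edge_mset wf_graph_def no_isolated_def)


section \<open>Replacement\<close>

lemma less_fresh: "finite A \<Longrightarrow> x \<in> A \<Longrightarrow> x < fresh A"
  by (auto simp: fresh_def less_Suc_eq_le)

lemma replace_simps [simp]: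
  "nodes (replace G e H) = nodes G \<union> node_copy G e H ` nodes H"
  "edges (replace G e H) = (edges G - {e}) \<union> edge_copy G ` edges H"
  "ext (replace G e H) = ext G"
  by (auto simp: replace_def)

lemma replace_old:
  assumes "finite (edges G)" "d \<in> edges G"
  shows "att (replace G e H) d = att G d" "lab (replace G e H) d = lab G d"
  using less_fresh[OF assms] by (auto simp: replace_def)

lemma replace_new:
  "att (replace G e H) (edge_copy G d) = map (node_copy G e H) (att H d)"
  "lab (replace G e H) (edge_copy G d) = lab H d"
  by (auto simp: replace_def edge_copy_def)

lemma inj_edge_copy: "inj (edge_copy G)"
  by (auto simp: edge_copy_def inj_on_def)

lemma edge_copy_notin: "finite (edges G) \<Longrightarrow> edge_copy G d \<notin> edges G"
  using less_fresh[of "edges G" "edge_copy G d"] by (auto simp: edge_copy_def)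

text \<open>Old and copied hyperedges have disjoint names, and the fusion of nodes is mere
  composition of the node naming with \<open>node_copy\<close>. This turns every replacement below
  into a sum of multisets.\<close>

lemma edge_mset_replace:
  assumes "finite (edges G)" "finite (edges H)"
  shows "edge_mset \<alpha> f (replace G e H) =
    edge_mset \<alpha> f (delete_edge G e) + edge_mset (\<alpha> \<circ> edge_copy G) (f \<circ> node_copy G e H) H"
proof -
  have disj: "(edges G - {e}) \<inter> edge_copy G ` edges H = {}"
    using edge_copy_notin[OF assms(1)] by auto
  have inj: "inj_on (edge_copy G) (edges H)"
    using inj_edge_copy by (rule inj_on_subset) simp
  show ?thesis
    unfolding edge_mset_def
    using assms by (simp add: mset_set_Union[OF _ _ disj] image_mset_mset_set[OF inj, symmetric]
        image_mset.compositionality comp_def replace_new)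
      (auto intro!: image_mset_cong simp: replace_old)
qed

lemma node_copy_ext:
  assumes "wf_graph H" "length (att G e) = length (ext H)"
  shows "map (node_copy G e H) (ext H) = att G e"
proof (rule nth_equalityI)
  fix i assume "i < length (map (node_copy G e H) (ext H))"
  then have "map_of (zip (ext H) (att G e)) (ext H ! i) = Some (att G e ! i)"
    using assms by (intro map_of_zip_nth) (auto simp: wf_graph_def)
  then show "map (node_copy G e H) (ext H) ! i = att G e ! i"
    using \<open>i < _\<close> by (simp add: node_copy_def)
qed (use assms in auto)

lemma node_copy_internal:
  assumes "length (att G e) = length (ext H)" "v \<notin> set (ext H)"
  shows "node_copy G e H v = v + fresh (nodes G)"
  using assms by (auto simp: node_copy_def split: option.split dest: map_of_SomeD set_zip_leftD)

lemma node_copy_notin: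
  assumes "finite (nodes G)" "length (att G e) = length (ext H)" "v \<notin> set (ext H)"
  shows "node_copy G e H v \<notin> nodes G"
  using node_copy_internal[OF assms(2,3)] less_fresh[OF assms(1)] by fastforce

lemma node_copy_ext_in:
  assumes "wf_graph G" "wf_graph H" "e \<in> edges G" "length (att G e) = length (ext H)" "v \<in> set (ext H)"
  shows "node_copy G e H v \<in> set (att G e)" "node_copy G e H v \<in> nodes G"
proof -
  show "node_copy G e H v \<in> set (att G e)"
    using assms(5) arg_cong[OF node_copy_ext[OF assms(2,4)], of set] by auto
  then show "node_copy G e H v \<in> nodes G"
    using assms by (auto simp: wf_graph_def)
qed

lemma inj_on_node_copy_internal:
  assumes "length (att G e) = length (ext H)"
  shows "inj_on (node_copy G e H) (- set (ext H))"
  using node_copy_internal[OF assms] by (auto simp: inj_on_def)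

text \<open>Nodes of \<open>H\<close> get identified only if \<open>e\<close> is attached twice to
  the same node. For translated types that happens at the loop of a bracelet or of its numerator,
  which is why those cases go through \<open>good_unfuse\<close> and \<open>good_fuse\<close>
  instead.\<close>

lemma inj_on_node_copy:
  assumes "wf_graph G" "wf_graph H" "e \<in> edges G" "length (att G e) = length (ext H)"
    "distinct (att G e)"
  shows "inj_on (node_copy G e H) UNIV"
proof (rule inj_onI)
  fix v w assume eq: "node_copy G e H v = node_copy G e H w"
  have fin: "finite (nodes G)" using assms(1) by (simp add: wf_graph_def)
  consider "v \<in> set (ext H)" "w \<in> set (ext H)" | "v \<notin> set (ext H)" "w \<notin> set (ext H)"
    | "v \<in> set (ext H)" "w \<notin> set (ext H)" | "v \<notin> set (ext H)" "w \<in> set (ext H)"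
    by blast
  then show "v = w"
  proof cases
    case 1
    then show ?thesis
      using eq assms(5) node_copy_ext[OF assms(2,4)] distinct_map[of "node_copy G e H" "ext H"]
      by (auto dest: inj_onD)
  next
    case 2
    then show ?thesis using eq node_copy_internal[OF assms(4)] by auto
  next
    case 3
    then show ?thesis
      using eq node_copy_ext_in(2)[OF assms(1-4)] node_copy_notin[OF fin assms(4)] by metis
  next
    case 4
    then show ?thesis
      using eq node_copy_ext_in(2)[OF assms(1-4)] node_copy_notin[OF fin assms(4)] by metis
  qed
qed

lemma wf_graph_replace:
  assumes "wf_graph G" "wf_graph H" "e \<in> edges G" "length (att G e) = length (ext H)"
  shows "wf_graph (replace G e H)"
  unfolding wf_graph_def replace_simps
proof (intro conjI ballI)
  fix d assume "d \<in> edges G - {e} \<union> edge_copy G ` edges H"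
  then show "set (att (replace G e H) d) \<subseteq> nodes G \<union> node_copy G e H ` nodes H"
  proof
    assume "d \<in> edges G - {e}"
    then show ?thesis using assms(1) by (auto simp: wf_graph_def replace_old)
  next
    assume "d \<in> edge_copy G ` edges H"
    then show ?thesis using assms(2) by (force simp: wf_graph_def replace_new)
  qed
qed (use assms in \<open>auto simp: wf_graph_def dest: subsetD\<close>)

lemma hypergraph_replace:
  assumes "hypergraph rk G" "hypergraph rk H" "e \<in> edges G" "length (att G e) = length (ext H)"
  shows "hypergraph rk (replace G e H)"
proof -
  have "wf_graph (replace G e H)"
    by (intro wf_graph_replace hypergraph_wf[of rk] assms)
  moreover have "length (att (replace G e H) d) = rank rk (lab (replace G e H) d)"
    if "d \<in> edges (replace G e H)" for d
    using that assms by (auto simp: hypergraph_def replace_old replace_new)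
  ultimately show ?thesis by (auto simp: hypergraph_def wf_graph_def)
qed

text \<open>The nodes at risk are those that lose \<open>e\<close>. Each of them is the image of an
  external node of \<open>H\<close>, and that node lies on a hyperedge of \<open>H\<close>.\<close>

lemma no_isolated_replace:
  assumes "wf_graph G" "wf_graph H" "e \<in> edges G" "length (att G e) = length (ext H)"
    and "no_isolated G" "no_isolated H"
  shows "no_isolated (replace G e H)"
proof -
  have new: "\<exists>d\<in>edges (replace G e H). node_copy G e H v \<in> set (att (replace G e H) d)"
    if v: "v \<in> nodes H" for v
  proof -
    obtain d where "d \<in> edges H" "v \<in> set (att H d)"
      using \<open>no_isolated H\<close> v by (auto simp: no_isolated_def)
    then show ?thesis by (intro bexI[of _ "edge_copy G d"]) (auto simp: replace_new)
  qed
  have old: "\<exists>d\<in>edges (replace G e H). v \<in> set (att (replace G e H) d)" if v: "v \<in> nodes G" for v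
  proof (cases "v \<in> set (att G e)")
    case True
    then obtain w where "w \<in> set (ext H)" "v = node_copy G e H w"
      using arg_cong[OF node_copy_ext[OF assms(2,4)], of set] by auto
    then show ?thesis using new[of w] assms(2) by (auto simp: wf_graph_def)
  next
    case False
    then obtain d where "d \<in> edges G" "d \<noteq> e" "v \<in> set (att G d)"
      using \<open>no_isolated G\<close> v by (auto simp: no_isolated_def)
    then show ?thesis
      using assms(1) by (intro bexI[of _ d]) (auto simp: replace_old wf_graph_def)
  qed
  from old new show ?thesis unfolding no_isolated_def by auto
qed

section \<open>Walks\<close>

text \<open>A step \<open>(A, b, y)\<close> traverses an \<open>A\<close>-labelled hyperedge towards the node \<open>y\<close>, along its
  direction iff \<open>b\<close> holds.\<close>

fun walk :: "('a \<Rightarrow> 'c) \<Rightarrow> nat \<Rightarrow> ('a \<times> bool \<times> nat) list \<Rightarrow> ('c \<times> nat list) list" where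
  "walk t x [] = []"
| "walk t x ((A, b, y) # ws) = (t A, if b then [x, y] else [y, x]) # walk t y ws"

fun final :: "nat \<Rightarrow> ('a \<times> bool \<times> nat) list \<Rightarrow> nat" where
  "final x [] = x"
| "final x ((A, b, y) # ws) = final y ws"

text \<open>The reversed walk starts at \<open>final x ws\<close>. A step records only the node it
  leads to, so the start \<open>x\<close> must be supplied as the last node reached.\<close>

fun backward :: "nat \<Rightarrow> ('a \<times> bool \<times> nat) list \<Rightarrow> ('a \<times> bool \<times> nat) list" where
  "backward x [] = []"
| "backward x ((A, b, y) # ws) = backward y ws @ [(A, \<not> b, x)]"

definition stops :: "('a \<times> bool \<times> nat) list \<Rightarrow> nat list" where
  "stops ws = map (snd \<circ> snd) ws"

text \<open>The start is not among the stops, so dropping the last stop leaves the nodes strictly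
  between the ends; for a cycle the closing node is left out as well.\<close>

definition inner :: "('a \<times> bool \<times> nat) list \<Rightarrow> nat list" where
  "inner ws = butlast (stops ws)"

definition signs :: "('a \<times> bool \<times> nat) list \<Rightarrow> ('a \<times> bool) list" where
  "signs ws = map (\<lambda>(A, b, y). (A, b)) ws"

definition flip :: "('a \<times> bool) list \<Rightarrow> ('a \<times> bool) list" where
  "flip w = rev (map (\<lambda>(A, b). (A, \<not> b)) w)"

definition move :: "(nat \<Rightarrow> nat) \<Rightarrow> ('a \<times> bool \<times> nat) list \<Rightarrow> ('a \<times> bool \<times> nat) list" where
  "move f ws = map (\<lambda>(A, b, y). (A, b, f y)) ws"

lemma stops_simps [simp]:
  "stops [] = []" "stops ((A, b, y) # ws) = y # stops ws" "stops (us @ vs) = stops us @ stops vs"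
  "stops ws = [] \<longleftrightarrow> ws = []"
  by (auto simp: stops_def)

lemma signs_simps [simp]:
  "signs [] = []" "signs ((A, b, y) # ws) = (A, b) # signs ws" "signs (us @ vs) = signs us @ signs vs"
  "signs ws = [] \<longleftrightarrow> ws = []"
  by (auto simp: signs_def)

lemma flip_simps [simp]:
  "flip [] = []" "flip ((A, b) # w) = flip w @ [(A, \<not> b)]" "flip (v @ w) = flip w @ flip v"
  "flip (flip w) = w" "flip w = [] \<longleftrightarrow> w = []"
  by (auto simp: flip_def rev_map comp_def case_prod_unfold)

lemma move_simps [simp]:
  "move f [] = []" "move f ((A, b, y) # ws) = (A, b, f y) # move f ws"
  "move f ws = [] \<longleftrightarrow> ws = []"
  by (auto simp: move_def)

lemma final_conv: "final x ws = last (x # stops ws)"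
  by (induction x ws rule: final.induct) auto

lemma stops_conv_inner: "ws \<noteq> [] \<Longrightarrow> stops ws = inner ws @ [final x ws]"
  by (simp add: inner_def final_conv)

lemma final_append [simp]: "final x (us @ vs) = final (final x us) vs"
  by (induction x us rule: final.induct) auto

lemma final_in_stops: "ws \<noteq> [] \<Longrightarrow> final x ws \<in> set (stops ws)"
  by (simp add: stops_conv_inner[of ws x])

lemma walk_append [simp]: "walk t x (us @ vs) = walk t x us @ walk t (final x us) vs"
  by (induction t x us rule: walk.induct) auto

lemma walk_eq_Nil [simp]: "walk t x ws = [] \<longleftrightarrow> ws = []"
  by (cases ws) auto

lemma names_walk:
  "names (mset (walk t x ws)) = (if ws = [] then {} else insert x (set (stops ws)))"
proof (induction t x ws rule: walk.induct)
  case (2 t x A b y ws)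
  then show ?case by (cases ws) auto
qed simp

lemma backward_eq_Nil [simp]: "backward x ws = [] \<longleftrightarrow> ws = []"
  by (cases ws) auto

lemma final_backward [simp]: "final y (backward x ws) = (if ws = [] then y else x)"
  by (induction x ws arbitrary: y rule: backward.induct) auto

lemma backward_append: "backward x (us @ vs) = backward (final x us) vs @ backward x us"
  by (induction x us rule: backward.induct) auto

lemma mset_walk_backward: "mset (walk t (final x ws) (backward x ws)) = mset (walk t x ws)"
proof (induction x ws rule: backward.induct)
  case (2 x A b y ws)
  then show ?case by (cases "ws = []") auto
qed simp

lemma stops_backward: "final x ws # stops (backward x ws) = rev (x # stops ws)"
  by (induction x ws rule: backward.induct) (auto simp flip: append_Cons)

lemma inner_backward: "inner (backward x ws) = rev (inner ws)"
proof -
  have "stops (backward x ws) = tl (rev (x # stops ws))"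
    using arg_cong[OF stops_backward[of x ws], of tl] by simp
  then have "inner (backward x ws) = butlast (tl (rev (x # stops ws)))"
    by (simp add: inner_def)
  also have "\<dots> = rev (inner ws)"
    by (cases "stops ws" rule: rev_cases) (auto simp: inner_def butlast_append)
  finally show ?thesis .
qed

lemma signs_backward: "signs (backward x ws) = flip (signs ws)"
  by (induction x ws rule: backward.induct) auto

lemma stops_move: "stops (move f ws) = map f (stops ws)"
  by (auto simp: stops_def move_def)

lemma final_move: "final (f x) (move f ws) = f (final x ws)"
  by (induction x ws rule: final.induct) auto

lemma signs_move: "signs (move f ws) = signs ws"
  by (auto simp: signs_def move_def)

lemma rename_walk: "rename f (mset (walk t x ws)) = mset (walk t (f x) (move f ws))"
  by (induction t x ws rule: walk.induct) auto

lemma walk_edgeE: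
  assumes "(c, [u, v]) \<in> set (walk t x ws)"
  obtains us A b z vs where "ws = us @ (A, b, z) # vs" "c = t A"
    "if b then final x us = u \<and> z = v else final x us = v \<and> z = u"
proof -
  have "\<exists>us A b z vs. ws = us @ (A, b, z) # vs \<and> c = t A \<and>
      (if b then final x us = u \<and> z = v else final x us = v \<and> z = u)"
    using assms
  proof (induction t x ws rule: walk.induct)
    case (2 t x A b y ws)
    show ?case
    proof (cases "(c, [u, v]) \<in> set (walk t y ws)")
      case True
      from 2(1)[OF True] obtain us A' b' z vs where "ws = us @ (A', b', z) # vs" "c = t A'"
        "if b' then final y us = u \<and> z = v else final y us = v \<and> z = u"
        by blast
      then show ?thesis
        by (intro exI[of _ "(A, b, y) # us"] exI[of _ A'] exI[of _ b'] exI[of _ z] exI[of _ vs]) auto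
    next
      case False
      then have "c = t A" "[u, v] = (if b then [x, y] else [y, x])" using 2(2) by auto
      then show ?thesis
        by (intro exI[of _ "[]"] exI[of _ A] exI[of _ b] exI[of _ y] exI[of _ ws])
          (auto split: if_splits)
    qed
  qed simp
  then show ?thesis using that by blast
qed

lemma walk_rotate:
  assumes "final x (us @ vs) = x"
  shows "mset (walk t (final x us) (vs @ us)) = mset (walk t x (us @ vs))"
    and "final (final x us) (vs @ us) = final x us"
  using assms by auto

text \<open>Since the nodes are distinct, only one edge touches the start, and this edge determines
  the first step; the rest follows by induction.\<close>

lemma walk_unique:
  assumes "inj t" "mset (walk t x ws) = mset (walk t x ws')"
    and "distinct (x # stops ws)" "distinct (x # stops ws')"
  shows "ws = ws'"
  using assms(2-)
proof (induction ws arbitrary: x ws')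
  case Nil
  then show ?case by simp
next
  case (Cons s vs)
  obtain A b y where s: "s = (A, b, y)" by (cases s)
  have "ws' \<noteq> []" using Cons.prems(1) s by auto
  then obtain A' b' y' vs' where ws': "ws' = (A', b', y') # vs'" by (cases ws') auto
  let ?e = "\<lambda>A b y. (t A, if b then [x, y] else [y, x])"
  have "x \<notin> names (mset (walk t y' vs'))"
    using Cons.prems(3) ws' by (auto simp: names_walk)
  then have "?e A b y \<notin> set (walk t y' vs')"
    unfolding names_def by fastforce
  moreover have "?e A b y \<in># mset (walk t x ws')"
    unfolding Cons.prems(1)[symmetric] s by auto
  ultimately have "?e A b y = ?e A' b' y'" using ws' by auto
  then have eq: "A = A'" "b = b'" "y = y'"
    using assms(1) Cons.prems(2,3) s ws' by (auto dest: injD split: if_splits)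
  then have "mset (walk t y vs) = mset (walk t y vs')"
    using Cons.prems(1) s ws' by auto
  then have "vs = vs'"
    by (rule Cons.IH) (use Cons.prems s ws' eq in auto)
  then show ?case using s ws' eq by simp
qed

section \<open>Derivable sequents are paths and cycles\<close>

fun letter :: "'q ltype \<times> bool \<Rightarrow> 'q ltype" where
  "letter (A, b) = (if b then A else Rev A)"

definition word :: "('q ltype \<times> bool \<times> nat) list \<Rightarrow> 'q ltype list" where
  "word ws = map letter (signs ws)"

lemma word_simps [simp]:
  "word [] = []" "word ((A, b, y) # ws) = letter (A, b) # word ws" "word (us @ vs) = word us @ word vs"
  "word ws = [] \<longleftrightarrow> ws = []"
  by (auto simp: word_def simp del: letter.simps)

lemma word_move [simp]: "word (move f ws) = word ws"
  by (simp add: word_def signs_move)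

section \<open>Reversal and rotation of words in the Lambek calculus\<close>

lemma lbr_cut: "lbr \<Pi> A \<Longrightarrow> \<Pi> \<noteq> [] \<Longrightarrow> lbr (\<Gamma> @ A # \<Delta>) B \<Longrightarrow> lbr (\<Gamma> @ \<Pi> @ \<Delta>) B"
  using lbr.Cut[of \<Pi> A \<Gamma> \<Delta> B] by simp

lemma lbr_list_cut:
  assumes "list_all2 (\<lambda>A B. lbr [A] B) \<Gamma> \<Delta>" "lbr (\<Theta> @ \<Delta>) C"
  shows "lbr (\<Theta> @ \<Gamma>) C"
  using assms
proof (induction arbitrary: \<Theta> rule: list_all2_induct)
  case (Cons A \<Gamma> B \<Delta>)
  have "lbr ((\<Theta> @ [A]) @ \<Delta>) C"
    using lbr_cut[OF Cons.hyps(1), of \<Theta> \<Delta> C] Cons.prems by simp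
  from Cons.IH[OF this] show ?case by simp
qed simp

text \<open>For letters read forwards this is the rule \<open>RevRev\<close> itself. A letter
  \<open>Rev A\<close>, read from a backward edge, becomes \<open>A\<close> in the reversed walk,
  whereas \<open>RevRev\<close> yields \<open>Rev (Rev A)\<close>; cuts with \<open>A\<close> to
  \<open>Rev (Rev A)\<close> repair the difference.\<close>

lemma lbr_word_backward:
  assumes "lbr (word ws) B" "ws \<noteq> []"
  shows "lbr (word (backward x ws)) (Rev B)"
proof -
  have "lbr (rev (map Rev (word ws))) (Rev B)"
    using assms by (intro lbr.RevRev) auto
  moreover have "list_all2 (\<lambda>A B. lbr [A] B) (word (backward x ws)) (rev (map Rev (word ws)))"
    unfolding word_def signs_backward flip_def
    by (auto simp: list_all2_map1 list_all2_map2 rev_map[symmetric]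
        intro!: list_all2_refl lbr.Ax lbr.RRR)
  ultimately show ?thesis using lbr_list_cut[of _ _ "[]"] by simp
qed

text \<open>The detour leads through the doubled bracelet: \<open>AxRevBrace\<close> gives
  \<open>Brace (Brace A)\<close>, and \<open>BraceL\<close> applied to an axiom collapses
  it.\<close>

lemma lbr_Rev_Brace: "lbr [Rev (Brace A)] (Brace A)"
  using lbr_cut[OF lbr.AxRevBrace[of "Brace A"], of "[]" "[]"] lbr.BraceL[OF lbr.Ax[of "Brace A"]]
  by simp

lemma lbr_backward_Brace:
  assumes "lbr (word ws) (Brace B)" "ws \<noteq> []"
  shows "lbr (word (backward x ws)) (Brace B)"
  using lbr_cut[OF lbr_word_backward[OF assms, of x], of "[]" "[]" "Brace B"] lbr_Rev_Brace[of B]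
    assms(2) by simp

lemma lbr_RR_elim: "lbr \<Gamma> (Rev (Rev A)) \<Longrightarrow> \<Gamma> \<noteq> [] \<Longrightarrow> lbr \<Gamma> A"
  using lbr_cut[of \<Gamma> "Rev (Rev A)" "[]" "[]" A] lbr.RRL[of "[]" A "[]" A] lbr.Ax[of A]
  by simp

lemma lbr_word_rotate:
  assumes "lbr (word (us @ vs)) (Brace B)"
  shows "lbr (word (vs @ us)) (Brace B)"
  using assms lbr.Rotate[of "word us" "word vs"] by (cases "us = [] \<or> vs = []") auto

text \<open>The labels occurring in derivations of translated sequents are the translations and the types
  \<open>\<times>(Loop(tr A))\<close> of rank 0.\<close>

datatype 'q xtype = Binary "'q ltype" | Nullary "'q ltype"

fun trx :: "('q \<Rightarrow> 'p) \<Rightarrow> 'q xtype \<Rightarrow> 'p label" where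
  "trx \<iota> (Binary A) = tr \<iota> A"
| "trx \<iota> (Nullary A) = Times (loop (tr \<iota> A))"

abbreviation "binary_walk x ws \<equiv> mset (walk Binary x ws)"

text \<open>On a cycle \<open>x\<close> is already the last entry of \<open>stops ws\<close>, so
  distinctness is asked of the stops alone. The word is tested against \<open>Brace B\<close>
  because, by \<open>lbr_word_rotate\<close> and \<open>lbr_backward_Brace\<close>, this test does
  not depend on the chosen start and direction.\<close>

fun good :: "'q xtype \<Rightarrow> ('q xtype \<times> nat list) multiset \<Rightarrow> nat list \<Rightarrow> bool" where
  "good (Binary B) M xs \<longleftrightarrow> (\<exists>x ws. ws \<noteq> [] \<and> distinct (x # stops ws) \<and>
     M = binary_walk x ws \<and> xs = [x, final x ws] \<and> lbr (word ws) B)"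
| "good (Nullary B) M xs \<longleftrightarrow> xs = [] \<and>
     ((\<exists>x ws. ws \<noteq> [] \<and> distinct (stops ws) \<and> final x ws = x \<and>
        M = binary_walk x ws \<and> lbr (word ws) (Brace B)) \<or>
      (\<exists>A. M = {#(Nullary A, [])#} \<and> lbr [A] (Brace B)))"

section \<open>Operations on good paths and cycles\<close>

lemma good_rename:
  assumes "good X M xs" "inj_on f (names M \<union> set xs)"
  shows "good X (rename f M) (map f xs)"
proof (cases X)
  case (Binary B)
  then obtain x ws where 1: "ws \<noteq> []" "distinct (x # stops ws)" "M = binary_walk x ws"
    "xs = [x, final x ws]" "lbr (word ws) B"
    using assms(1) by auto
  have "inj_on f (set (x # stops ws))"
    using assms(2) 1 by (auto simp: names_walk elim: inj_on_subset)
  then have "distinct (map f (x # stops ws))"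
    using 1(2) distinct_map by blast
  then show ?thesis
    unfolding Binary good.simps using 1
    by (intro exI[of _ "f x"] exI[of _ "move f ws"]) (auto simp: stops_move rename_walk final_move)
next
  case (Nullary B)
  consider x ws where "ws \<noteq> []" "distinct (stops ws)" "final x ws = x" "M = binary_walk x ws"
      "lbr (word ws) (Brace B)" "xs = []"
    | A where "M = {#(Nullary A, [])#}" "lbr [A] (Brace B)" "xs = []"
    using assms(1) Nullary by auto
  then show ?thesis
  proof cases
    case 1
    have "inj_on f (set (stops ws))"
      using assms(2) 1 by (auto simp: names_walk elim: inj_on_subset)
    then have "distinct (map f (stops ws))"
      using 1(2) distinct_map by blast
    moreover have "final (f x) (move f ws) = f x" by (simp add: final_move 1)
    ultimately show ?thesis
      unfolding Nullary good.simps using 1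
      by (intro conjI disjI1 exI[of _ "f x"] exI[of _ "move f ws"])
        (auto simp: stops_move rename_walk)
  qed (auto simp: Nullary)
qed

lemma good_unrename:
  assumes "good X (rename f M) (map f xs)" "inj_on f (names M \<union> set xs)"
  shows "good X M xs"
proof -
  define g where "g = inv_into (names M \<union> set xs) f"
  have g: "g (f x) = x" if "x \<in> names M \<union> set xs" for x
    unfolding g_def by (rule inv_into_f_f[OF assms(2) that])
  have "good X (rename g (rename f M)) (map g (map f xs))"
    by (rule good_rename[OF assms(1)]) (auto simp: inj_on_def g)
  moreover have "rename g (rename f M) = M"
    unfolding rename_comp by (rule rename_ident) (simp add: g)
  moreover have "map g (map f xs) = xs"
    by (simp add: map_idI g)
  ultimately show ?thesis by simp
qed

text \<open>Splicing \<open>qs\<close> in for an edge is \<open>Cut\<close> at the letter of that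
  edge. If the walk traverses the edge backwards, the reversal of \<open>qs\<close> is spliced in;
  it derives the reversed letter by \<open>lbr_word_backward\<close>. Paths and cycles both use
  this.\<close>

lemma walk_subst:
  assumes M: "add_mset (Binary A, [u, v]) M = binary_walk x ws"
    and qs: "qs \<noteq> []" "final u qs = v" "distinct (inner qs)"
      "set (inner qs) \<inter> (names M \<union> {u, v}) = {}" "lbr (word qs) A"
  shows "\<exists>ws'. ws' \<noteq> [] \<and> M + binary_walk u qs = binary_walk x ws' \<and>
    final x ws' = final x ws \<and> set (stops ws') = set (stops ws) \<union> set (inner qs) \<and>
    (distinct (stops ws) \<longrightarrow> distinct (stops ws')) \<and> (\<forall>C. lbr (word ws) C \<longrightarrow> lbr (word ws') C)"
proof -
  have "(Binary A, [u, v]) \<in> set (walk Binary x ws)"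
    using M by (metis set_mset_mset union_single_eq_member)
  then obtain us b z vs where ws: "ws = us @ (A, b, z) # vs"
    and b: "if b then final x us = u \<and> z = v else final x us = v \<and> z = u"
    by (rule walk_edgeE) auto
  define rs where "rs = (if b then qs else backward u qs)"
  have rs: "rs \<noteq> []" "final (final x us) rs = z" "distinct (inner rs)" "set (inner rs) = set (inner qs)"
    "binary_walk (final x us) rs = binary_walk u qs" "lbr (word rs) (letter (A, b))"
    using b qs mset_walk_backward[of Binary u qs] lbr_word_backward[OF qs(5,1)]
    by (auto simp: rs_def inner_backward split: if_splits)
  have st: "stops rs = inner rs @ [z]"
    using stops_conv_inner[OF rs(1), of "final x us"] rs(2) by simp
  have stops: "set (stops ws) \<subseteq> names M \<union> {u, v}"
    using arg_cong[OF M, of names] by (auto simp: names_walk split: if_splits)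
  show ?thesis
  proof (intro exI conjI allI impI)
    show "M + binary_walk u qs = binary_walk x (us @ rs @ vs)"
    proof -
      have "M = binary_walk x us + binary_walk z vs"
        using M b by (auto simp: ws split: if_splits)
      then show ?thesis using rs(2,5) by simp
    qed
    show "set (stops (us @ rs @ vs)) = set (stops ws) \<union> set (inner qs)"
      using st rs(4) by (auto simp: ws)
    show "distinct (stops (us @ rs @ vs))" if "distinct (stops ws)"
      using that st rs(3,4) qs(4) stops by (auto simp: ws)
    show "lbr (word (us @ rs @ vs)) C" if "lbr (word ws) C" for C
      using lbr_cut[OF rs(6), of "word us" "word vs" C] that rs(1) by (simp add: ws)
  qed (use rs in \<open>auto simp: ws\<close>)
qed

lemma good_subst:
  assumes "good X (add_mset (Binary A, [u, v]) M) xs"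
    and qs: "qs \<noteq> []" "final u qs = v" "distinct (inner qs)"
      "set (inner qs) \<inter> (names M \<union> {u, v} \<union> set xs) = {}" "lbr (word qs) A"
  shows "good X (M + binary_walk u qs) xs"
proof (cases X)
  case (Binary B)
  then obtain x ws where 1: "ws \<noteq> []" "distinct (x # stops ws)"
    "add_mset (Binary A, [u, v]) M = binary_walk x ws" "xs = [x, final x ws]" "lbr (word ws) B"
    using assms(1) by auto
  have "set (inner qs) \<inter> (names M \<union> {u, v}) = {}" using qs(4) by auto
  from walk_subst[OF 1(3) qs(1-3) this qs(5)] obtain ws' where 2: "ws' \<noteq> []"
    "M + binary_walk u qs = binary_walk x ws'"
    "final x ws' = final x ws" "set (stops ws') = set (stops ws) \<union> set (inner qs)"
    "distinct (stops ws')" "lbr (word ws') B"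
    using 1(2,5) by (metis distinct.simps(2))
  then show ?thesis
    using 1 qs(4) unfolding Binary good.simps by (intro exI[of _ x] exI[of _ ws']) auto
next
  case (Nullary B)
  then obtain x ws where 1: "ws \<noteq> []" "distinct (stops ws)" "final x ws = x" "xs = []"
    "add_mset (Binary A, [u, v]) M = binary_walk x ws" "lbr (word ws) (Brace B)"
    using assms(1) by auto
  have "set (inner qs) \<inter> (names M \<union> {u, v}) = {}" using qs(4) by auto
  from walk_subst[OF 1(5) qs(1-3) this qs(5)] obtain ws' where 2: "ws' \<noteq> []"
    "M + binary_walk u qs = binary_walk x ws'"
    "final x ws' = final x ws" "distinct (stops ws')" "lbr (word ws') (Brace B)"
    using 1(2,6) by metis
  then show ?thesis
    using 1 unfolding Nullary good.simps by (intro conjI disjI1 exI[of _ x] exI[of _ ws']) auto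
qed

text \<open>A cycle may be rotated and, with a bracelet as succedent, also reversed. Hence any
  prescribed edge may be taken to be the first one and to be traversed forwards.\<close>

lemma cycle_start:
  assumes "(Binary A, [u, v]) \<in> set (walk Binary x ws)"
    and ws: "distinct (stops ws)" "final x ws = x" "lbr (word ws) (Brace C)"
  obtains vs where "binary_walk u ((A, True, v) # vs) = binary_walk x ws"
    "distinct (v # stops vs)" "final v vs = u" "lbr (A # word vs) (Brace C)"
proof -
  obtain us b z vs where s: "ws = us @ (A, b, z) # vs"
    and b: "if b then final x us = u \<and> z = v else final x us = v \<and> z = u"
    using assms(1) by (rule walk_edgeE) auto
  show ?thesis
  proof (cases b)
    case True
    show ?thesis
    proof (rule that[of "vs @ us"])
      show "lbr (A # word (vs @ us)) (Brace C)"
        using lbr_word_rotate[of us "(A, b, z) # vs"] ws(3) s True by simp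
    qed (use s b ws True in auto)
  next
    case False
    show ?thesis
    proof (rule that[of "backward x us @ backward u vs"])
      have B: "backward x ws = backward u vs @ (A, True, v) # backward x us"
        using s b False by (simp add: backward_append)
      have fv: "final x us = v" "final u vs = x"
        using s b ws(2) False by simp_all
      then have fin: "final x (backward u vs) = u" and fin': "final v (backward x us) = x"
        by auto
      have "binary_walk x (backward x ws) = binary_walk x ws"
        using mset_walk_backward[of Binary x ws] ws(2) by simp
      then show "binary_walk u ((A, True, v) # backward x us @ backward u vs) =
          binary_walk x ws"
        unfolding B by (simp add: fin fin' add.commute del: final_backward)
      have "distinct (stops (backward x ws))"
      proof -
        have "stops (backward x ws) = rev (inner ws) @ [x]"
          using s ws(2) stops_conv_inner[of "backward x ws" x] by (simp add: inner_backward)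
        moreover have "stops ws = inner ws @ [x]"
          using s ws(2) stops_conv_inner[of ws x] by simp
        ultimately show ?thesis using ws(1) by simp
      qed
      then show "distinct (v # stops (backward x us @ backward u vs))"
        unfolding B by auto
      show "final v (backward x us @ backward u vs) = u"
        by (simp add: fin fin' del: final_backward)
      have "lbr (word (backward x ws)) (Brace C)"
        using ws(3) s by (intro lbr_backward_Brace) auto
      then show "lbr (A # word (backward x us @ backward u vs)) (Brace C)"
        using lbr_word_rotate[of "backward u vs" "(A, True, v) # backward x us"] unfolding B by simp
    qed
  qed
qed

lemma notin_namesD: "x \<notin> names M \<Longrightarrow> x \<in> set a \<Longrightarrow> (c, a) \<notin># M"
  by (force simp: names_def)

text \<open>As \<open>m\<close> does not occur in \<open>M\<close>, the step leaving
  \<open>m\<close> can only use the \<open>B\<close>-edge; \<open>m \<noteq> v\<close> fixes its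
  direction.\<close>

lemma walk_contract:
  assumes M: "add_mset (Binary A, [u, m]) (add_mset (Binary B, [m, v]) M) =
      binary_walk x (us @ (A, True, m) # vs)"
    and "final x us = u" "vs \<noteq> []" and m: "m \<notin> names M" "m \<noteq> v"
  obtains vs' where "vs = (B, True, v) # vs'"
    "add_mset (Binary (Prod A B), [u, v]) M = binary_walk x (us @ (Prod A B, True, v) # vs')"
proof -
  obtain C c y vs' where vs: "vs = (C, c, y) # vs'" using \<open>vs \<noteq> []\<close> by (cases vs) auto
  let ?e = "(Binary C, if c then [m, y] else [y, m])"
  have M': "add_mset (Binary B, [m, v]) M = binary_walk x us + binary_walk m vs"
    using M assms(2) by simp
  then have "?e \<in># add_mset (Binary B, [m, v]) M" using vs by simp
  moreover have "?e \<notin># M" using m(1) by (rule notin_namesD) auto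
  ultimately have "?e = (Binary B, [m, v])" by auto
  then have "vs = (B, True, v) # vs'" using m(2) vs by (auto split: if_splits)
  then show ?thesis using that[of vs'] M' assms(2) by simp
qed

lemma good_reverse: "good (Binary A) M [x, y] \<Longrightarrow> good (Binary (Rev A)) M [y, x]"
proof -
  assume "good (Binary A) M [x, y]"
  then obtain ws where 1: "ws \<noteq> []" "distinct (x # stops ws)" "M = binary_walk x ws"
    "y = final x ws" "lbr (word ws) A"
    by auto
  have "distinct (y # stops (backward x ws))"
    using 1(2) unfolding 1(4) stops_backward by simp
  then show ?thesis
    unfolding good.simps using 1 lbr_word_backward[OF 1(5,1)] mset_walk_backward[of Binary x ws]
    by (intro exI[of _ y] exI[of _ "backward x ws"]) auto
qed

text \<open>Reversing once more yields \<open>Rev (Rev A)\<close>, and \<open>lbr_RR_elim\<close>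
  removes the double reversal.\<close>

lemma good_unreverse: "good (Binary (Rev A)) M [y, x] \<Longrightarrow> good (Binary A) M [x, y]"
  using good_reverse[of "Rev A" M y x] lbr_RR_elim[of "word ws" A for ws] by fastforce

text \<open>This is \<open>ProdL\<close> on a path or cycle: the middle node \<open>m\<close> lies
  on no other edge, so the walk passes the two edges consecutively. If it passes them backwards, a
  path is reversed before and after the contraction, and a cycle is reoriented by
  \<open>cycle_start\<close>.\<close>

lemma good_contract:
  assumes good: "good X (add_mset (Binary A, [u, m]) (add_mset (Binary B, [m, v]) M)) xs"
    and m: "m \<notin> names M" "m \<notin> set xs" "m \<noteq> u" "m \<noteq> v"
  shows "good X (add_mset (Binary (Prod A B), [u, v]) M) xs"
proof (cases X)
  case (Binary C)
  let ?M = "add_mset (Binary A, [u, m]) (add_mset (Binary B, [m, v]) M)"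
    and ?N = "add_mset (Binary (Prod A B), [u, v]) M"
  \<comment> \<open>Stated for every succedent \<open>C\<close>, because it is applied to the given
    path and, with \<open>Rev C\<close>, to the reversed one.\<close>
  have forward: "good (Binary C) ?N [x, final x ws]"
    if ws: "distinct (x # stops ws)" "?M = binary_walk x ws" "lbr (word ws) C" "final x ws \<noteq> m"
      "ws = us @ (A, True, m) # vs" "final x us = u" for x ws us vs C
  proof -
    have "vs \<noteq> []" using ws(4,5) by auto
    from walk_contract[OF ws(2)[unfolded ws(5)] ws(6) this m(1,4)] obtain vs' where
      2: "vs = (B, True, v) # vs'" "?N = binary_walk x (us @ (Prod A B, True, v) # vs')"
      by auto
    have "lbr (word (us @ (Prod A B, True, v) # vs')) C"
      using lbr.ProdL[of "word us" A B "word vs'" C] ws(3,5) 2(1) by simp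
    then show ?thesis
      unfolding good.simps using ws 2
      by (intro exI[of _ x] exI[of _ "us @ (Prod A B, True, v) # vs'"]) auto
  qed
  obtain x ws where 1: "ws \<noteq> []" "distinct (x # stops ws)" "xs = [x, final x ws]"
    "?M = binary_walk x ws" "lbr (word ws) C"
    using good Binary by auto
  have "(Binary A, [u, m]) \<in> set (walk Binary x ws)"
    using 1(4) by (metis set_mset_mset union_single_eq_member)
  then obtain us b z vs where ws: "ws = us @ (A, b, z) # vs"
    and b: "if b then final x us = u \<and> z = m else final x us = m \<and> z = u"
    by (rule walk_edgeE) auto
  show ?thesis
  proof (cases b)
    case True
    then show ?thesis
      using forward[OF 1(2,4,5), of us vs] 1(3) m(2) ws b by (simp add: Binary del: good.simps)
  next
    case False
    let ?y = "final x ws" and ?ws = "backward x ws"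
    have split: "?ws = backward u vs @ (A, True, m) # backward x us" and fin: "final ?y (backward u vs) = u"
      using ws b False by (auto simp: backward_append)
    have "distinct (?y # stops ?ws)" using 1(2) unfolding stops_backward by simp
    moreover have "?M = binary_walk ?y ?ws" using 1(4) by (simp add: mset_walk_backward)
    moreover have "final ?y ?ws = x" using 1(1) by simp
    ultimately have "good (Binary (Rev C)) ?N [?y, x]"
      using forward[of ?y ?ws "Rev C", OF _ _ lbr_word_backward[OF 1(5,1)] _ split fin] 1(3) m(2)
      by (simp del: good.simps)
    then show ?thesis using good_unreverse 1(3) by (simp add: Binary del: good.simps)
  qed
next
  case (Nullary C)
  then obtain x ws where 1: "ws \<noteq> []" "distinct (stops ws)" "final x ws = x" "xs = []"
    "add_mset (Binary A, [u, m]) (add_mset (Binary B, [m, v]) M) = binary_walk x ws"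
    "lbr (word ws) (Brace C)"
    using good by auto
  have "(Binary A, [u, m]) \<in> set (walk Binary x ws)"
    using 1(5) by (metis set_mset_mset union_single_eq_member)
  from cycle_start[OF this 1(2,3,6)] obtain vs where
    2: "binary_walk u ((A, True, m) # vs) = binary_walk x ws"
    "distinct (m # stops vs)" "final m vs = u" "lbr (A # word vs) (Brace C)" by blast
  have "vs \<noteq> []" using 2(3) m(3) by auto
  have "add_mset (Binary A, [u, m]) (add_mset (Binary B, [m, v]) M) =
        binary_walk u ([] @ (A, True, m) # vs)" using 1(5) 2(1) by simp
  from walk_contract[OF this _ \<open>vs \<noteq> []\<close> m(1,4)] obtain vs' where
    3: "vs = (B, True, v) # vs'"
    "add_mset (Binary (Prod A B), [u, v]) M = binary_walk u ((Prod A B, True, v) # vs')"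
    by auto
  have "lbr (word ((Prod A B, True, v) # vs')) (Brace C)"
    using lbr.ProdL[of "[]" A B "word vs'" "Brace C"] 2(4) 3(1) by simp
  then show ?thesis
    unfolding Nullary good.simps using 1(4) 2 3
    by (intro conjI disjI1 exI[of _ u] exI[of _ "(Prod A B, True, v) # vs'"]) auto
qed

lemma image_mset_eq_mset:
  assumes "image_mset f M = mset l"
  obtains L where "mset L = M" "map f L = l"
proof -
  have "\<exists>L. mset L = M \<and> map f L = l"
    using assms
  proof (induction l arbitrary: M)
    case (Cons a l)
    then obtain b N where "M = add_mset b N" "f b = a" "image_mset f N = mset l"
      by (auto dest!: msed_map_invR)
    moreover from this Cons.IH obtain L where "mset L = N" "map f L = l" by blast
    ultimately show ?case by (intro exI[of _ "b # L"]) auto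
  qed simp
  then show ?thesis using that by blast
qed

text \<open>The edges lift one by one. Two consecutive lifts still meet, because their common node
  lies over an inner node, where \<open>k\<close> is injective. Only the two ends, which may lie
  over the same node, can come apart.\<close>

lemma walk_lift:
  assumes "map (map_prod id (map k)) L = walk t c ws" "ws \<noteq> []"
    and "\<And>q q'. q \<in> names (mset L) \<Longrightarrow> q' \<in> names (mset L) \<Longrightarrow> k q = k q' \<Longrightarrow>
      k q \<in> set (inner ws) \<Longrightarrow> q = q'"
  shows "\<exists>p ws'. L = walk t p ws' \<and> k p = c \<and> move k ws' = ws"
  using assms
proof (induction ws arbitrary: L c)
  case (Cons s vs)
  obtain A b y where s: "s = (A, b, y)" by (cases s)
  obtain e L' where L: "L = e # L'" using Cons.prems(1) s by auto
  then obtain p q where e: "e = (t A, if b then [p, q] else [q, p])" "k p = c" "k q = y"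
    using Cons.prems(1) s by (cases e) (auto split: if_splits)
  have L': "map (map_prod id (map k)) L' = walk t y vs"
    using Cons.prems(1) s L by (simp add: id_def)
  show ?case
  proof (cases "vs = []")
    case True
    then show ?thesis using L L' e s by (intro exI[of _ p] exI[of _ "[(A, b, q)]"]) auto
  next
    case False
    have inner: "inner (s # vs) = y # inner vs"
      using False by (simp add: s inner_def)
    have "\<exists>p ws'. L' = walk t p ws' \<and> k p = y \<and> move k ws' = vs"
      by (rule Cons.IH[OF L' False]) (use Cons.prems(3) L inner in auto)
    then obtain p' ws' where 1: "L' = walk t p' ws'" "k p' = y" "move k ws' = vs" by blast
    have "ws' \<noteq> []" using 1(3) False by auto
    then have "p' \<in> names (mset L')" by (simp add: 1(1) names_walk)
    moreover have "q \<in> names (mset L)" using L e by auto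
    ultimately have "q = p'"
      using Cons.prems(3)[of q p'] e(3) 1(2) inner L by auto
    then show ?thesis
      using 1 L e s by (intro exI[of _ p] exI[of _ "(A, b, q) # ws'"]) auto
  qed
qed simp

text \<open>The heart of the right rule for the bracelet. Rotated so as to start at
  \<open>c\<close>, the cycle lifts to a walk whose two ends lie over \<open>c\<close>, while its
  inner nodes do not. Both \<open>x\<close> and \<open>y\<close> occur on edges, so they must be the
  two ends. Without this occurrence the lift could be closed again at one of them.\<close>

lemma good_unfuse:
  assumes good: "good (Nullary A) (rename k M) []"
    and k: "k x = c" "k y = c" "x \<noteq> y" "x \<in> names M" "y \<in> names M"
      "\<And>p q. p \<in> names M \<Longrightarrow> q \<in> names M \<Longrightarrow> k p = k q \<Longrightarrow> k p \<noteq> c \<Longrightarrow> p = q"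
      "\<And>p. p \<in> names M \<Longrightarrow> k p = c \<Longrightarrow> p = x \<or> p = y"
  shows "good (Binary (Brace A)) M [x, y]"
proof -
  have "c \<in> names (rename k M)" using k by force
  \<comment> \<open>The lone hyperedge of rank 0 touches no node, so only the cyclic alternative of
    \<open>good\<close> remains.\<close>
  then have "\<And>A. rename k M \<noteq> {#(Nullary A, [])#}" by force
  then obtain z ws0 where ws0: "ws0 \<noteq> []" "distinct (stops ws0)" "final z ws0 = z"
    "rename k M = binary_walk z ws0" "lbr (word ws0) (Brace A)"
    using good by auto
  have "names (rename k M) = set (stops ws0)"
    using ws0 final_in_stops[of ws0 z] by (auto simp: names_walk)
  then have "c \<in> set (stops ws0)" using \<open>c \<in> names (rename k M)\<close> by simp
  then obtain us0 C b vs0 where s: "ws0 = us0 @ (C, b, c) # vs0"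
    by (fastforce simp: stops_def dest: split_list)
  \<comment> \<open>The same cycle, now read from \<open>c\<close> to \<open>c\<close>.\<close>
  define ws where "ws = vs0 @ us0 @ [(C, b, c)]"
  have ws: "ws \<noteq> []" "distinct (stops ws)" "final c ws = c" "rename k M = binary_walk c ws"
    "lbr (word ws) (Brace A)"
  proof -
    show "rename k M = binary_walk c ws"
      using ws0(3,4) s by (simp add: ws_def)
    show "lbr (word ws) (Brace A)"
      using lbr_word_rotate[of "us0 @ [(C, b, c)]" vs0 A] ws0(5) by (simp add: ws_def s)
  qed (use ws0 s in \<open>auto simp: ws_def\<close>)
  have stops: "stops ws = inner ws @ [c]" using ws(1,3) stops_conv_inner[of ws c] by simp
  then have c: "c \<notin> set (inner ws)" using ws(2) by auto
  obtain L where L: "mset L = M" "map (map_prod id (map k)) L = walk Binary c ws"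
    using ws(4) unfolding rename_def by (metis image_mset_eq_mset)
  have "\<exists>p ws'. L = walk Binary p ws' \<and> k p = c \<and> move k ws' = ws"
    by (rule walk_lift[OF L(2) ws(1)]) (use k(6) c L(1) in auto)
  then obtain p ws' where p: "L = walk Binary p ws'" "k p = c" "move k ws' = ws" by blast
  have ne: "ws' \<noteq> []" using p ws(1) by auto
  define q where "q = final p ws'"
  have "k q = c" using final_move[of k p ws'] p ws(3) by (simp add: q_def)
  have st: "stops ws' = inner ws' @ [q]" using stops_conv_inner[OF ne] q_def by simp
  have kst: "map k (stops ws') = inner ws @ [c]" using stops p(3) stops_move[of k ws'] by simp
  then have inn: "map k (inner ws') = inner ws" using st by simp
  have M: "M = binary_walk p ws'" using L(1) p(1) by simp
  have names: "names M = insert p (insert q (set (inner ws')))"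
    using ne st by (auto simp: M names_walk)
  have "x \<notin> set (inner ws')" "y \<notin> set (inner ws')"
    using inn c k(1,2) by (metis image_eqI list.set_map)+
  moreover have "p \<in> {x, y}" "q \<in> {x, y}"
    using k(7) names p(2) \<open>k q = c\<close> by auto
  \<comment> \<open>Each of \<open>x\<close> and \<open>y\<close> is a name of \<open>M\<close>
    outside the inner nodes, hence equals \<open>p\<close> or \<open>q\<close>; being different,
    they exhaust both.\<close>
  ultimately have pq: "p = x \<and> q = y \<or> p = y \<and> q = x"
    using names k(3,4,5) by auto
  have "distinct (map k (stops ws'))" using kst stops ws(2) by simp
  then have dist: "distinct (p # stops ws')"
    using st pq k(3) \<open>x \<notin> set (inner ws')\<close> \<open>y \<notin> set (inner ws')\<close> by (auto simp: distinct_map)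
  have lbr: "lbr (word ws') (Brace A)" using ws(5) p(3) word_move[of k ws'] by simp
  show ?thesis
  proof (cases "p = x")
    case True
    then have "q = y" using pq k(3) by auto
    then show ?thesis
      unfolding good.simps using ne dist M lbr True q_def
      by (intro exI[of _ x] exI[of _ ws']) auto
  next
    case False
    then have "p = y" "q = x" using pq by auto
    have "distinct (q # stops (backward p ws'))"
      using dist unfolding q_def stops_backward by simp
    then show ?thesis
      unfolding good.simps using ne M lbr_backward_Brace[OF lbr ne] \<open>p = y\<close> \<open>q = x\<close> q_def
        mset_walk_backward[of Binary p ws']
      by (intro exI[of _ x] exI[of _ "backward p ws'"]) auto
  qed
qed

text \<open>Fusing the ends of a simple path gives a simple cycle; \<open>BraceR\<close> supplies
  the bracelet against which cycles are tested.\<close>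

lemma good_fuse:
  assumes "good (Binary A) M [x, y]" "inj_on k (names M - {x, y})"
    "k x = c" "k y = c" "c \<notin> k ` (names M - {x, y})"
  shows "good (Nullary A) (rename k M) []"
proof -
  obtain ws where 1: "ws \<noteq> []" "distinct (x # stops ws)" "M = binary_walk x ws"
    "y = final x ws" "lbr (word ws) A"
    using assms(1) by auto
  have st: "stops ws = inner ws @ [y]" using stops_conv_inner[OF 1(1)] 1(4) by simp
  have "set (inner ws) \<subseteq> names M - {x, y}"
    using 1 st by (auto simp: names_walk)
  then have "distinct (map k (stops ws))"
    using 1(2) st assms(2,4,5) by (auto simp: distinct_map elim: inj_on_subset)
  moreover have "lbr (word ws) (Brace A)" using 1 by (auto intro: lbr.BraceR)
  ultimately show ?thesis
    unfolding good.simps using 1 assms(3,4) final_move[of k x ws]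
    by (intro conjI disjI1 exI[of _ c] exI[of _ "move k ws"]) (auto simp: stops_move rename_walk)
qed

lemma good_append:
  assumes "good (Binary A) M [x, y]" "good (Binary B) N [y, z]" "names M \<inter> names N \<subseteq> {y}" "x \<noteq> z"
  shows "good (Binary (Prod A B)) (M + N) [x, z]"
proof -
  obtain us where 1: "us \<noteq> []" "distinct (x # stops us)" "M = binary_walk x us"
    "y = final x us" "lbr (word us) A"
    using assms(1) by auto
  obtain vs where 2: "vs \<noteq> []" "distinct (y # stops vs)" "N = binary_walk y vs"
    "z = final y vs" "lbr (word vs) B"
    using assms(2) by auto
  have "x \<notin> set (stops vs)"
    using assms(3) 1 2 final_in_stops[of us x] by (auto simp: names_walk)
  moreover have "set (stops us) \<inter> set (stops vs) = {}"
    using assms(3) 1 2 by (auto simp: names_walk)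
  ultimately show ?thesis
    unfolding good.simps using 1 2 lbr.ProdR[of "word us" "word vs" A B]
    by (intro exI[of _ x] exI[of _ "us @ vs"]) auto
qed

text \<open>The start \<open>x\<close> lies on no edge of \<open>M\<close>, so the path must begin
  with the \<open>A\<close>-edge. What remains leads from \<open>y\<close> to a different node
  \<open>z\<close> and is thus nonempty, as \<open>UnderR\<close> demands.\<close>

lemma good_cons_elim:
  assumes "good (Binary B) (add_mset (Binary A, [x, y]) M) [x, z]" "x \<notin> names M" "x \<noteq> y" "y \<noteq> z"
  shows "good (Binary (Under A B)) M [y, z]"
proof -
  obtain ws where 1: "ws \<noteq> []" "distinct (x # stops ws)"
    "add_mset (Binary A, [x, y]) M = binary_walk x ws" "z = final x ws" "lbr (word ws) B"
    using assms(1) by auto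
  obtain C c w vs where ws: "ws = (C, c, w) # vs" using 1(1) by (cases ws) auto
  let ?e = "(Binary C, if c then [x, w] else [w, x])"
  have "?e \<in># add_mset (Binary A, [x, y]) M" using 1(3) ws by simp
  moreover have "?e \<notin># M" using assms(2) by (rule notin_namesD) auto
  ultimately have "?e = (Binary A, [x, y])" by auto
  then have eq: "C = A" "c" "w = y" using assms(3) by (auto split: if_splits)
  then have "vs \<noteq> []" using 1(4) ws assms(4) by auto
  then show ?thesis
    unfolding good.simps using 1 ws eq lbr.UnderR[of "word vs" A B]
    by (intro exI[of _ y] exI[of _ vs]) auto
qed

lemma good_snoc_elim:
  assumes "good (Binary B) (add_mset (Binary A, [y, z]) M) [x, z]" "z \<notin> names M" "x \<noteq> y" "y \<noteq> z"
  shows "good (Binary (Over B A)) M [x, y]"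
proof -
  obtain ws where 1: "ws \<noteq> []" "distinct (x # stops ws)"
    "add_mset (Binary A, [y, z]) M = binary_walk x ws" "z = final x ws" "lbr (word ws) B"
    using assms(1) by auto
  obtain C c w vs where ws: "ws = vs @ [(C, c, w)]" by (metis 1(1) rev_exhaust prod_cases3)
  have w: "w = z" using 1(4) ws by simp
  let ?e = "(Binary C, if c then [final x vs, z] else [z, final x vs])"
  have "?e \<in># add_mset (Binary A, [y, z]) M" using 1(3) ws w by simp
  moreover have "?e \<notin># M" using assms(2) by (rule notin_namesD) auto
  ultimately have "?e = (Binary A, [y, z])" by auto
  then have eq: "C = A" "c" "final x vs = y" using assms(4) by (auto split: if_splits)
  then have "vs \<noteq> []" using assms(3) by auto
  then show ?thesis
    unfolding good.simps using 1 ws eq lbr.OverR[of "word vs" A B]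
    by (intro exI[of _ x] exI[of _ vs]) auto
qed

section \<open>Shapes of graphs isomorphic to the translated ones\<close>

lemma iso_string_graph2E:
  assumes "hg_iso R D (string_graph [a, b])" "wf_graph D"
  obtains d0 d1 n0 n1 n2 where "edges D = {d0, d1}" "d0 \<noteq> d1" "nodes D = {n0, n1, n2}"
    "distinct [n0, n1, n2]" "att D d0 = [n0, n1]" "att D d1 = [n1, n2]" "ext D = [n0, n2]"
    "R (lab D d0) a" "R (lab D d1) b"
proof -
  let ?S = "string_graph [a, b]"
  obtain f g where f: "bij_betw f (nodes D) (nodes ?S)" and g: "bij_betw g (edges D) (edges ?S)"
    and e: "\<And>e. e \<in> edges D \<Longrightarrow> att ?S (g e) = map f (att D e) \<and> R (lab D e) (lab ?S (g e))"
    and x: "ext ?S = map f (ext D)"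
    using assms(1) unfolding hg_iso_def by blast
  have S: "nodes ?S = {0, 1, 2}" "edges ?S = {0, 1}" by (auto simp: string_graph_def)
  define d where "d = inv_into (edges D) g"
  define n where "n = inv_into (nodes D) f"
  have d: "bij_betw d {0, 1} (edges D)" "\<And>i. i \<in> {0, 1} \<Longrightarrow> g (d i) = i"
    using bij_betw_inv_into[OF g] bij_betw_inv_into_right[OF g] unfolding d_def S by auto
  have n: "bij_betw n {0, 1, 2} (nodes D)" "\<And>v. v \<in> nodes D \<Longrightarrow> n (f v) = v"
    using bij_betw_inv_into[OF f] bij_betw_inv_into_left[OF f] unfolding n_def S by auto
  have D: "edges D = {d 0, d 1}" "nodes D = {n 0, n 1, n 2}"
    using bij_betw_imp_surj_on[OF d(1)] bij_betw_imp_surj_on[OF n(1)] by auto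
  have map_n: "map n (map f xs) = xs" if "set xs \<subseteq> nodes D" for xs
    using that n(2) by (auto intro!: map_idI)
  have att: "att D (d i) = map n (att ?S i)" "R (lab D (d i)) (lab ?S i)" if "i \<in> {0, 1}" for i
  proof -
    have di: "d i \<in> edges D" using that D by auto
    then show "att D (d i) = map n (att ?S i)"
      using e[OF di] d(2)[OF that] map_n[of "att D (d i)"] assms(2) by (auto simp: wf_graph_def)
    show "R (lab D (d i)) (lab ?S i)" using e[OF di] d(2)[OF that] by simp
  qed
  show ?thesis
  proof (rule that[OF D(1) _ D(2)])
    show "d 0 \<noteq> d 1" using d(2)[of 0] d(2)[of 1] by auto
    show "distinct [n 0, n 1, n 2]" using bij_betw_imp_inj_on[OF n(1)] by (auto simp: inj_on_def)
    have "ext D = map n (ext ?S)"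
      unfolding x using map_n[of "ext D"] assms(2) by (simp add: wf_graph_def)
    then show "ext D = [n 0, n 2]" by (simp add: string_graph_def numeral_2_eq_2)
  qed (use att[of 0] att[of 1] in \<open>auto simp: string_graph_def numeral_2_eq_2\<close>)
qed

lemma iso_loopE:
  assumes "hg_iso R D (loop a)" "wf_graph D"
  obtains d z where "edges D = {d}" "nodes D = {z}" "att D d = [z, z]" "ext D = []" "R (lab D d) a"
proof -
  obtain f g :: "nat \<Rightarrow> nat" where f: "bij_betw f (nodes D) {0}" and g: "bij_betw g (edges D) {0}"
    and e: "\<And>e. e \<in> edges D \<Longrightarrow> [0, 0] = map f (att D e) \<and> R (lab D e) a"
    and x: "[] = map f (ext D)"
    using assms(1) unfolding hg_iso_def loop_def hgraph.sel by blast
  have "card (edges D) = 1" "card (nodes D) = 1"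
    using bij_betw_same_card[OF f] bij_betw_same_card[OF g] by auto
  then obtain d z where D: "edges D = {d}" "nodes D = {z}" by (auto simp: card_1_singleton_iff)
  then have "att D d = [z, z]" using e[of d] assms(2) by (auto simp: wf_graph_def)
  then show ?thesis using that D e x by auto
qed

lemma iso_reversalE:
  assumes "hg_iso R D (reversal a)" "wf_graph D"
  obtains d n0 n1 where "edges D = {d}" "nodes D = {n0, n1}" "n0 \<noteq> n1" "att D d = [n0, n1]"
    "ext D = [n1, n0]" "R (lab D d) a"
proof -
  obtain f g :: "nat \<Rightarrow> nat" where f: "bij_betw f (nodes D) {0, 1}" and g: "bij_betw g (edges D) {0}"
    and e: "\<And>e. e \<in> edges D \<Longrightarrow> [0, 1] = map f (att D e) \<and> R (lab D e) a"
    and x: "[1, 0] = map f (ext D)"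
    using assms(1) unfolding hg_iso_def reversal_def hgraph.sel
    by (elim exE conjE) (rule that, assumption, assumption, blast, assumption)
  have "card (edges D) = 1"
    using bij_betw_same_card[OF g] by auto
  then obtain d where D: "edges D = {d}" by (auto simp: card_1_singleton_iff)
  then obtain n0 n1 where a: "att D d = [n0, n1]" "f n0 = 0" "f n1 = 1"
    using e[of d] by (auto simp: Cons_eq_map_conv)
  then have n: "n0 \<in> nodes D" "n1 \<in> nodes D" using D assms(2) by (auto simp: wf_graph_def)
  have inj: "inj_on f (nodes D)" and im: "f ` nodes D = {0, 1}" using f by (auto simp: bij_betw_def)
  have N: "nodes D = {n0, n1}"
  proof
    show "nodes D \<subseteq> {n0, n1}"
    proof
      fix v assume "v \<in> nodes D"
      then have "f v = f n0 \<or> f v = f n1" using im a by auto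
      then show "v \<in> {n0, n1}" using inj n \<open>v \<in> nodes D\<close> by (auto dest: inj_onD)
    qed
  qed (use n in auto)
  have "ext D = [n1, n0]"
  proof (rule map_inj_on)
    show "map f (ext D) = map f [n1, n0]" using x a by simp
    show "inj_on f (set (ext D) \<union> set [n1, n0])"
      by (rule inj_on_subset[OF inj]) (use n assms(2) in \<open>auto simp: wf_graph_def\<close>)
  qed
  moreover have "n0 \<noteq> n1" using a(2,3) by auto
  ultimately show ?thesis using that[OF D N _ a(1)] e[of d] D by blast
qed

lemma edge_mset_delete_replace:
  assumes "finite (edges G)" "finite (edges H)" "d \<in> edges G" "d \<noteq> e"
  shows "edge_mset \<alpha> f (delete_edge (replace G e H) d) =
    edge_mset \<alpha> f (delete_edge (delete_edge G e) d) +
    edge_mset (\<alpha> \<circ> edge_copy G) (f \<circ> node_copy G e H) H"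
proof -
  have "add_mset (\<alpha> d, map f (att G d)) (edge_mset \<alpha> f (delete_edge (replace G e H) d)) =
      edge_mset \<alpha> f (replace G e H)"
    using assms by (subst edge_mset_delete[of "replace G e H" d]) (auto simp: replace_old)
  moreover have "add_mset (\<alpha> d, map f (att G d)) (edge_mset \<alpha> f (delete_edge (delete_edge G e) d)) =
      edge_mset \<alpha> f (delete_edge G e)"
    using assms by (subst edge_mset_delete[of "delete_edge G e" d]) auto
  ultimately have "add_mset (\<alpha> d, map f (att G d)) (edge_mset \<alpha> f (delete_edge (replace G e H) d)) =
      add_mset (\<alpha> d, map f (att G d)) (edge_mset \<alpha> f (delete_edge (delete_edge G e) d) +
        edge_mset (\<alpha> \<circ> edge_copy G) (f \<circ> node_copy G e H) H)"
    using edge_mset_replace[OF assms(1,2), of \<alpha> f e] by (metis union_mset_add_mset_left)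
  then show ?thesis by simp
qed

lemma edge_mset_empty: "edges G = {} \<Longrightarrow> edge_mset \<alpha> f G = {#}"
  by (simp add: edge_mset_def)

lemma edge_mset_singleton: "edges G = {d} \<Longrightarrow> edge_mset \<alpha> f G = {#(\<alpha> d, map f (att G d))#}"
  by (simp add: edge_mset_def)

lemma edge_mset_pair:
  "edges G = {d, e} \<Longrightarrow> d \<noteq> e \<Longrightarrow>
    edge_mset \<alpha> f G = {#(\<alpha> d, map f (att G d)), (\<alpha> e, map f (att G e))#}"
  by (simp add: edge_mset_def)

lemma wf_graph_bullet: "wf_graph (bullet rk a)"
  by (auto simp: wf_graph_def bullet_def)

lemma replaces_simps [simp]:
  "replaces G [] = G" "replaces G ((e, H) # xs) = replaces (replace G e H) xs"
  by (auto simp: replaces_def)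

text \<open>The map \<open>n\<close> embeds the nodes of \<open>D\<close>.\<close>

lemma divL_step:
  fixes H D :: "'p label hgraph"
  assumes wf: "wf_graph H" "wf_graph D"
    and e: "e \<in> edges H" "length (att H e) = length (ext D)"
    and s: "s \<in> edges D" "length (att D s) = rank rk X"
    and K: "K = replaces H [(e, D), (edge_copy H s, bullet rk X)]"
  obtains k n where "wf_graph K" "k \<in> edges K" "lab K k = X" "ext K = ext H" "nodes H \<union> n ` nodes D \<subseteq> nodes K"
    "\<And>x. x \<in> edges H - {e} \<Longrightarrow> x \<in> edges K \<and> lab K x = lab H x"
    "\<And>d. d \<in> edges D - {s} \<Longrightarrow>
      edge_copy H d \<in> edges K \<and> edge_copy H d \<noteq> k \<and> att K (edge_copy H d) = map n (att D d)"
    "\<And>\<alpha> :: nat \<Rightarrow> 'c. edge_mset \<alpha> id K = edge_mset \<alpha> id (delete_edge H e) +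
      {#(\<alpha> k, map n (att D s))#} + edge_mset (\<alpha> \<circ> edge_copy H) n (delete_edge D s)"
    "map n (ext D) = att H e" "n ` internal D \<inter> nodes H = {}"
proof -
  define K1 where "K1 = replace H e D"
  define es where "es = edge_copy H s"
  let ?b = "bullet rk X" and ?n = "node_copy H e D"
  define k where "k = edge_copy K1 0"
  have K': "K = replace K1 es ?b" by (simp add: K K1_def es_def)
  have wf1: "wf_graph K1" unfolding K1_def by (rule wf_graph_replace[OF wf e])
  have fin: "finite (edges H)" "finite (edges D)" "finite (edges K1)" "finite (nodes H)"
    using wf wf1 by (auto simp: wf_graph_def)
  have es: "es \<in> edges K1" using s by (auto simp: K1_def es_def)
  have att1: "att K1 (edge_copy H d) = map ?n (att D d)" for d
    by (auto simp: K1_def replace_new)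
  have len: "length (att K1 es) = length (ext ?b)"
    by (simp add: es_def att1 s bullet_def)
  have k: "k \<notin> edges K1" using edge_copy_notin[OF fin(3)] by (simp add: k_def)
  show ?thesis
  proof (rule that[of k ?n])
    show "wf_graph K" unfolding K' by (rule wf_graph_replace[OF wf1 wf_graph_bullet es len])
    show "k \<in> edges K" by (auto simp: K' k_def bullet_def)
    show "lab K k = X" by (simp add: K' k_def replace_new) (simp add: bullet_def)
    show "ext K = ext H" by (simp add: K' K1_def)
    show "nodes H \<union> ?n ` nodes D \<subseteq> nodes K" by (auto simp: K' K1_def)
    show "x \<in> edges K \<and> lab K x = lab H x" if "x \<in> edges H - {e}" for x
    proof -
      have "x \<in> edges K1" "x \<noteq> es" "lab K1 x = lab H x"
        using that edge_copy_notin[OF fin(1)] fin by (auto simp: K1_def es_def replace_old)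
      then show ?thesis using fin by (simp add: K' replace_old)
    qed
    show "edge_copy H d \<in> edges K \<and> edge_copy H d \<noteq> k \<and> att K (edge_copy H d) = map ?n (att D d)"
      if "d \<in> edges D - {s}" for d
    proof -
      have "edge_copy H d \<in> edges K1" "edge_copy H d \<noteq> es"
        using that inj_edge_copy[of H] by (auto simp: K1_def es_def dest: injD)
      then show ?thesis using k att1 fin(3) by (auto simp: K' replace_old)
    qed
    show "edge_mset \<alpha> id K = edge_mset \<alpha> id (delete_edge H e) + {#(\<alpha> k, map ?n (att D s))#} +
        edge_mset (\<alpha> \<circ> edge_copy H) ?n (delete_edge D s)" for \<alpha> :: "nat \<Rightarrow> 'c"
    proof -
      have "add_mset (\<alpha> es, att K1 es) (edge_mset \<alpha> id (delete_edge K1 es)) = edge_mset \<alpha> id K1"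
        using edge_mset_delete[OF fin(3) es, of \<alpha> id] by simp
      also have "\<dots> = add_mset (\<alpha> es, att K1 es) (edge_mset \<alpha> id (delete_edge H e) +
          edge_mset (\<alpha> \<circ> edge_copy H) ?n (delete_edge D s))"
        unfolding es_def att1 unfolding K1_def edge_mset_replace[OF fin(1,2)]
          edge_mset_delete[OF fin(2) s(1)] by simp
      finally have 1: "edge_mset \<alpha> id (delete_edge K1 es) = edge_mset \<alpha> id (delete_edge H e) +
          edge_mset (\<alpha> \<circ> edge_copy H) ?n (delete_edge D s)" by simp
      have b: "edges ?b = {0}" by (simp add: bullet_def)
      have "map (node_copy K1 es ?b) (att ?b 0) = att K1 es"
        using node_copy_ext[OF wf_graph_bullet len] by (simp add: bullet_def)
      then show ?thesis
        using edge_mset_replace[of K1 ?b \<alpha> id es] 1 fin b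
        by (simp add: K' edge_mset_singleton[OF b] k_def es_def att1)
    qed
    show "map ?n (ext D) = att H e" by (rule node_copy_ext[OF wf(2) e(2)])
    show "?n ` internal D \<inter> nodes H = {}"
      using node_copy_notin[OF fin(4) e(2)] by auto
  qed
qed

text \<open>\<open>UnderL\<close> applied to an axiom shows that \<open>ws\<close> followed by the
  new edge is a path deriving \<open>B\<close>. Then \<open>good_subst\<close> puts it in the place
  of the \<open>B\<close>-edge, whichever way that edge is traversed.\<close>

lemma good_subst_left:
  assumes "good X (add_mset (Binary B, [u, v]) M) xs" "good (Binary A) P [u, w]"
    and fresh: "w \<notin> names M \<union> {u, v} \<union> set xs" "(names P - {u, w}) \<inter> (names M \<union> {u, v} \<union> set xs) = {}"
  shows "good X (M + P + {#(Binary (Under A B), [w, v])#}) xs"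
proof -
  obtain ws where ws: "ws \<noteq> []" "distinct (u # stops ws)" "P = binary_walk u ws"
    "w = final u ws" "lbr (word ws) A"
    using assms(2) by auto
  define qs where "qs = ws @ [(Under A B, True, v)]"
  have inner: "inner qs = stops ws" by (simp add: qs_def inner_def)
  have "set (stops ws) \<inter> (names M \<union> {u, v} \<union> set xs) = {}"
    using ws fresh by (fastforce simp: names_walk)
  moreover have "lbr (word qs) B"
    using lbr.UnderL[of "[]" B "[]" B "word ws" A] ws lbr.Ax[of B] by (simp add: qs_def)
  ultimately have "good X (M + binary_walk u qs) xs"
    using ws by (intro good_subst[OF assms(1)]) (auto simp: inner, auto simp: qs_def)
  then show ?thesis using ws by (simp add: qs_def)
qed

lemma good_subst_right:
  assumes "good X (add_mset (Binary B, [u, v]) M) xs" "good (Binary A) P [w, v]"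
    and fresh: "w \<notin> names M \<union> {u, v} \<union> set xs" "(names P - {w, v}) \<inter> (names M \<union> {u, v} \<union> set xs) = {}"
  shows "good X (M + P + {#(Binary (Over B A), [u, w])#}) xs"
proof -
  obtain ws where ws: "ws \<noteq> []" "distinct (w # stops ws)" "P = binary_walk w ws"
    "v = final w ws" "lbr (word ws) A"
    using assms(2) by auto
  define qs where "qs = (Over B A, True, w) # ws"
  have stops: "stops ws = inner ws @ [v]" using stops_conv_inner[OF ws(1)] ws(4) by simp
  have inner: "inner qs = w # inner ws" using ws(1) by (simp add: qs_def inner_def)
  have "set (inner ws) \<inter> (names M \<union> {u, v} \<union> set xs) = {}"
    using ws fresh stops by (fastforce simp: names_walk)
  moreover have "lbr (word qs) B"
    using lbr.OverL[of "[]" B "[]" B "word ws" A] ws lbr.Ax[of B] by (simp add: qs_def)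
  ultimately have "good X (M + binary_walk u qs) xs"
    using ws stops fresh by (intro good_subst[OF assms(1)]) (auto simp: inner, auto simp: qs_def)
  then show ?thesis using ws by (simp add: qs_def)
qed

text \<open>A loop cannot lie on a path with distinct nodes, and on a simple cycle it is the whole
  cycle. Hence the hyperedge of rank 0 that hides it is the entire antecedent.\<close>

lemma good_unfold_loop:
  assumes "good X (add_mset (Binary A, [z, z]) M) xs"
  shows "good X (add_mset (Nullary A, []) M) xs"
proof (cases X)
  case (Binary B)
  then obtain x ws where 1: "ws \<noteq> []" "distinct (x # stops ws)"
    "add_mset (Binary A, [z, z]) M = binary_walk x ws"
    using assms by auto
  have "(Binary A, [z, z]) \<in> set (walk Binary x ws)"
    using 1(3) by (metis set_mset_mset union_single_eq_member)
  then obtain us b y vs where "ws = us @ (A, b, y) # vs" "final x us = z" "y = z"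
    by (rule walk_edgeE) (auto split: if_splits)
  then have False using 1(2) by (cases "us = []") (use final_in_stops[of us x] in auto)
  then show ?thesis ..
next
  case (Nullary C)
  then obtain x ws where 1: "ws \<noteq> []" "distinct (stops ws)" "final x ws = x" "xs = []"
    "add_mset (Binary A, [z, z]) M = binary_walk x ws" "lbr (word ws) (Brace C)"
    using assms by auto
  have "(Binary A, [z, z]) \<in> set (walk Binary x ws)"
    using 1(5) by (metis set_mset_mset union_single_eq_member)
  from cycle_start[OF this 1(2,3,6)] obtain vs where
    2: "binary_walk z ((A, True, z) # vs) = binary_walk x ws"
    "distinct (z # stops vs)" "final z vs = z" "lbr (A # word vs) (Brace C)" by blast
  have "vs = []" using 2(2,3) final_in_stops[of vs z] by auto
  then show ?thesis using 1(4,5) 2 Nullary by simp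
qed

section \<open>The rules of the hypergraph calculus preserve good sequents\<close>

declare good.simps [simp del]

text \<open>Quantifying over all labellings \<open>\<alpha>\<close>, instead of fixing one, lets
  each rule prescribe the Lambek types in its premises. Sequents with other labels satisfy the
  condition vacuously, so the induction can run over arbitrary derivations.\<close>

definition good_seq :: "('q \<Rightarrow> 'p) \<Rightarrow> 'p label hgraph \<Rightarrow> 'p label \<Rightarrow> bool" where
  "good_seq \<iota> K L \<longleftrightarrow> (\<forall>\<alpha> X. (\<forall>e\<in>edges K. label_iso (lab K e) (trx \<iota> (\<alpha> e))) \<longrightarrow>
     label_iso L (trx \<iota> X) \<longrightarrow> good X (edge_mset \<alpha> id K) (ext K))"

lemma good_seqD:
  "good_seq \<iota> K L \<Longrightarrow> (\<And>e. e \<in> edges K \<Longrightarrow> label_iso (lab K e) (trx \<iota> (\<alpha> e))) \<Longrightarrow>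
    label_iso L (trx \<iota> X) \<Longrightarrow> good X (edge_mset \<alpha> id K) (ext K)"
  by (auto simp: good_seq_def)

lemma trx_neq_Dollar [simp]: "trx \<iota> X \<noteq> Dollar n" "Dollar n \<noteq> trx \<iota> X"
  "tr \<iota> A \<noteq> Dollar n" "Dollar n \<noteq> tr \<iota> A"
  by (cases X; cases A; cases "case X of Binary A \<Rightarrow> A | Nullary A \<Rightarrow> A"; simp add: bracelet_def)+

lemma label_iso_Dollar: "label_iso L (Dollar n) \<longleftrightarrow> L = Dollar n" "label_iso (Dollar n) L \<longleftrightarrow> L = Dollar n"
  by (auto elim: label_iso.cases intro: label_iso.intros)

lemma iso_Div_trxE:
  assumes "label_iso (Div N D) (trx \<iota> X)"
  obtains A B where "X = Binary (Under A B)" "label_iso N (tr \<iota> B)"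
      "hg_iso label_iso D (string_graph [tr \<iota> A, Dollar 2])"
  | A B where "X = Binary (Over B A)" "label_iso N (tr \<iota> B)"
      "hg_iso label_iso D (string_graph [Dollar 2, tr \<iota> A])"
  | A where "X = Binary (Brace A)" "label_iso N (trx \<iota> (Nullary A))"
      "hg_iso label_iso D (loop (Dollar 2))"
proof (cases X)
  case (Binary C)
  then show ?thesis
    using assms that by (cases C) (auto simp: bracelet_def elim: label_iso_DivE)
next
  case (Nullary C)
  then show ?thesis using assms by (auto elim: label_iso_DivE)
qed

lemma iso_Times_trxE:
  assumes "label_iso (Times M) (trx \<iota> X)"
  obtains A B where "X = Binary (Prod A B)" "hg_iso label_iso M (string_graph [tr \<iota> A, tr \<iota> B])"
  | A where "X = Binary (Rev A)" "hg_iso label_iso M (reversal (tr \<iota> A))"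
  | A where "X = Nullary A" "hg_iso label_iso M (loop (tr \<iota> A))"
proof (cases X)
  case (Binary C)
  then show ?thesis
    using assms that by (cases C) (auto simp: bracelet_def elim: label_iso_TimesE)
next
  case (Nullary C)
  then show ?thesis using assms that by (auto elim: label_iso_TimesE)
qed

inductive_cases hl_type_DollarE: "hl_type ok rk (Dollar n)"
inductive_cases hl_type_DivE: "hl_type ok rk (Div N D)"
inductive_cases hl_type_TimesE: "hl_type ok rk (Times M)"

lemma hl_type_DivD:
  assumes "hl_type ok rk (Div N D)"
  shows "hypergraph rk D" "rank rk N = length (ext D)" "hl_type ok rk N" "ok D"
  using assms by (auto elim: hl_type_DivE)

text \<open>Every hyperedge except the distinguished one is labelled by a type, and no
  \<open>Dollar\<close> label is a type; so the definite description in \<open>rank\<close> has a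
  unique value.\<close>

lemma rank_Div:
  assumes "hl_type ok rk (Div N D)" "s \<in> edges D" "lab D s = Dollar n"
  shows "rank rk (Div N D) = n" "length (att D s) = n"
proof -
  obtain s' d where s': "s' \<in> edges D" "lab D s' = Dollar d" "hypergraph rk D"
    "\<forall>e\<in>edges D - {s'}. hl_type ok rk (lab D e)"
    using assms(1) by (rule hl_type_DivE) auto
  have "e = s'" if "e \<in> edges D" "lab D e = Dollar m" for e m
    using s'(4) that by (metis DiffI hl_type_DollarE singletonD)
  then have "\<And>e m. e \<in> edges D \<Longrightarrow> lab D e = Dollar m \<Longrightarrow> m = n"
    using assms(2,3) by (metis label.inject(2))
  then show "rank rk (Div N D) = n"
    unfolding rank.simps using assms(2,3) by (intro the_equality) blast+
  show "length (att D s) = n"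
    using s'(3) assms(2,3) by (auto simp: hypergraph_def)
qed

lemma hl_sequentD: "hl ok rk K L \<Longrightarrow> hl_sequent ok rk K L"
  by (erule hl.cases) auto

lemma hl_sequent_wf: "hl_sequent ok rk K L \<Longrightarrow> wf_graph K"
  by (auto simp: hl_sequent_def hypergraph_wf)

lemma good_seq_iso:
  assumes "good_seq \<iota> H A" "hg_iso label_iso H H'" "label_iso A A'" "wf_graph H"
  shows "good_seq \<iota> H' A'"
  unfolding good_seq_def
proof (intro allI impI)
  fix \<alpha> X
  assume \<alpha>: "\<forall>e\<in>edges H'. label_iso (lab H' e) (trx \<iota> (\<alpha> e))" and X: "label_iso A' (trx \<iota> X)"
  obtain f g where f: "bij_betw f (nodes H) (nodes H')" and g: "bij_betw g (edges H) (edges H')"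
    and e: "\<And>e. e \<in> edges H \<Longrightarrow> att H' (g e) = map f (att H e) \<and> label_iso (lab H e) (lab H' (g e))"
    and x: "ext H' = map f (ext H)"
    using assms(2) unfolding hg_iso_def by blast
  have "good X (edge_mset (\<alpha> \<circ> g) id H) (ext H)"
  proof (rule good_seqD[OF assms(1)])
    fix d assume "d \<in> edges H"
    moreover from this have "g d \<in> edges H'" using g bij_betwE by blast
    ultimately show "label_iso (lab H d) (trx \<iota> ((\<alpha> \<circ> g) d))"
      using e[of d] \<alpha> label_iso_trans by auto
  qed (rule label_iso_trans[OF assms(3) X])
  then have "good X (rename f (edge_mset (\<alpha> \<circ> g) id H)) (map f (ext H))"
  proof (rule good_rename)
    show "inj_on f (names (edge_mset (\<alpha> \<circ> g) id H) \<union> set (ext H))"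
      by (rule inj_on_subset[OF bij_betw_imp_inj_on[OF f]])
        (use assms(4) in \<open>auto simp: names_edge_mset wf_graph_def\<close>)
  qed
  moreover have "rename f (edge_mset (\<alpha> \<circ> g) id H) = edge_mset \<alpha> id H'"
  proof -
    have "mset_set (edges H') = image_mset g (mset_set (edges H))"
      using g by (simp add: bij_betw_def image_mset_mset_set)
    then show ?thesis
      using e assms(4) unfolding rename_edge_mset edge_mset_def
      by (auto simp: rename_def image_mset.compositionality comp_def wf_graph_def
          intro!: image_mset_cong)
  qed
  ultimately show "good X (edge_mset \<alpha> id H') (ext H')" using x by simp
qed

lemma inj_on_nodes:
  assumes "wf_graph F" "distinct (map m (ext F))" "inj_on m (internal F)"
    "m ` internal F \<inter> set (map m (ext F)) = {}"
  shows "inj_on m (nodes F)"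
proof -
  have "nodes F = (internal F) \<union> set (ext F)"
    using assms(1) by (auto simp: wf_graph_def)
  moreover have "inj_on m ((internal F) \<union> set (ext F))"
    using assms(2-4) by (subst inj_on_Un) (auto simp: distinct_map)
  ultimately show ?thesis by simp
qed

lemma names_edge_mset_le: "wf_graph F \<Longrightarrow> names (edge_mset \<alpha> m F) \<subseteq> m ` nodes F"
  by (auto simp: names_edge_mset wf_graph_def)

lemma good_embed:
  assumes "good X (edge_mset \<beta> id F) (ext F)" "wf_graph F"
    "distinct (map m (ext F))" "inj_on m (internal F)"
    "m ` internal F \<inter> set (map m (ext F)) = {}"
  shows "good X (edge_mset \<beta> m F) (map m (ext F))"
proof -
  have "inj_on m (names (edge_mset \<beta> id F) \<union> set (ext F))"
    by (rule inj_on_subset[OF inj_on_nodes[OF assms(2-5)]])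
      (use assms(2) names_edge_mset_le[OF assms(2), of \<beta> id] in \<open>auto simp: wf_graph_def\<close>)
  from good_rename[OF assms(1) this] show ?thesis by (simp add: rename_edge_mset)
qed

lemma ext_replaces: "ext (replaces G (map (\<lambda>d. (d, F d)) ds)) = ext G"
  by (induction ds arbitrary: G) auto

lemma replaces_old:
  assumes "finite (edges G)" "\<And>e H. (e, H) \<in> set xs \<Longrightarrow> finite (edges H)"
    "k \<in> edges G" "k \<notin> fst ` set xs" "lab G k = L"
  shows "k \<in> edges (replaces G xs) \<and> lab (replaces G xs) k = L"
  using assms
proof (induction xs arbitrary: G)
  case (Cons x xs)
  obtain e H where x: "x = (e, H)" by (cases x)
  show ?case
    unfolding x replaces_simps
    by (rule Cons.IH) (use Cons.prems x in \<open>force simp: replace_old\<close>)+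
qed simp

lemma good_seq_divL:
  fixes H D :: "'p label hgraph" and \<iota> :: "'q \<Rightarrow> 'p"
  assumes div: "hl_type ok rk (Div N D)" and s: "s \<in> edges D" "lab D s = Dollar n"
    and ds: "distinct ds" "set ds = edges D - {s}"
    and e: "e \<in> edges H" "lab H e = N" and H: "hl_sequent ok rk H A" "good_seq \<iota> H A"
    and F: "\<And>d. d \<in> set ds \<Longrightarrow> wf_graph (F d) \<and> good_seq \<iota> (F d) (lab D d) \<and>
      length (att D d) = length (ext (F d))"
    and K: "K = replaces H ([(e, D), (edge_copy H s, bullet rk (Div N D))]
          @ map (\<lambda>d. (edge_copy H d, F d)) ds)"
  shows "good_seq \<iota> K A"
  unfolding good_seq_def
proof (intro allI impI)
  fix \<alpha> X
  assume \<alpha>: "\<forall>e\<in>edges K. label_iso (lab K e) (trx \<iota> (\<alpha> e))" and X: "label_iso A (trx \<iota> X)"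
  have wf: "wf_graph H" "wf_graph D"
    using hl_sequent_wf[OF H(1)] hypergraph_wf[OF hl_type_DivD(1)[OF div]] by auto
  have lenN: "length (att H e) = length (ext D)"
    using H(1) e hl_type_DivD(2)[OF div] by (auto simp: hl_sequent_def hypergraph_def)
  have lens: "length (att D s) = rank rk (Div N D)" using rank_Div[OF div s] by simp
  have fin: "finite (edges H)" using wf by (simp add: wf_graph_def)
  let ?M = "edge_mset \<alpha> id (delete_edge H e)"
  have names_H: "names ?M \<union> set (att H e) \<union> set (ext H) \<subseteq> nodes H"
    using wf e by (auto simp: names_edge_mset wf_graph_def)
  define K2 where "K2 = replaces H [(e, D), (edge_copy H s, bullet rk (Div N D))]"
  obtain k n where K2: "wf_graph K2" "k \<in> edges K2" "lab K2 k = Div N D" "ext K2 = ext H"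
    "nodes H \<union> n ` nodes D \<subseteq> nodes K2"
    "\<And>x. x \<in> edges H - {e} \<Longrightarrow> x \<in> edges K2 \<and> lab K2 x = lab H x"
    "\<And>d. d \<in> edges D - {s} \<Longrightarrow>
      edge_copy H d \<in> edges K2 \<and> edge_copy H d \<noteq> k \<and> att K2 (edge_copy H d) = map n (att D d)"
    "\<And>\<beta> :: nat \<Rightarrow> 'q xtype. edge_mset \<beta> id K2 = edge_mset \<beta> id (delete_edge H e) +
      {#(\<beta> k, map n (att D s))#} + edge_mset (\<beta> \<circ> edge_copy H) n (delete_edge D s)"
    and n: "map n (ext D) = att H e" "n ` internal D \<inter> nodes H = {}"
    by (rule divL_step[OF wf e(1) lenN s(1) lens K2_def, where 'c = "'q xtype"]) (rule that; assumption)
  have fin2: "finite (edges K2)" "finite (nodes K2)" using K2(1) by (auto simp: wf_graph_def)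
  have K': "K = replaces K2 (map (\<lambda>d. (edge_copy H d, F d)) ds)"
    by (simp add: K K2_def)
  have keep: "x \<in> edges K \<and> lab K x = lab K2 x" if "x \<in> edges K2" "x \<notin> edge_copy H ` (edges D - {s})" for x
    unfolding K' using that F ds by (intro replaces_old fin2) (auto simp: wf_graph_def)
  have k: "label_iso (Div N D) (trx \<iota> (\<alpha> k))"
    using keep[OF K2(2)] K2(3,7) \<alpha> by force
  \<comment> \<open>The replaced hyperedge \<open>e\<close> does not survive in \<open>K\<close>, so
    its Lambek type can be chosen freely: it becomes the type \<open>Y\<close> of the
    numerator.\<close>
  have goodH: "good X (add_mset (Y, att H e) ?M) (ext H)" if "label_iso N (trx \<iota> Y)" for Y
  proof -
    have old: "x \<in> edges K \<and> lab K x = lab H x" if "x \<in> edges H - {e}" for x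
      using keep[of x] K2(6)[OF that] that edge_copy_notin[OF fin] by auto
    have "good X (edge_mset (\<alpha>(e := Y)) id H) (ext H)"
      by (rule good_seqD[OF H(2)]) (use old that e \<alpha> X in force)+
    also have "edge_mset (\<alpha>(e := Y)) id H = add_mset (Y, att H e) (edge_mset (\<alpha>(e := Y)) id (delete_edge H e))"
      using edge_mset_delete[OF fin e(1), of "\<alpha>(e := Y)" id] by simp
    also have "edge_mset (\<alpha>(e := Y)) id (delete_edge H e) = ?M"
      by (rule edge_mset_cong) auto
    finally show ?thesis .
  qed
  \<comment> \<open>For both divisions there is one premise besides the main one. \<open>P\<close>
    is the copy of its antecedent between the images of the nodes of \<open>d\<close>; it is copied
    into a graph that already contains \<open>H\<close>, so its internal nodes are new.\<close>
  have pair: "\<exists>P. edge_mset \<alpha> id K = ?M + P + {#(\<alpha> k, map n (att D s))#} \<and> ext K = ext H \<and>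
      good (Binary C) P (map n (att D d)) \<and> (names P - set (map n (att D d))) \<inter> nodes H = {}"
    if D: "edges D = {s, d}" "d \<noteq> s" and C: "label_iso (lab D d) (tr \<iota> C)" "distinct (map n (att D d))" for d C
  proof -
    have del: "edges (delete_edge D s) = {d}" using D by auto
    have "ds = [d]"
      using ds del distinct_card[OF ds(1)] by (cases ds) (auto dest: subset_singletonD)
    then have K3: "K = replace K2 (edge_copy H d) (F d)" and Fd: "wf_graph (F d)"
      "good_seq \<iota> (F d) (lab D d)" "length (att D d) = length (ext (F d))"
      using F[of d] by (auto simp: K')
    have ed: "edge_copy H d \<in> edges K2" "att K2 (edge_copy H d) = map n (att D d)"
      using K2(7)[of d] D by auto
    then have len: "length (att K2 (edge_copy H d)) = length (ext (F d))" using Fd(3) by simp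
    let ?m = "node_copy K2 (edge_copy H d) (F d)" and ?\<alpha> = "\<alpha> \<circ> edge_copy K2"
    have m: "map ?m (ext (F d)) = map n (att D d)"
      using node_copy_ext[OF Fd(1) len] ed(2) by simp
    have int: "?m ` internal (F d) \<inter> nodes K2 = {}"
      using node_copy_notin[OF fin2(2) len] by auto
    have "set (map n (att D d)) \<subseteq> n ` nodes D"
      using wf(2) D(1) by (auto simp: wf_graph_def)
    then have attD: "set (map n (att D d)) \<subseteq> nodes K2" using K2(5) by blast
    have "edge_mset \<alpha> id (delete_edge K2 (edge_copy H d)) = ?M + {#(\<alpha> k, map n (att D s))#}"
      using edge_mset_delete[OF fin2(1) ed(1), of \<alpha> id] K2(8)[of \<alpha>]
      by (simp add: ed(2) edge_mset_singleton[OF del])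
    then have "edge_mset \<alpha> id K = ?M + edge_mset ?\<alpha> ?m (F d) + {#(\<alpha> k, map n (att D s))#}"
      using edge_mset_replace[OF fin2(1), of "F d" \<alpha> id "edge_copy H d"] Fd(1)
      by (simp add: K3 wf_graph_def)
    moreover have "good (Binary C) (edge_mset ?\<alpha> ?m (F d)) (map ?m (ext (F d)))"
    proof (rule good_embed[OF _ Fd(1)])
      show "good (Binary C) (edge_mset ?\<alpha> id (F d)) (ext (F d))"
        by (rule good_seqD[OF Fd(2)]) (use \<alpha> C(1) in \<open>force simp: K3 replace_new\<close>)+
      show "inj_on ?m (internal (F d))"
        by (rule inj_on_subset[OF inj_on_node_copy_internal[OF len]]) auto
    qed (use C(2) int attD in \<open>auto simp: m simp del: set_map\<close>)
    moreover have "(names (edge_mset ?\<alpha> ?m (F d)) - set (map ?m (ext (F d)))) \<inter> nodes H = {}"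
      using names_edge_mset_le[OF Fd(1), of ?\<alpha> ?m] int K2(5) by auto
    ultimately show ?thesis using K2(4) unfolding m by (auto simp: K3)
  qed
  show "good X (edge_mset \<alpha> id K) (ext K)"
    using k
  proof (cases rule: iso_Div_trxE)
    case (1 A' B')
    from iso_string_graph2E[OF 1(3) wf(2)] obtain d0 d1 n0 n1 n2 where D: "edges D = {d0, d1}"
      "d0 \<noteq> d1" "nodes D = {n0, n1, n2}" "distinct [n0, n1, n2]" "att D d0 = [n0, n1]"
      "att D d1 = [n1, n2]" "ext D = [n0, n2]" "label_iso (lab D d0) (tr \<iota> A')"
      "label_iso (lab D d1) (Dollar 2)" .
    have s': "s = d1" using s D by (auto simp: label_iso_Dollar)
    have att: "att H e = [n n0, n n2]" using n(1) D by simp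
    have n1: "n n1 \<notin> nodes H" using n(2) D by auto
    then have ne: "n n0 \<noteq> n n1" "n n1 \<noteq> n n2" using names_H att by auto
    obtain P where P: "edge_mset \<alpha> id K = ?M + P + {#(\<alpha> k, [n n1, n n2])#}" "ext K = ext H"
      "good (Binary A') P [n n0, n n1]" "(names P - {n n0, n n1}) \<inter> nodes H = {}"
      using pair[of d0 A'] D s' ne by (auto simp: insert_commute)
    have "good X (?M + P + {#(Binary (Under A' B'), [n n1, n n2])#}) (ext H)"
      by (rule good_subst_left[OF _ P(3)])
        (use goodH[of "Binary B'"] 1(2) att n1 names_H P(4) in auto)
    then show ?thesis using P(1,2) 1(1) by simp
  next
    case (2 A' B')
    from iso_string_graph2E[OF 2(3) wf(2)] obtain d0 d1 n0 n1 n2 where D: "edges D = {d0, d1}"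
      "d0 \<noteq> d1" "nodes D = {n0, n1, n2}" "distinct [n0, n1, n2]" "att D d0 = [n0, n1]"
      "att D d1 = [n1, n2]" "ext D = [n0, n2]" "label_iso (lab D d0) (Dollar 2)"
      "label_iso (lab D d1) (tr \<iota> A')" .
    have s': "s = d0" using s D by (auto simp: label_iso_Dollar)
    have att: "att H e = [n n0, n n2]" using n(1) D by simp
    have n1: "n n1 \<notin> nodes H" using n(2) D by auto
    then have ne: "n n0 \<noteq> n n1" "n n1 \<noteq> n n2" using names_H att by auto
    obtain P where P: "edge_mset \<alpha> id K = ?M + P + {#(\<alpha> k, [n n0, n n1])#}" "ext K = ext H"
      "good (Binary A') P [n n1, n n2]" "(names P - {n n1, n n2}) \<inter> nodes H = {}"
      using pair[of d1 A'] D s' ne by auto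
    have "good X (?M + P + {#(Binary (Over B' A'), [n n0, n n1])#}) (ext H)"
      by (rule good_subst_right[OF _ P(3)])
        (use goodH[of "Binary B'"] 2(2) att n1 names_H P(4) in auto)
    then show ?thesis using P(1,2) 2(1) by simp
  next
    case (3 A')
    from iso_loopE[OF 3(3) wf(2)] obtain d z where D: "edges D = {d}" "att D d = [z, z]" "ext D = []"
      by metis
    then have att: "att D s = [z, z]" "att H e = []" and del: "edges (delete_edge D s) = {}" and "ds = []"
      using s lenN ds by auto
    \<comment> \<open>A hyperedge of rank 0 lies on no walk. So in the main premise it was the whole
      antecedent, and the conclusion consists of a single loop, handled by
      \<open>BraceL\<close>.\<close>
    have "(Nullary A', []) \<notin> set (walk Binary x ws)" for x and ws :: "('q ltype \<times> bool \<times> nat) list"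
      by (induction "Binary :: 'q ltype \<Rightarrow> _" x ws rule: walk.induct) auto
    then have "add_mset (Nullary A', []) ?M \<noteq> binary_walk x ws" for x ws
      by (metis set_mset_mset union_single_eq_member)
    then obtain C where C: "X = Nullary C" "?M = {#}" "ext H = []" "lbr [A'] (Brace C)"
      using goodH[of "Nullary A'"] 3(2) att by (cases X) (auto simp: good.simps)
    have "lbr (word [(Brace A', True, n z)]) (Brace C)" using lbr.BraceL[OF C(4)] by simp
    then have "good (Nullary C) {#(Binary (Brace A'), [n z, n z])#} []"
      unfolding good.simps
      by (intro conjI disjI1 exI[of _ "n z"] exI[of _ "[(Brace A', True, n z)]"]) auto
    then show ?thesis
      using K2(4,8) C 3(1) att \<open>ds = []\<close> by (simp add: K' edge_mset_empty[OF del])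
  qed
qed

lemma good_seq_replaceD:
  assumes "good_seq \<iota> (replace G e H) L" "wf_graph G" "wf_graph H"
    and "\<And>x. x \<in> edges G - {e} \<Longrightarrow> label_iso (lab G x) (trx \<iota> (\<beta> x))"
    and "\<And>x. x \<in> edges H \<Longrightarrow> label_iso (lab H x) (trx \<iota> (\<alpha> x))"
    and "label_iso L (trx \<iota> X)"
  shows "good X (edge_mset \<beta> id (delete_edge G e) + edge_mset \<alpha> (node_copy G e H) H) (ext G)"
proof -
  \<comment> \<open>The two labellings are glued at the same threshold by which
    \<open>replace\<close> tells old hyperedges from copied ones.\<close>
  define \<gamma> where "\<gamma> x = (if x < fresh (edges G) then \<beta> x else \<alpha> (x - fresh (edges G)))" for x
  have fin: "finite (edges G)" "finite (edges H)" using assms(2,3) by (auto simp: wf_graph_def)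
  have old: "\<gamma> x = \<beta> x" if "x \<in> edges G" for x
    using less_fresh[OF fin(1) that] by (simp add: \<gamma>_def)
  have new: "\<gamma> \<circ> edge_copy G = \<alpha>" by (auto simp: \<gamma>_def edge_copy_def)
  then have new': "\<gamma> (edge_copy G x) = \<alpha> x" for x by (metis comp_apply)
  have "good X (edge_mset \<gamma> id (replace G e H)) (ext (replace G e H))"
    using assms(1)
  proof (rule good_seqD)
    fix x assume "x \<in> edges (replace G e H)"
    then consider "x \<in> edges G - {e}" | y where "y \<in> edges H" "x = edge_copy G y" by auto
    then show "label_iso (lab (replace G e H) x) (trx \<iota> (\<gamma> x))"
      by cases (use assms(4,5) fin in \<open>auto simp: replace_old replace_new old new'\<close>)
  qed fact
  moreover have "edge_mset \<gamma> id (delete_edge G e) = edge_mset \<beta> id (delete_edge G e)"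
    by (rule edge_mset_cong) (auto simp: old)
  ultimately show ?thesis by (simp add: edge_mset_replace[OF fin] new)
qed

lemma good_seq_divR:
  assumes div: "hl_type ok rk (Div N D)" and s: "s \<in> edges D" "lab D s = Dollar n"
    and len: "length (att D s) = length (ext F)"
    and N: "good_seq \<iota> (replace D s F) N"
    and F: "wf_graph F" "no_isolated F"
  shows "good_seq \<iota> F (Div N D)"
  unfolding good_seq_def
proof (intro allI impI)
  fix \<alpha> X
  assume \<alpha>: "\<forall>e\<in>edges F. label_iso (lab F e) (trx \<iota> (\<alpha> e))" and X: "label_iso (Div N D) (trx \<iota> X)"
  have wfD: "wf_graph D" using hypergraph_wf[OF hl_type_DivD(1)[OF div]] .
  have fin: "finite (nodes D)" using wfD by (simp add: wf_graph_def)
  let ?n = "node_copy D s F"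
  have good: "good Y (edge_mset \<beta> id (delete_edge D s) + edge_mset \<alpha> ?n F) (ext D)"
    if "\<And>x. x \<in> edges D - {s} \<Longrightarrow> label_iso (lab D x) (trx \<iota> (\<beta> x))" "label_iso N (trx \<iota> Y)" for \<beta> Y
    using good_seq_replaceD[OF N wfD F(1) that(1) _ that(2)] \<alpha> by blast
  have ext: "map ?n (ext F) = att D s" by (rule node_copy_ext[OF F(1) len[symmetric, THEN sym]])
  have names: "names (edge_mset \<alpha> ?n F) \<inter> nodes D \<subseteq> set (att D s)"
    using names_edge_mset_le[OF F(1), of \<alpha> ?n] node_copy_notin[OF fin len]
      node_copy_ext_in(1)[OF wfD F(1) s(1) len] by blast
  \<comment> \<open>This serves the two divisions, where \<open>s\<close> is attached to distinct
    nodes. For the bracelet both ends of \<open>F\<close> are sent to the node of the loop, and the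
    renaming cannot be inverted.\<close>
  have unrename: "good Y (edge_mset \<alpha> id F) (ext F)"
    if "good Y (edge_mset \<alpha> ?n F) (att D s)" "distinct (att D s)" for Y
  proof (rule good_unrename)
    show "good Y (rename ?n (edge_mset \<alpha> id F)) (map ?n (ext F))"
      using that(1) by (simp add: rename_edge_mset ext)
    show "inj_on ?n (names (edge_mset \<alpha> id F) \<union> set (ext F))"
      by (rule inj_on_subset[OF inj_on_node_copy[OF wfD F(1) s(1) len that(2)]]) simp
  qed
  show "good X (edge_mset \<alpha> id F) (ext F)"
    using X
  proof (cases rule: iso_Div_trxE)
    case (1 A B)
    from iso_string_graph2E[OF 1(3) wfD] obtain d0 d1 n0 n1 n2 where D: "edges D = {d0, d1}"
      "d0 \<noteq> d1" "nodes D = {n0, n1, n2}" "distinct [n0, n1, n2]" "att D d0 = [n0, n1]"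
      "att D d1 = [n1, n2]" "ext D = [n0, n2]" "label_iso (lab D d0) (tr \<iota> A)"
      "label_iso (lab D d1) (Dollar 2)" .
    have "s = d1" using s D by (auto simp: label_iso_Dollar)
    then have del: "edges (delete_edge D s) = {d0}" using D by auto
    have "good (Binary B) (add_mset (Binary A, [n0, n1]) (edge_mset \<alpha> ?n F)) [n0, n2]"
    proof -
      have "good (Binary B) (edge_mset (\<lambda>_. Binary A) id (delete_edge D s) + edge_mset \<alpha> ?n F) (ext D)"
        by (rule good) (use 1(2) D \<open>s = d1\<close> in auto)
      then show ?thesis using D by (simp add: edge_mset_singleton[OF del])
    qed
    then have "good (Binary (Under A B)) (edge_mset \<alpha> ?n F) [n1, n2]"
      by (rule good_cons_elim) (use names D \<open>s = d1\<close> in auto)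
    then show ?thesis using unrename D \<open>s = d1\<close> 1(1) by simp
  next
    case (2 A B)
    from iso_string_graph2E[OF 2(3) wfD] obtain d0 d1 n0 n1 n2 where D: "edges D = {d0, d1}"
      "d0 \<noteq> d1" "nodes D = {n0, n1, n2}" "distinct [n0, n1, n2]" "att D d0 = [n0, n1]"
      "att D d1 = [n1, n2]" "ext D = [n0, n2]" "label_iso (lab D d0) (Dollar 2)"
      "label_iso (lab D d1) (tr \<iota> A)" .
    have "s = d0" using s D by (auto simp: label_iso_Dollar)
    then have del: "edges (delete_edge D s) = {d1}" using D by auto
    have "good (Binary B) (add_mset (Binary A, [n1, n2]) (edge_mset \<alpha> ?n F)) [n0, n2]"
    proof -
      have "good (Binary B) (edge_mset (\<lambda>_. Binary A) id (delete_edge D s) + edge_mset \<alpha> ?n F) (ext D)"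
        by (rule good) (use 2(2) D \<open>s = d0\<close> in auto)
      then show ?thesis using D by (simp add: edge_mset_singleton[OF del])
    qed
    then have "good (Binary (Over B A)) (edge_mset \<alpha> ?n F) [n0, n1]"
      by (rule good_snoc_elim) (use names D \<open>s = d0\<close> in auto)
    then show ?thesis using unrename D \<open>s = d0\<close> 2(1) by simp
  next
    case (3 A)
    from iso_loopE[OF 3(3) wfD] obtain d z where D: "edges D = {d}" "nodes D = {z}"
      "att D d = [z, z]" "ext D = []" .
    have "s = d" using s D by auto
    then have del: "edges (delete_edge D s) = {}" using D by auto
    have good': "good (Nullary A) (rename ?n (edge_mset \<alpha> id F)) []"
    proof -
      have "good (Nullary A) (edge_mset (\<lambda>_. Binary A) id (delete_edge D s) + edge_mset \<alpha> ?n F) (ext D)"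
        by (rule good) (use 3(2) D \<open>s = d\<close> in auto)
      then show ?thesis using D by (simp add: edge_mset_empty[OF del] rename_edge_mset)
    qed
    obtain x y where xy: "ext F = [x, y]" "x \<noteq> y"
      using len[symmetric] D \<open>s = d\<close> F(1) by (auto simp: wf_graph_def numeral_2_eq_2 length_Suc_conv)
    have k: "?n x = z" "?n y = z" using ext xy D \<open>s = d\<close> by auto
    \<comment> \<open>Absence of isolated nodes enters here: it guarantees that both external nodes
      of \<open>F\<close> occur on edges, as \<open>good_unfuse\<close> requires.\<close>
    have namesF: "names (edge_mset \<alpha> id F) = nodes F"
      using names_edge_mset_nodes[OF F, of \<alpha> id] by simp
    have int: "?n p \<noteq> z" if "p \<notin> {x, y}" for p
      using node_copy_notin[OF fin len, of p] that xy D by auto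
    have "good (Binary (Brace A)) (edge_mset \<alpha> id F) [x, y]"
    proof (rule good_unfuse[where k = ?n and x = x and y = y, OF good' k xy(2)])
      show "p = q" if "?n p = ?n q" "?n p \<noteq> z" for p q
        using inj_on_node_copy_internal[OF len] that k xy(1) by (auto dest!: inj_onD)
    qed (use namesF xy int F(1) in \<open>auto simp: wf_graph_def\<close>)
    then show ?thesis using 3(1) xy by simp
  qed
qed

lemma good_seq_timesL:
  assumes e: "e \<in> edges G" "lab G e = Times F" and "good_seq \<iota> (replace G e F) A"
    and G: "hl_sequent ok rk G A"
  shows "good_seq \<iota> G A"
  unfolding good_seq_def
proof (intro allI impI)
  fix \<alpha> X
  assume \<alpha>: "\<forall>e\<in>edges G. label_iso (lab G e) (trx \<iota> (\<alpha> e))" and X: "label_iso A (trx \<iota> X)"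
  have wf: "wf_graph G" "wf_graph F"
    using hl_sequent_wf[OF G] G e hypergraph_wf
    by (force simp: hl_sequent_def elim: hl_type_TimesE)+
  have len: "length (att G e) = length (ext F)"
    using G e by (auto simp: hl_sequent_def hypergraph_def)
  have fin: "finite (nodes G)" "finite (edges G)" using wf by (auto simp: wf_graph_def)
  let ?n = "node_copy G e F" and ?M = "edge_mset \<alpha> id (delete_edge G e)"
  have good: "good X (?M + edge_mset \<beta> ?n F) (ext G)"
    if "\<And>x. x \<in> edges F \<Longrightarrow> label_iso (lab F x) (trx \<iota> (\<beta> x))" for \<beta>
    by (rule good_seq_replaceD[OF assms(3) wf _ that X]) (use \<alpha> in auto)
  have ext: "map ?n (ext F) = att G e" by (rule node_copy_ext[OF wf(2) len])
  have old: "names ?M \<union> set (ext G) \<union> set (att G e) \<subseteq> nodes G"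
    using wf e by (auto simp: names_edge_mset wf_graph_def)
  have M: "edge_mset \<alpha> id G = add_mset (\<alpha> e, att G e) ?M"
    using edge_mset_delete[OF fin(2) e(1), of \<alpha> id] by simp
  have "label_iso (Times F) (trx \<iota> (\<alpha> e))" using \<alpha> e by force
  then show "good X (edge_mset \<alpha> id G) (ext G)"
  proof (cases rule: iso_Times_trxE)
    case (1 B C)
    from iso_string_graph2E[OF 1(2) wf(2)] obtain d0 d1 n0 n1 n2 where D: "edges F = {d0, d1}"
      "d0 \<noteq> d1" "nodes F = {n0, n1, n2}" "distinct [n0, n1, n2]" "att F d0 = [n0, n1]"
      "att F d1 = [n1, n2]" "ext F = [n0, n2]" "label_iso (lab F d0) (tr \<iota> B)"
      "label_iso (lab F d1) (tr \<iota> C)" .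
    have att: "att G e = [?n n0, ?n n2]" using ext D by simp
    have n1: "?n n1 \<notin> nodes G" using node_copy_notin[OF fin(1) len] D by auto
    have "edge_mset (\<lambda>x. if x = d0 then Binary B else Binary C) ?n F =
        {#(Binary B, [?n n0, ?n n1]), (Binary C, [?n n1, ?n n2])#}"
      using edge_mset_pair[OF D(1,2), of "\<lambda>x. if x = d0 then Binary B else Binary C" ?n] D by simp
    then have "good X (add_mset (Binary B, [?n n0, ?n n1])
        (add_mset (Binary C, [?n n1, ?n n2]) ?M)) (ext G)"
      using good[of "\<lambda>x. if x = d0 then Binary B else Binary C"] D by fastforce
    then have "good X (add_mset (Binary (Prod B C), [?n n0, ?n n2]) ?M) (ext G)"
      by (rule good_contract) (use n1 old att in auto)
    then show ?thesis using M 1(1) att by simp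
  next
    case (2 B)
    from iso_reversalE[OF 2(2) wf(2)] obtain d n0 n1 where D: "edges F = {d}" "nodes F = {n0, n1}"
      "n0 \<noteq> n1" "att F d = [n0, n1]" "ext F = [n1, n0]" "label_iso (lab F d) (tr \<iota> B)" .
    have att: "att G e = [?n n1, ?n n0]" using ext D by simp
    have "good X (add_mset (Binary B, [?n n0, ?n n1]) ?M) (ext G)"
      using good[of "\<lambda>_. Binary B"] D by (auto simp: edge_mset_singleton[OF D(1)])
    \<comment> \<open>In place of the \<open>B\<close>-edge comes a single \<open>Rev B\<close>-edge
      traversed backwards. Its letter is \<open>Rev (Rev B)\<close>, from which \<open>RRL\<close>
      derives \<open>B\<close>.\<close>
    then have "good X (?M + binary_walk (?n n0) [(Rev B, False, ?n n1)]) (ext G)"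
      by (rule good_subst)
        (use lbr.RRL[of "[]" B "[]" B] lbr.Ax[of B] in \<open>auto simp: inner_def\<close>)
    then show ?thesis using M 2(1) att by simp
  next
    case (3 B)
    from iso_loopE[OF 3(2) wf(2)] obtain d z where D: "edges F = {d}" "nodes F = {z}"
      "att F d = [z, z]" "ext F = []" "label_iso (lab F d) (tr \<iota> B)" .
    have att: "att G e = []" using len D by simp
    have "good X (add_mset (Binary B, [?n z, ?n z]) ?M) (ext G)"
      using good[of "\<lambda>_. Binary B"] D by (auto simp: edge_mset_singleton[OF D(1)])
    then show ?thesis using M 3(1) att good_unfold_loop by simp
  qed
qed

text \<open>The copy of \<open>G\<close> is made after \<open>F\<close> has been inserted, so its
  internal nodes avoid both \<open>M\<close> and the copy of \<open>F\<close>. Hence the two paths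
  meet at most in nodes of \<open>M\<close>, which is what concatenation needs.\<close>

lemma good_replace_pair:
  fixes \<iota> :: "'q \<Rightarrow> 'p"
  assumes wf: "wf_graph M" "wf_graph F" "wf_graph G"
    and M: "edges M = {a, b}" "a \<noteq> b" "distinct (att M a)" "distinct (att M b)"
    and len: "length (att M a) = length (ext F)" "length (att M b) = length (ext G)"
    and good: "good_seq \<iota> F (lab M a)" "good_seq \<iota> G (lab M b)"
    and lab: "label_iso (lab M a) (trx \<iota> A)" "label_iso (lab M b) (trx \<iota> B)"
    and K: "K = replaces M [(a, F), (b, G)]" "\<forall>e\<in>edges K. label_iso (lab K e) (trx \<iota> (\<alpha> e))"
  shows "\<exists>P Q. edge_mset \<alpha> id K = P + Q \<and> good A P (att M a) \<and> good B Q (att M b) \<and>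
    (names P - set (att M a)) \<inter> nodes M = {} \<and> (names Q - set (att M b)) \<inter> nodes M = {} \<and>
    (names P - set (att M a)) \<inter> (names Q - set (att M b)) = {}"
proof -
  define K1 where "K1 = replace M a F"
  have K': "K = replace K1 b G" by (simp add: K K1_def)
  have a: "a \<in> edges M" and b: "b \<in> edges K1" using M by (auto simp: K1_def)
  have wf1: "wf_graph K1" unfolding K1_def by (rule wf_graph_replace[OF wf(1,2) a len(1)])
  have fin: "finite (edges M)" "finite (edges F)" "finite (edges G)" "finite (edges K1)"
    "finite (nodes M)" "finite (nodes K1)"
    using wf wf1 by (auto simp: wf_graph_def)
  have att: "att K1 b = att M b" using M fin by (simp add: K1_def replace_old)
  have len': "length (att K1 b) = length (ext G)" using att len by simp
  let ?n = "node_copy M a F" and ?m = "node_copy K1 b G"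
  let ?\<beta> = "\<alpha> \<circ> edge_copy M" and ?\<gamma> = "\<alpha> \<circ> edge_copy K1"
  let ?P = "edge_mset ?\<beta> ?n F" and ?Q = "edge_mset ?\<gamma> ?m G"
  have attM: "set (att M a) \<subseteq> nodes M" "set (att M b) \<subseteq> nodes M"
    using wf(1) M(1) by (auto simp: wf_graph_def)
  have ext: "map ?n (ext F) = att M a" "map ?m (ext G) = att M b"
    using node_copy_ext[OF wf(2) len(1)] node_copy_ext[OF wf(3) len'] att by simp_all
  have int: "?n ` internal F \<inter> nodes M = {}" "?m ` internal G \<inter> nodes K1 = {}"
    using node_copy_notin[OF fin(5) len(1)] node_copy_notin[OF fin(6) len'] by auto
  have sub: "nodes M \<union> ?n ` internal F \<subseteq> nodes K1" by (auto simp: K1_def)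
  have "edges (delete_edge (delete_edge M a) b) = {}" using M by auto
  then have "edge_mset \<alpha> id (delete_edge K1 b) = ?P"
    using edge_mset_delete_replace[OF fin(1,2), of b a \<alpha> id] M
    by (simp add: K1_def edge_mset_empty)
  then have "edge_mset \<alpha> id K = ?P + ?Q"
    using edge_mset_replace[OF fin(4,3), of \<alpha> id b] by (simp add: K')
  moreover have "good A ?P (map ?n (ext F))"
  proof (rule good_embed[OF _ wf(2)])
    have "edge_copy M x \<in> edges K \<and> lab K (edge_copy M x) = lab F x" if "x \<in> edges F" for x
      using that M edge_copy_notin[OF fin(1), of x] fin
      by (auto simp: K' K1_def replace_old replace_new)
    then show "good A (edge_mset ?\<beta> id F) (ext F)"
      by (intro good_seqD[OF good(1) _ lab(1)]) (use K(2) in force)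
    show "inj_on ?n (internal F)"
      by (rule inj_on_subset[OF inj_on_node_copy_internal[OF len(1)]]) auto
  qed (use M(3) int(1) attM in \<open>auto simp: ext simp del: set_map\<close>)
  moreover have "good B ?Q (map ?m (ext G))"
  proof (rule good_embed[OF _ wf(3)])
    show "good B (edge_mset ?\<gamma> id G) (ext G)"
      by (intro good_seqD[OF good(2) _ lab(2)]) (use K(2) in \<open>force simp: K' replace_new\<close>)
    show "inj_on ?m (internal G)"
      by (rule inj_on_subset[OF inj_on_node_copy_internal[OF len']]) auto
  qed (use M(4) int(2) attM sub in \<open>auto simp: ext simp del: set_map\<close>)
  moreover have P: "names ?P - set (map ?n (ext F)) \<subseteq> ?n ` internal F"
    using names_edge_mset_le[OF wf(2), of ?\<beta> ?n] by auto
  moreover have Q: "names ?Q - set (map ?m (ext G)) \<subseteq> ?m ` internal G"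
    using names_edge_mset_le[OF wf(3), of ?\<gamma> ?m] by auto
  moreover have "(names ?P - set (map ?n (ext F))) \<inter> nodes M = {}" using P int(1) by blast
  moreover have "(names ?Q - set (map ?m (ext G))) \<inter> nodes M = {}" using Q int(2) sub by blast
  moreover have "(names ?P - set (map ?n (ext F))) \<inter> (names ?Q - set (map ?m (ext G))) = {}"
    using P Q int(2) sub by blast
  ultimately show ?thesis
    unfolding ext by (intro exI[of _ ?P] exI[of _ ?Q] conjI)
qed

lemma good_seq_timesR:
  fixes M K :: "'p label hgraph" and \<iota> :: "'q \<Rightarrow> 'p"
  assumes ms: "distinct ms" "set ms = edges M"
    and F: "\<And>m. m \<in> set ms \<Longrightarrow> wf_graph (F m) \<and> good_seq \<iota> (F m) (lab M m) \<and>
      length (att M m) = length (ext (F m))"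
    and K: "K = replaces M (map (\<lambda>m. (m, F m)) ms)" and M: "hl_type ok rk (Times M)"
  shows "good_seq \<iota> K (Times M)"
  unfolding good_seq_def
proof (intro allI impI)
  fix \<alpha> X
  assume \<alpha>: "\<forall>e\<in>edges K. label_iso (lab K e) (trx \<iota> (\<alpha> e))" and X: "label_iso (Times M) (trx \<iota> X)"
  have wfM: "wf_graph M" using M hypergraph_wf by (auto elim: hl_type_TimesE)
  then have finM: "finite (nodes M)" "finite (edges M)" by (auto simp: wf_graph_def)
  have single: "edge_mset \<alpha> id K = edge_mset (\<alpha> \<circ> edge_copy M) (node_copy M d (F d)) (F d)"
      "ext K = ext M" "length (att M d) = length (ext (F d))" "wf_graph (F d)"
      "\<And>B. label_iso (lab M d) (tr \<iota> B) \<Longrightarrow> good (Binary B) (edge_mset (\<alpha> \<circ> edge_copy M) id (F d)) (ext (F d))"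
    if "edges M = {d}" for d
  proof -
    have "ms = [d]"
      using ms that by (cases ms) (auto dest: subset_singletonD)
    then have K': "K = replace M d (F d)" and Fd: "wf_graph (F d)" "good_seq \<iota> (F d) (lab M d)"
      "length (att M d) = length (ext (F d))"
      using K F by auto
    have e: "edges (delete_edge M d) = {}" using that by simp
    show "edge_mset \<alpha> id K = edge_mset (\<alpha> \<circ> edge_copy M) (node_copy M d (F d)) (F d)"
      using edge_mset_replace[OF finM(2), of "F d" \<alpha> id d] Fd(1)
      by (simp add: K' edge_mset_empty[OF e] wf_graph_def)
    show "ext K = ext M" by (simp add: K')
    show "good (Binary B) (edge_mset (\<alpha> \<circ> edge_copy M) id (F d)) (ext (F d))"
      if "label_iso (lab M d) (tr \<iota> B)" for B
      by (rule good_seqD[OF Fd(2)]) (use \<alpha> that K' in \<open>force simp: replace_new\<close>)+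
  qed (use F ms that in auto)
  show "good X (edge_mset \<alpha> id K) (ext K)"
    using X
  proof (cases rule: iso_Times_trxE)
    case (1 A B)
    from iso_string_graph2E[OF 1(2) wfM] obtain d0 d1 n0 n1 n2 where D: "edges M = {d0, d1}"
      "d0 \<noteq> d1" "nodes M = {n0, n1, n2}" "distinct [n0, n1, n2]" "att M d0 = [n0, n1]"
      "att M d1 = [n1, n2]" "ext M = [n0, n2]" "label_iso (lab M d0) (tr \<iota> A)"
      "label_iso (lab M d1) (tr \<iota> B)" .
    have F0: "wf_graph (F d0)" "good_seq \<iota> (F d0) (lab M d0)" "length (att M d0) = length (ext (F d0))"
      and F1: "wf_graph (F d1)" "good_seq \<iota> (F d1) (lab M d1)" "length (att M d1) = length (ext (F d1))"
      using F ms D(1) by auto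
    have "\<exists>P Q. edge_mset \<alpha> id K = P + Q \<and> good (Binary A) P [n0, n1] \<and> good (Binary B) Q [n1, n2] \<and>
        (names P - {n0, n1}) \<inter> nodes M = {} \<and> (names Q - {n1, n2}) \<inter> nodes M = {} \<and>
        (names P - {n0, n1}) \<inter> (names Q - {n1, n2}) = {}"
    proof -
      have "length ms = 2" using distinct_card[OF ms(1)] ms(2) D by simp
      then obtain a b where "ms = [a, b]" by (auto simp: numeral_2_eq_2 length_Suc_conv)
      then consider "ms = [d0, d1]" | "ms = [d1, d0]" using ms D by (auto simp: doubleton_eq_iff)
      then show ?thesis
      proof cases
        case 1
        then show ?thesis
          using good_replace_pair[OF wfM F0(1) F1(1) D(1,2) _ _ F0(3) F1(3) F0(2) F1(2), of "Binary A" "Binary B" K \<alpha>]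
            D K \<alpha> by simp
      next
        \<comment> \<open>The rule lists the premises in an arbitrary order, so the second factor
          may be inserted first; the sum of multisets is the same.\<close>
        case 2
        have "edges M = {d1, d0}" using D by auto
        then have "\<exists>Q P. edge_mset \<alpha> id K = Q + P \<and> good (Binary B) Q [n1, n2] \<and> good (Binary A) P [n0, n1] \<and>
            (names Q - {n1, n2}) \<inter> nodes M = {} \<and> (names P - {n0, n1}) \<inter> nodes M = {} \<and>
            (names Q - {n1, n2}) \<inter> (names P - {n0, n1}) = {}"
          using good_replace_pair[OF wfM F1(1) F0(1) _ D(2)[symmetric] _ _ F1(3) F0(3) F1(2) F0(2),
              of "Binary B" "Binary A" K \<alpha>] D K \<alpha> 2 by simp
        then show ?thesis by (metis add.commute Int_commute)
      qed
    qed
    then obtain P Q where PQ: "edge_mset \<alpha> id K = P + Q" "good (Binary A) P [n0, n1]"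
      "good (Binary B) Q [n1, n2]" "(names P - {n0, n1}) \<inter> nodes M = {}"
      "(names Q - {n1, n2}) \<inter> nodes M = {}" "(names P - {n0, n1}) \<inter> (names Q - {n1, n2}) = {}"
      by blast
    have "n0 \<noteq> n1" "n0 \<noteq> n2" "n1 \<noteq> n2" using D by auto
    then have "names P \<inter> names Q \<subseteq> {n1}" using PQ(4-6) unfolding D(3) by blast
    then have "good (Binary (Prod A B)) (edge_mset \<alpha> id K) [n0, n2]"
      unfolding PQ(1) by (rule good_append[OF PQ(2,3) _ \<open>n0 \<noteq> n2\<close>])
    moreover have "ext K = ext M" unfolding K by (rule ext_replaces)
    ultimately show ?thesis using 1(1) D by simp
  next
    case (2 A)
    from iso_reversalE[OF 2(2) wfM] obtain d n0 n1 where D: "edges M = {d}" "nodes M = {n0, n1}"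
      "n0 \<noteq> n1" "att M d = [n0, n1]" "ext M = [n1, n0]" "label_iso (lab M d) (tr \<iota> A)" .
    let ?n = "node_copy M d (F d)"
    note sd = single[OF D(1)]
    have ext: "map ?n (ext (F d)) = [n0, n1]" using node_copy_ext[OF sd(4,3)] D by simp
    have "good (Binary A) (edge_mset (\<alpha> \<circ> edge_copy M) ?n (F d)) (map ?n (ext (F d)))"
    proof (rule good_embed[OF sd(5)[OF D(6)] sd(4)])
      show "inj_on ?n (internal (F d))"
        by (rule inj_on_subset[OF inj_on_node_copy_internal[OF sd(3)]]) auto
      show "?n ` internal (F d) \<inter> set (map ?n (ext (F d))) = {}"
        using node_copy_notin[OF finM(1) sd(3)] unfolding ext D(2) by auto
    qed (use ext D in auto)
    then show ?thesis using good_reverse sd(1,2) D 2(1) ext by simp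
  next
    case (3 A)
    from iso_loopE[OF 3(2) wfM] obtain d z where D: "edges M = {d}" "nodes M = {z}"
      "att M d = [z, z]" "ext M = []" "label_iso (lab M d) (tr \<iota> A)" .
    let ?n = "node_copy M d (F d)" and ?P = "edge_mset (\<alpha> \<circ> edge_copy M) id (F d)"
    note sd = single[OF D(1)]
    obtain x y where xy: "ext (F d) = [x, y]" "x \<noteq> y"
      using sd(3)[symmetric] sd(4) D by (auto simp: wf_graph_def numeral_2_eq_2 length_Suc_conv)
    have k: "?n x = z" "?n y = z" using node_copy_ext[OF sd(4,3)] D xy by auto
    have "good (Nullary A) (rename ?n ?P) []"
    proof (rule good_fuse[where k = ?n and x = x and y = y, OF _ _ k])
      show "good (Binary A) ?P [x, y]" using sd(5)[OF D(5)] xy by simp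
      show "inj_on ?n (names ?P - {x, y})"
        by (rule inj_on_subset[OF inj_on_node_copy_internal[OF sd(3)]]) (auto simp: xy)
      show "z \<notin> ?n ` (names ?P - {x, y})"
        using node_copy_notin[OF finM(1) sd(3)] D xy by auto
    qed
    then show ?thesis using sd(1,2) D 3(1) by (simp add: rename_edge_mset)
  qed
qed

lemma hl_good_seq:
  fixes \<iota> :: "'q \<Rightarrow> 'p"
  assumes "hl no_isolated rk K L" "inj \<iota>" "\<And>q. rk (\<iota> q) = 2"
  shows "good_seq \<iota> K L"
  using assms(1)
proof (induction rule: hl.induct)
  case (Iso H A H' A')
  then show ?case
    using good_seq_iso hl_sequent_wf[OF hl_sequentD[OF Iso(1)]] by blast
next
  case (Ax p)
  show ?case
    unfolding good_seq_def
  proof (intro allI impI)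
    fix \<alpha> X
    assume \<alpha>: "\<forall>e\<in>edges (bullet rk (Prim p)). label_iso (lab (bullet rk (Prim p)) e) (trx \<iota> (\<alpha> e))"
      and X: "label_iso (Prim p) (trx \<iota> X)"
    have *: "\<exists>q. Y = Binary (LPrim q) \<and> \<iota> q = p" if "label_iso (Prim p) (trx \<iota> Y)" for Y
    proof (cases Y)
      case (Binary A)
      then show ?thesis using that by (cases A) (auto simp: bracelet_def elim: label_iso_PrimE)
    next
      case (Nullary A)
      then show ?thesis using that by (auto elim: label_iso_PrimE)
    qed
    obtain q where q: "X = Binary (LPrim q)" "\<iota> q = p" using *[OF X] by blast
    \<comment> \<open>Injectivity of \<open>\<iota>\<close> forces antecedent and succedent to carry
      the same primitive type.\<close>
    have "\<alpha> 0 = Binary (LPrim q)" using *[of "\<alpha> 0"] \<alpha> q assms(2) by (auto simp: bullet_def dest: injD)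
    moreover have "edges (bullet rk (Prim p)) = {0}" by (simp add: bullet_def)
    moreover have "rk p = 2" using assms(3) q by blast
    ultimately have "edge_mset \<alpha> id (bullet rk (Prim p)) = {#(Binary (LPrim q), [0, 1])#}"
      "ext (bullet rk (Prim p)) = [0, 1]"
      by (auto simp: edge_mset_singleton bullet_def upt_rec)
    then show "good X (edge_mset \<alpha> id (bullet rk (Prim p))) (ext (bullet rk (Prim p)))"
      unfolding q good.simps using lbr.Ax[of "LPrim q"]
      by (intro exI[of _ 0] exI[of _ "[(LPrim q, True, 1)]"]) auto
  qed
next
  case (DivL N D s n ds e H A F K)
  show ?case
    by (rule good_seq_divL[OF DivL(1-7) hl_sequentD[OF DivL(8)] DivL(11) _ DivL(9)])
      (use DivL(12) hl_sequent_wf hl_sequentD in blast)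
next
  case (DivR N D s n F)
  then show ?case
    using good_seq_divR hl_sequent_wf by (metis hl_sequent_def)
next
  case (TimesL e G F A)
  then show ?case using good_seq_timesL by blast
next
  case (TimesR ms M F K)
  show ?case
    by (rule good_seq_timesR[where ok = no_isolated and rk = rk, OF TimesR(1,2) _ TimesR(3)])
      (use TimesR(5) hl_sequent_wf hl_sequentD in blast, use TimesR(4) in \<open>simp add: hl_sequent_def\<close>)
qed

lemma walk_string:
  "mset (walk t i (map (\<lambda>k. (As ! k, True, Suc k)) [i..<n])) = {# (t (As ! k), [k, Suc k]). k \<in># mset [i..<n] #}"
proof (induction "n - i" arbitrary: i)
  case (Suc d)
  then show ?case by (simp add: upt_conv_Cons)
qed simp

lemma HL_WI_imp_lbr:
  fixes \<iota> :: "'q \<Rightarrow> 'p"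
  assumes hl: "HL_WI rk (string_graph (map (tr \<iota>) As)) (tr \<iota> B)"
    and "As \<noteq> []" "inj \<iota>" "\<And>q. rk (\<iota> q) = 2"
  shows "lbr As B"
proof -
  let ?n = "length As" and ?G = "string_graph (map (tr \<iota>) As)"
  define ws where "ws = map (\<lambda>k. (As ! k, True, Suc k)) [0..<?n]"
  have "good_seq \<iota> ?G (tr \<iota> B)"
    using hl_good_seq[OF hl[unfolded HL_WI_def] assms(3,4)] .
  then have "good (Binary B) (edge_mset (\<lambda>k. Binary (As ! k)) id ?G) (ext ?G)"
    by (rule good_seqD) (auto simp: string_graph_def label_iso_refl)
  moreover have "edge_mset (\<lambda>k. Binary (As ! k)) id ?G = binary_walk 0 ws"
    unfolding ws_def walk_string by (simp add: edge_mset_def string_graph_def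
        mset_set_upto_eq_mset_upto del: mset_upt)
  moreover have "ext ?G = [0, ?n]" by (simp add: string_graph_def)
  ultimately obtain ws' where ws': "distinct (0 # stops ws')" "binary_walk 0 ws = binary_walk 0 ws'"
    "lbr (word ws') B" by (auto simp: good.simps)
  have "stops ws = map Suc [0..<?n]" by (simp add: ws_def stops_def comp_def)
  then have "distinct (0 # stops ws)" by (simp add: distinct_map)
  \<comment> \<open>So far some walk along these edges spells a derivable word; uniqueness
    identifies it with the string graph read from left to right.\<close>
  with ws' have "ws = ws'" by (intro walk_unique[of Binary]) (auto simp: inj_def)
  moreover have "word ws = As"
    by (rule nth_equalityI) (auto simp: ws_def word_def signs_def)
  ultimately show ?thesis using ws' by simp
qed

section \<open>Derivability of named graphs\<close>

definition rep :: "('p \<Rightarrow> nat) \<Rightarrow> 'p label hgraph \<Rightarrow> (nat \<Rightarrow> nat) \<Rightarrow>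
    ('p label \<times> nat list) multiset \<Rightarrow> nat list \<Rightarrow> bool" where
  "rep rk G f M xs \<longleftrightarrow> hypergraph rk G \<and> no_isolated G \<and> inj_on f (nodes G) \<and>
     edge_mset (lab G) f G = M \<and> map f (ext G) = xs"

text \<open>One derivable representative is demanded, but by \<open>rep_iso\<close> and the rule
  \<open>Iso\<close> derivability then passes to all of them (\<open>der_hl\<close>). Node names are
  arbitrary and need not be those of the graph.\<close>

definition der :: "('p \<Rightarrow> nat) \<Rightarrow> ('p label \<times> nat list) multiset \<Rightarrow> nat list \<Rightarrow> 'p label \<Rightarrow> bool" where
  "der rk M xs L \<longleftrightarrow> (\<exists>G f. rep rk G f M xs \<and> hl no_isolated rk G L)"

definition typed :: "('p \<Rightarrow> nat) \<Rightarrow> ('p label \<times> nat list) multiset \<Rightarrow> bool" where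
  "typed rk M \<longleftrightarrow> (\<forall>(l, a)\<in>#M. hl_type no_isolated rk l \<and> length a = rank rk l)"

lemma typed_simps [simp]:
  "typed rk {#}"
  "typed rk (add_mset (l, a) M) \<longleftrightarrow> hl_type no_isolated rk l \<and> length a = rank rk l \<and> typed rk M"
  "typed rk (M + N) \<longleftrightarrow> typed rk M \<and> typed rk N"
  by (auto simp: typed_def)

lemma rep_wf: "rep rk G f M xs \<Longrightarrow> wf_graph G"
  by (auto simp: rep_def hypergraph_wf)

lemma rep_names:
  assumes "rep rk G f M xs"
  shows "names M = f ` nodes G"
  using assms names_edge_mset_nodes[OF rep_wf[OF assms], of "lab G" f] by (auto simp: rep_def)

lemma rep_ext:
  assumes "rep rk G f M xs"
  shows "distinct xs" "set xs \<subseteq> names M"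
proof -
  have "inj_on f (nodes G)" "xs = map f (ext G)" "set (ext G) \<subseteq> nodes G" "distinct (ext G)"
    using assms rep_wf[OF assms] by (auto simp: rep_def wf_graph_def)
  then show "distinct xs" "set xs \<subseteq> names M"
    using rep_names[OF assms] by (auto simp: distinct_map inj_on_subset)
qed

lemma rep_internal:
  assumes "rep rk G f M xs"
  shows "inj_on f (internal G)" "f ` internal G = names M - set xs"
proof -
  have inj: "inj_on f (nodes G)" and "xs = map f (ext G)" and "set (ext G) \<subseteq> nodes G"
    using assms rep_wf[OF assms] by (auto simp: rep_def wf_graph_def)
  then show "f ` internal G = names M - set xs"
    using rep_names[OF assms] by (auto dest: inj_onD)
  show "inj_on f (internal G)" using inj by (auto elim: inj_on_subset)
qed

lemma rep_edgeE:
  assumes "rep rk G f (add_mset (l, a) M) xs"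
  obtains e where "e \<in> edges G" "lab G e = l" "map f (att G e) = a"
    "edge_mset (lab G) f (delete_edge G e) = M"
proof -
  have fin: "finite (edges G)" using rep_wf[OF assms] by (simp add: wf_graph_def)
  have M: "edge_mset (lab G) f G = add_mset (l, a) M" using assms by (simp add: rep_def)
  then have "(l, a) \<in># edge_mset (lab G) f G" by simp
  then obtain e where e: "e \<in> edges G" "(l, a) = (lab G e, map f (att G e))"
    using in_edge_mset[OF fin] by blast
  then show ?thesis using that[of e] M edge_mset_delete[OF fin e(1), of "lab G" f] by auto
qed

lemma rep_typed:
  assumes "rep rk G f M xs"
  shows "typed rk M \<longleftrightarrow> (\<forall>e\<in>edges G. hl_type no_isolated rk (lab G e))"
proof -
  have "finite (edges G)" using rep_wf[OF assms] by (simp add: wf_graph_def)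
  then show ?thesis
    using assms by (auto simp: rep_def typed_def hypergraph_def edge_mset_def)
qed

lemma der_typed:
  assumes "der rk M xs L"
  shows "typed rk M" "hl_type no_isolated rk L" "distinct xs" "set xs \<subseteq> names M"
proof -
  obtain G f where G: "rep rk G f M xs" "hl_sequent no_isolated rk G L"
    using assms unfolding der_def by (blast dest: hl_sequentD)
  then show "typed rk M" "hl_type no_isolated rk L" "distinct xs" "set xs \<subseteq> names M"
    using rep_typed[OF G(1)] rep_ext[OF G(1)] by (auto simp: hl_sequent_def)
qed

lemma rep_hl_sequent:
  "rep rk G f M xs \<Longrightarrow> typed rk M \<Longrightarrow> hl_type no_isolated rk L \<Longrightarrow> hl_sequent no_isolated rk G L"
  by (auto simp: rep_typed hl_sequent_def) (auto simp: rep_def)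

text \<open>The hyperedges are the positions in a list enumerating \<open>M\<close>, since the same
  named edge may occur in \<open>M\<close> several times.\<close>

lemma rep_exists:
  assumes "typed rk M" "distinct xs" "set xs \<subseteq> names M"
  obtains G where "rep rk G id M xs"
proof -
  obtain l where l: "mset l = M" using ex_mset by blast
  define G where "G = HGraph (names M) {..<length l} (\<lambda>i. snd (l ! i)) (\<lambda>i. fst (l ! i)) xs"
  have nth: "l ! i \<in># M" if "i < length l" for i using l that by auto
  have "length (snd (l ! i)) = rank rk (fst (l ! i))" "set (snd (l ! i)) \<subseteq> names M"
    if "i < length l" for i
    using nth[OF that] assms(1) unfolding typed_def names_def by (cases "l ! i"; fastforce)+
  note edge = this
  have "hypergraph rk G"
    unfolding hypergraph_def
  proof (intro conjI ballI)
    fix i assume "i \<in> edges G"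
    then have i: "i < length l" by (simp add: G_def)
    show "set (att G i) \<subseteq> nodes G" using edge(2)[OF i] by (simp add: G_def)
    show "length (att G i) = rank rk (lab G i)" using edge(1)[OF i] by (simp add: G_def)
  qed (use assms(2,3) in \<open>simp_all add: G_def\<close>)
  moreover have "no_isolated G"
  proof -
    have "\<exists>i<length l. v \<in> set (snd (l ! i))" if v: "v \<in> names M" for v
    proof -
      obtain s where "s \<in> set l" "v \<in> set (snd s)"
        using v unfolding names_def l[symmetric] set_mset_mset by blast
      then show ?thesis by (metis in_set_conv_nth)
    qed
    then show ?thesis by (auto simp: no_isolated_def G_def)
  qed
  moreover have "edge_mset (lab G) id G = M"
  proof -
    have "edge_mset (lab G) id G = image_mset (\<lambda>i. l ! i) (mset_set {..<length l})"
      by (simp add: edge_mset_def G_def)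
    also have "\<dots> = mset (map (\<lambda>i. l ! i) [0..<length l])"
      by (simp only: mset_map mset_set_upto_eq_mset_upto)
    finally show ?thesis by (simp only: map_nth l)
  qed
  ultimately have "rep rk G id M xs" by (simp add: rep_def G_def)
  then show ?thesis using that by blast
qed

lemma image_mset_bij:
  assumes "finite A" "finite B" "image_mset f (mset_set A) = image_mset g (mset_set B)"
  shows "\<exists>h. bij_betw h A B \<and> (\<forall>a\<in>A. g (h a) = f a)"
  using assms
proof (induction arbitrary: B rule: finite_induct)
  case empty
  then have "B = {}" by (simp add: mset_set_empty_iff)
  then show ?case by (auto simp: bij_betw_def)
next
  case (insert a A)
  then have "f a \<in># image_mset g (mset_set B)" by (metis finite.insertI finite_set_mset_mset_set
        image_eqI image_iff insertI1 set_image_mset)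
  then obtain b where b: "b \<in> B" "g b = f a" using insert.prems(1) by auto
  have "image_mset f (mset_set A) = image_mset g (mset_set (B - {b}))"
    using insert.prems insert.hyps b mset_set.remove[OF insert.prems(1) b(1)] by simp
  from insert.IH[OF _ this] insert.prems(1) obtain h where
    h: "bij_betw h A (B - {b})" "\<forall>a\<in>A. g (h a) = f a" by auto
  have "bij_betw (h(a := b)) (insert a A) B"
  proof -
    have "bij_betw (h(a := b)) A (B - {b})"
      using h(1) insert.hyps by (subst bij_betw_cong[of A _ h]) auto
    then have "bij_betw (h(a := b)) (A \<union> {a}) ((B - {b}) \<union> {b})"
      by (rule bij_betw_combine) auto
    moreover have "(B - {b}) \<union> {b} = B" using b by auto
    ultimately show ?thesis by simp
  qed
  moreover have "\<forall>c\<in>insert a A. g ((h(a := b)) c) = f c"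
    using h(2) b insert.hyps by auto
  ultimately show ?case by blast
qed

text \<open>Equal multisets allow the hyperedges to be matched one by one. On nodes the isomorphism
  is \<open>f\<close> followed by the inverse of \<open>g\<close>; both namings have range
  \<open>names M\<close> because no node is isolated.\<close>

lemma rep_iso:
  assumes G: "rep rk G f M xs" and H: "rep rk H g M xs"
  shows "hg_iso label_iso G H"
proof -
  have fin: "finite (edges G)" "finite (edges H)"
    using rep_wf[OF G] rep_wf[OF H] by (auto simp: wf_graph_def)
  have "image_mset (\<lambda>e. (lab G e, map f (att G e))) (mset_set (edges G)) =
      image_mset (\<lambda>e. (lab H e, map g (att H e))) (mset_set (edges H))"
    using G H by (simp add: rep_def edge_mset_def)
  from image_mset_bij[OF fin this] obtain h where h: "bij_betw h (edges G) (edges H)"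
    "\<And>e. e \<in> edges G \<Longrightarrow> lab H (h e) = lab G e \<and> map g (att H (h e)) = map f (att G e)"
    by auto
  define j where "j = inv_into (nodes H) g \<circ> f"
  have g: "bij_betw g (nodes H) (names M)" and f: "bij_betw f (nodes G) (names M)"
    using G H rep_names[OF G] rep_names[OF H] by (auto simp: rep_def bij_betw_def)
  have j: "bij_betw j (nodes G) (nodes H)"
    unfolding j_def using f bij_betw_inv_into[OF g] by (rule bij_betw_trans)
  have map: "b = map j a" if "map g b = map f a" "set b \<subseteq> nodes H" for a b
  proof -
    have "map (inv_into (nodes H) g) (map g b) = b"
      using that(2) bij_betw_imp_inj_on[OF g] by (auto intro!: map_idI)
    then show ?thesis using that(1) by (simp add: j_def)
  qed
  show ?thesis
    unfolding hg_iso_def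
  proof (rule exI[of _ j], rule exI[of _ h], intro conjI ballI j h(1))
    fix e assume e: "e \<in> edges G"
    then have "h e \<in> edges H" using h(1) bij_betwE by blast
    then show "att H (h e) = map j (att G e)"
      using map h(2)[OF e] rep_wf[OF H] by (auto simp: wf_graph_def)
    show "label_iso (lab G e) (lab H (h e))" using h(2)[OF e] by (simp add: label_iso_refl)
  next
    show "ext H = map j (ext G)"
      using map[of "ext H" "ext G"] G H rep_wf[OF H] by (auto simp: rep_def wf_graph_def)
  qed
qed

lemma der_hl:
  assumes "der rk M xs L" "rep rk G f M xs"
  shows "hl no_isolated rk G L"
proof -
  obtain H g where H: "rep rk H g M xs" "hl no_isolated rk H L"
    using assms(1) by (auto simp: der_def)
  show ?thesis
    using H(2) rep_iso[OF H(1) assms(2)] label_iso_refl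
    by (rule hl.Iso) (rule rep_hl_sequent[OF assms(2) der_typed(1,2)[OF assms(1)]])
qed

lemma derI: "rep rk G f M xs \<Longrightarrow> hl no_isolated rk G L \<Longrightarrow> der rk M xs L"
  by (auto simp: der_def)

text \<open>The new naming is \<open>f\<close> on old nodes and \<open>h\<close> on copied ones;
  they agree on fused nodes by the hypothesis on \<open>ext H\<close>. Injectivity of
  \<open>h\<close> is asked only on internal nodes, so that \<open>e\<close> may be a loop.\<close>

lemma rep_replace:
  assumes G: "rep rk G f M xs" "e \<in> edges G"
    and H: "hypergraph rk H" "no_isolated H" "map h (ext H) = map f (att G e)"
      "inj_on h (internal H)" "h ` internal H \<inter> names M = {}"
  obtains k where
    "rep rk (replace G e H) k (edge_mset (lab G) f (delete_edge G e) + edge_mset (lab H) h H) xs"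
    "\<And>x. x \<in> edges G \<Longrightarrow> map k (att (replace G e H) x) = map f (att G x)"
    "\<And>x. x \<in> edges H \<Longrightarrow> map k (att (replace G e H) (edge_copy G x)) = map h (att H x)"
proof -
  have wf: "wf_graph G" "wf_graph H" using rep_wf[OF G(1)] hypergraph_wf[OF H(1)] by auto
  then have fin: "finite (nodes G)" "finite (edges G)" "finite (edges H)" by (auto simp: wf_graph_def)
  have len: "length (att G e) = length (ext H)" using H(3) by (metis length_map)
  define k where "k v = (if v < fresh (nodes G) then f v else h (v - fresh (nodes G)))" for v
  have kG: "k v = f v" if "v \<in> nodes G" for v
    using less_fresh[OF fin(1) that] by (simp add: k_def)
  have kH: "k (node_copy G e H v) = h v" for v
  proof (cases "v \<in> set (ext H)")
    case True
    then obtain i where i: "i < length (ext H)" "v = ext H ! i" by (metis in_set_conv_nth)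
    have "set (att G e) \<subseteq> nodes G" using G(2) wf(1) by (auto simp: wf_graph_def)
    then have "att G e ! i \<in> nodes G"
      using i(1) len nth_mem[of i "att G e"] by auto
    moreover have "node_copy G e H v = att G e ! i"
      using arg_cong[OF node_copy_ext[where e = e and G = G, OF wf(2) len], of "\<lambda>l. l ! i"] i by simp
    moreover have "h v = f (att G e ! i)"
      using arg_cong[OF H(3), of "\<lambda>l. l ! i"] i len by simp
    ultimately show ?thesis using kG by simp
  next
    case False
    then show ?thesis using node_copy_internal[OF len] by (simp add: k_def)
  qed
  have attG: "map k (att G x) = map f (att G x)" if "x \<in> edges G" for x
    using that wf(1) kG by (auto simp: wf_graph_def)
  show ?thesis
  proof (rule that)
    show "map k (att (replace G e H) x) = map f (att G x)" if "x \<in> edges G" for x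
      using attG[OF that] replace_old(1)[OF fin(2) that] by simp
    show "map k (att (replace G e H) (edge_copy G x)) = map h (att H x)" for x
      by (simp add: replace_new kH)
    show "rep rk (replace G e H) k (edge_mset (lab G) f (delete_edge G e) + edge_mset (lab H) h H) xs"
      unfolding rep_def
    proof (intro conjI)
      show "hypergraph rk (replace G e H)"
        using G H(1) len by (intro hypergraph_replace) (auto simp: rep_def)
      show "no_isolated (replace G e H)"
        using G H(2) wf len by (intro no_isolated_replace) (auto simp: rep_def)
      have "set (ext G) \<subseteq> nodes G" using wf(1) by (simp add: wf_graph_def)
      then have "map k (ext G) = map f (ext G)" using kG by auto
      then show "map k (ext (replace G e H)) = xs"
        using G(1) unfolding rep_def replace_simps by metis
      have N: "nodes (replace G e H) = nodes G \<union> node_copy G e H ` internal H"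
        using node_copy_ext_in(2)[OF wf G(2) len] by auto
      show "inj_on k (nodes (replace G e H))"
        unfolding N
      proof (subst inj_on_Un, intro conjI)
        show "inj_on k (nodes G)"
          using G(1) by (subst inj_on_cong[of _ k f]) (auto simp: kG rep_def)
        show "inj_on k (node_copy G e H ` internal H)"
          using H(4) by (auto simp: inj_on_def kH)
        show "k ` (nodes G - node_copy G e H ` internal H) \<inter>
            k ` (node_copy G e H ` internal H - nodes G) = {}"
          using H(5) rep_names[OF G(1)] by (force simp: kG kH)
      qed
      have "edge_mset (lab (replace G e H)) k (delete_edge G e) = edge_mset (lab G) f (delete_edge G e)"
        using fin attG by (intro edge_mset_cong) (auto simp: replace_old)
      moreover have "edge_mset (lab (replace G e H) \<circ> edge_copy G) (k \<circ> node_copy G e H) H =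
          edge_mset (lab H) h H"
        by (intro edge_mset_cong) (auto simp: replace_new kH)
      ultimately show "edge_mset (lab (replace G e H)) k (replace G e H) =
          edge_mset (lab G) f (delete_edge G e) + edge_mset (lab H) h H"
        by (simp add: edge_mset_replace[OF fin(2,3)])
    qed
  qed
qed

section \<open>Division and product rules for named graphs\<close>

lemma hypergraph_bullet: "hypergraph rk (bullet rk l)" "no_isolated (bullet rk l)"
  by (auto simp: hypergraph_def bullet_def no_isolated_def)

lemma edge_mset_bullet: "edge_mset \<alpha> f (bullet rk l) = {#(\<alpha> 0, map f (ext (bullet rk l)))#}"
  by (simp add: edge_mset_def bullet_def)

lemma map_nth_bullet: "length a = rank rk l \<Longrightarrow> map (\<lambda>i. a ! i) (ext (bullet rk l)) = a"
  by (auto simp: bullet_def intro: nth_equalityI)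

lemma lab_bullet: "lab (bullet rk l) d = l" "nodes (bullet rk l) - set (ext (bullet rk l)) = {}"
  by (auto simp: bullet_def)

lemma rep_delete:
  assumes "rep rk G f (add_mset (l, a) M) xs" "e \<in> edges G" "lab G e = l" "map f (att G e) = a"
  shows "edge_mset (lab G) f (delete_edge G e) = M"
proof -
  have "finite (edges G)" using rep_wf[OF assms(1)] by (simp add: wf_graph_def)
  from edge_mset_delete[OF this assms(2), of "lab G" f] show ?thesis
    using assms by (simp add: rep_def)
qed

lemma rep_divL:
  assumes div: "hl_type no_isolated rk (Div N D)"
    and s: "s \<in> edges D" "lab D s = Dollar n"
    and h: "inj_on h (internal D)"
      "h ` internal D \<inter> names (add_mset (N, map h (ext D)) M) = {}"
    and H: "rep rk H f (add_mset (N, map h (ext D)) M) xs"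
  obtains e K k where "e \<in> edges H" "lab H e = N"
    "K = replaces H [(e, D), (edge_copy H s, bullet rk (Div N D))]"
    "rep rk K k (add_mset (Div N D, map h (att D s)) M + edge_mset (lab D) h (delete_edge D s)) xs"
    "\<And>d. d \<in> edges D - {s} \<Longrightarrow> edge_copy H d \<in> edges K \<and> lab K (edge_copy H d) = lab D d \<and>
      map k (att K (edge_copy H d)) = map h (att D d)"
proof -
  note DD = hl_type_DivD[OF div]
  have finD: "finite (edges D)" using hypergraph_wf[OF DD(1)] by (simp add: wf_graph_def)
  have rank: "length (att D s) = rank rk (Div N D)" using rank_Div[OF div s] by simp
  obtain e where e: "e \<in> edges H" "lab H e = N" "map f (att H e) = map h (ext D)"
    "edge_mset (lab H) f (delete_edge H e) = M"
    by (rule rep_edgeE[OF H]) blast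
  define K1 where "K1 = replace H e D"
  define es where "es = edge_copy H s"
  let ?b = "bullet rk (Div N D)" and ?D = "edge_mset (lab D) h (delete_edge D s)"
  obtain k1 where k1: "rep rk K1 k1 (add_mset (Dollar n, map h (att D s)) (M + ?D)) xs"
    "\<And>x. x \<in> edges D \<Longrightarrow> map k1 (att K1 (edge_copy H x)) = map h (att D x)"
  proof (rule rep_replace[OF H e(1) DD(1,4) e(3)[symmetric] h])
    fix k assume "rep rk (replace H e D) k (edge_mset (lab H) f (delete_edge H e) + edge_mset (lab D) h D) xs"
      "\<And>x. x \<in> edges D \<Longrightarrow> map k (att (replace H e D) (edge_copy H x)) = map h (att D x)"
    then show ?thesis
      using that[of k] e(4) edge_mset_delete[OF finD s(1), of "lab D" h] s(2) by (simp add: K1_def)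
  qed
  have edge1: "edge_copy H d \<in> edges K1" "lab K1 (edge_copy H d) = lab D d" if "d \<in> edges D" for d
    using that by (auto simp: K1_def replace_new)
  have es: "es \<in> edges K1" "lab K1 es = Dollar n" and att1: "map k1 (att K1 es) = map h (att D s)"
    using edge1[OF s(1)] s k1(2) by (auto simp: es_def)
  have fin1: "finite (edges K1)" using rep_wf[OF k1(1)] by (simp add: wf_graph_def)
  have del1: "edge_mset (lab K1) k1 (delete_edge K1 es) = M + ?D"
    by (rule rep_delete[OF k1(1) es att1])
  \<comment> \<open>The nodes of a \<open>bullet\<close> are positions; each receives the name that
    \<open>att D s\<close> has at that position.\<close>
  define h2 where "h2 i = map h (att D s) ! i" for i
  have h2: "map h2 (ext ?b) = map h (att D s)"
    unfolding h2_def by (rule map_nth_bullet) (use rank in simp)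
  show ?thesis
  proof (rule rep_replace[OF k1(1) es(1) hypergraph_bullet[of rk "Div N D"], where h = h2])
    fix k assume k: "rep rk (replace K1 es ?b) k
        (edge_mset (lab K1) k1 (delete_edge K1 es) + edge_mset (lab ?b) h2 ?b) xs"
      "\<And>x. x \<in> edges K1 \<Longrightarrow> map k (att (replace K1 es ?b) x) = map k1 (att K1 x)"
    have "edge_copy H d \<in> edges (replace K1 es ?b) \<and> lab (replace K1 es ?b) (edge_copy H d) = lab D d \<and>
        map k (att (replace K1 es ?b) (edge_copy H d)) = map h (att D d)" if "d \<in> edges D - {s}" for d
    proof -
      have "edge_copy H d \<noteq> es" using that inj_edge_copy[of H] by (auto simp: es_def dest: injD)
      then show ?thesis
        using that edge1[of d] k(2)[of "edge_copy H d"] k1(2)[of d] fin1 by (simp add: replace_old)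
    qed
    moreover have "replace K1 es ?b = replaces H [(e, D), (edge_copy H s, ?b)]"
      by (simp add: K1_def es_def)
    moreover have "rep rk (replace K1 es ?b) k (add_mset (Div N D, map h (att D s)) M + ?D) xs"
      using k(1) by (simp add: del1 edge_mset_bullet lab_bullet(1) h2)
    ultimately show ?thesis using that[OF e(1,2)] by blast
  qed (use h2 att1(1) in \<open>simp_all add: lab_bullet(2)\<close>)
qed

text \<open>The denominators of both Lambek divisions have this shape, the \<open>Dollar\<close>
  edge with one further edge; \<open>der_divL_singleton\<close> covers the bracelet.\<close>

lemma der_divL_pair:
  assumes div: "hl_type no_isolated rk (Div N D)"
    and D: "edges D = {s, d}" "s \<noteq> d" "lab D s = Dollar n"
    and h: "inj_on h (internal D)"
      "h ` internal D \<inter> names (add_mset (N, map h (ext D)) M) = {}"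
    and H: "der rk (add_mset (N, map h (ext D)) M) xs L"
    and P: "der rk P (map h (att D d)) (lab D d)"
      "(names P - set (map h (att D d))) \<inter> (names M \<union> h ` nodes D) = {}"
  shows "der rk (add_mset (Div N D, map h (att D s)) (M + P)) xs L"
proof -
  have "wf_graph D" using hypergraph_wf[OF hl_type_DivD(1)[OF div]] .
  then have attD: "set (att D s) \<subseteq> nodes D" "set (att D d) \<subseteq> nodes D"
    using D(1) by (auto simp: wf_graph_def)
  have s: "s \<in> edges D" and del: "edges (delete_edge D s) = {d}" using D by auto
  obtain H f where H': "rep rk H f (add_mset (N, map h (ext D)) M) xs" "hl no_isolated rk H L"
    using H by (auto simp: der_def)
  let ?M = "add_mset (Div N D, map h (att D s)) M"
  obtain e K2 k2 where e: "e \<in> edges H" "lab H e = N"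
    and K2: "K2 = replaces H [(e, D), (edge_copy H s, bullet rk (Div N D))]"
      "rep rk K2 k2 (add_mset (lab D d, map h (att D d)) ?M) xs"
      "edge_copy H d \<in> edges K2" "lab K2 (edge_copy H d) = lab D d"
      "map k2 (att K2 (edge_copy H d)) = map h (att D d)"
    by (rule rep_divL[OF div s D(3) h H'(1)]) (use D in \<open>simp add: edge_mset_singleton[OF del]\<close>)
  obtain F g where F: "rep rk F g P (map h (att D d))" "hl no_isolated rk F (lab D d)"
    using P(1) by (auto simp: der_def)
  have F': "hypergraph rk F" "no_isolated F" "map g (ext F) = map h (att D d)"
    using F(1) by (auto simp: rep_def)
  define K where "K = replace K2 (edge_copy H d) F"
  obtain k where K: "rep rk K k (?M + P) xs"
  proof (rule rep_replace[OF K2(2,3) F'(1,2), where h = g])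
    fix k assume "rep rk (replace K2 (edge_copy H d) F) k
        (edge_mset (lab K2) k2 (delete_edge K2 (edge_copy H d)) + edge_mset (lab F) g F) xs"
    then show ?thesis
      using that[of k] F(1) rep_delete[OF K2(2-5)] by (simp add: K_def rep_def)
  next
    show "inj_on g (internal F)" by (rule rep_internal(1)[OF F(1)])
    show "g ` internal F \<inter> names (add_mset (lab D d, map h (att D d)) ?M) = {}"
      unfolding rep_internal(2)[OF F(1)] using P(2) attD by auto
  qed (use F'(3) K2(5) in simp)
  have "hl no_isolated rk K L"
  proof (rule hl.DivL[where ds = "[d]" and F = "\<lambda>_. F", OF div s D(3) _ _ e H'(2)])
    show "K = replaces H ([(e, D), (edge_copy H s, bullet rk (Div N D))] @ map (\<lambda>d. (edge_copy H d, F)) [d])"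
      by (simp add: K_def K2(1))
    show "hl_sequent no_isolated rk K L"
      by (rule rep_hl_sequent[OF K])
        (use rank_Div[OF div s D(3)] div der_typed(1,2)[OF H] der_typed(1)[OF P(1)] in auto)
    show "\<forall>d\<in>set [d]. hl no_isolated rk F (lab D d) \<and> length (att D d) = length (ext F)"
      using F(2) arg_cong[OF F'(3), of length] by simp
  qed (use D in auto)
  with K have "der rk (?M + P) xs L" by (rule derI)
  then show ?thesis by simp
qed

lemma der_divL_singleton:
  assumes div: "hl_type no_isolated rk (Div N D)"
    and D: "edges D = {s}" "lab D s = Dollar n"
    and h: "inj_on h (internal D)"
      "h ` internal D \<inter> names (add_mset (N, map h (ext D)) M) = {}"
    and H: "der rk (add_mset (N, map h (ext D)) M) xs L"
  shows "der rk (add_mset (Div N D, map h (att D s)) M) xs L"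
proof -
  have s: "s \<in> edges D" and del: "edges (delete_edge D s) = {}" using D by auto
  obtain H f where H': "rep rk H f (add_mset (N, map h (ext D)) M) xs" "hl no_isolated rk H L"
    using H by (auto simp: der_def)
  obtain e K k where e: "e \<in> edges H" "lab H e = N"
    and K: "K = replaces H [(e, D), (edge_copy H s, bullet rk (Div N D))]"
      "rep rk K k (add_mset (Div N D, map h (att D s)) M) xs"
    by (rule rep_divL[OF div s D(2) h H'(1)]) (simp add: edge_mset_empty[OF del])
  have "hl no_isolated rk K L"
  proof (rule hl.DivL[where ds = "[]", OF div s D(2) _ _ e H'(2)])
    show "hl_sequent no_isolated rk K L"
      by (rule rep_hl_sequent[OF K(2)])
        (use rank_Div[OF div s D(2)] div der_typed(1,2)[OF H] in auto)
  qed (use D K(1) in auto)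
  with K(2) show ?thesis by (rule derI)
qed

text \<open>Here \<open>\<sigma>\<close> renames \<open>P\<close> as it appears inside
  \<open>D\<close>. It is injective only away from the ends \<open>ys\<close>, because for a
  bracelet both ends go to the one node of the loop.\<close>

lemma der_divR:
  assumes div: "hl_type no_isolated rk (Div N D)" and s: "s \<in> edges D" "lab D s = Dollar n"
    and h: "inj_on h (nodes D)"
    and P: "typed rk P" "distinct ys" "set ys \<subseteq> names P"
    and \<sigma>: "map \<sigma> ys = map h (att D s)" "inj_on \<sigma> (names P - set ys)"
      "\<sigma> ` (names P - set ys) \<inter> h ` nodes D = {}"
    and N: "der rk (edge_mset (lab D) h (delete_edge D s) + rename \<sigma> P) (map h (ext D)) N"
  shows "der rk P ys (Div N D)"
proof -
  note DD = hl_type_DivD[OF div]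
  obtain F where F: "rep rk F id P ys" by (rule rep_exists[OF P])
  have F': "hypergraph rk F" "no_isolated F" "ext F = ys" "edge_mset (lab F) id F = P"
    using F by (auto simp: rep_def)
  have D: "rep rk D h (edge_mset (lab D) h D) (map h (ext D))"
    using DD h by (simp add: rep_def)
  have int: "internal F = names P - set ys"
    using rep_internal(2)[OF F] by simp
  obtain k where "rep rk (replace D s F) k
      (edge_mset (lab D) h (delete_edge D s) + edge_mset (lab F) \<sigma> F) (map h (ext D))"
  proof (rule rep_replace[OF D s(1) F'(1,2), where h = \<sigma>])
    show "map \<sigma> (ext F) = map h (att D s)" using F'(3) \<sigma>(1) by simp
    show "inj_on \<sigma> (internal F)" unfolding int by (rule \<sigma>(2))
    show "\<sigma> ` internal F \<inter> names (edge_mset (lab D) h D) = {}"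
      unfolding int rep_names[OF D] by (rule \<sigma>(3))
  qed
  moreover have "edge_mset (lab F) \<sigma> F = rename \<sigma> P"
    using F'(4) rename_edge_mset[of \<sigma> "lab F" id F] by simp
  ultimately have "hl no_isolated rk (replace D s F) N"
    using der_hl[OF N] by simp
  moreover have "length (att D s) = length (ext F)"
    using arg_cong[OF \<sigma>(1), of length] F'(3) by simp
  moreover have "hl_sequent no_isolated rk F (Div N D)"
    by (rule rep_hl_sequent[OF F P(1) div])
  ultimately have "hl no_isolated rk F (Div N D)"
    using div s by (intro hl.DivR)
  with F show ?thesis by (rule derI)
qed

lemma der_timesL:
  assumes F: "hl_type no_isolated rk (Times F)"
    and h: "inj_on h (internal F)"
      "h ` internal F \<inter> (names (add_mset (Times F, map h (ext F)) M) \<union> set xs) = {}"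
    and L: "der rk (M + edge_mset (lab F) h F) xs L"
  shows "der rk (add_mset (Times F, map h (ext F)) M) xs L"
proof -
  let ?M = "add_mset (Times F, map h (ext F)) M"
  have hypF: "hypergraph rk F" "no_isolated F" using F by (auto elim: hl_type_TimesE)
  have "names (edge_mset (lab F) h F) = h ` nodes F"
    using names_edge_mset_nodes hypergraph_wf hypF by blast
  \<comment> \<open>For \<open>add_mset (Times F, map h (ext F)) M\<close> to be representable, its
    ends must lie on edges. They are not internal to \<open>F\<close>, so they lie on
    \<open>M\<close> or at the ends of the new edge.\<close>
  then have "set xs \<subseteq> names M \<union> h ` nodes F" using der_typed(4)[OF L] by simp
  moreover have "h ` nodes F \<subseteq> h ` set (ext F) \<union> h ` internal F" by auto
  moreover have "h ` internal F \<inter> set xs = {}" using h(2) by blast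
  ultimately have "set xs \<subseteq> names M \<union> h ` set (ext F)" by blast
  then have "set xs \<subseteq> names ?M" by auto
  moreover have "typed rk ?M" using F der_typed(1)[OF L] by simp
  ultimately obtain G where G: "rep rk G id ?M xs"
    using rep_exists der_typed(3)[OF L] by metis
  obtain e where e: "e \<in> edges G" "lab G e = Times F" "map id (att G e) = map h (ext F)"
    "edge_mset (lab G) id (delete_edge G e) = M"
    by (rule rep_edgeE[OF G]) blast
  obtain k where "rep rk (replace G e F) k (M + edge_mset (lab F) h F) xs"
    by (rule rep_replace[OF G e(1) hypF e(3)[symmetric] h(1)]) (use h(2) e(4) in auto)
  then have "hl no_isolated rk (replace G e F) L" by (rule der_hl[OF L])
  then have "hl no_isolated rk G L"
    by (rule hl.TimesL[OF e(1,2) _ rep_hl_sequent[OF G \<open>typed rk ?M\<close> der_typed(2)[OF L]]])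
  with G show ?thesis by (rule derI)
qed

lemma der_timesR_singleton:
  assumes M: "hl_type no_isolated rk (Times M)" "edges M = {m}" "inj_on h (nodes M)"
    and P: "der rk P ys (lab M m)"
    and \<sigma>: "map \<sigma> ys = map h (att M m)" "inj_on \<sigma> (names P - set ys)"
      "\<sigma> ` (names P - set ys) \<inter> h ` nodes M = {}"
  shows "der rk (rename \<sigma> P) (map h (ext M)) (Times M)"
proof -
  have hyp: "hypergraph rk M" "no_isolated M" using M by (auto elim: hl_type_TimesE)
  then have rep: "rep rk M h (edge_mset (lab M) h M) (map h (ext M))"
    using M(3) by (simp add: rep_def)
  obtain F f where F: "rep rk F f P ys" "hl no_isolated rk F (lab M m)"
    using P by (auto simp: der_def)
  have F': "hypergraph rk F" "no_isolated F" "map f (ext F) = ys" "edge_mset (lab F) f F = P"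
    using F(1) by (auto simp: rep_def)
  have m: "m \<in> edges M" using M by simp
  have map: "map (\<sigma> \<circ> f) (ext F) = map h (att M m)" using F'(3) \<sigma>(1) by (metis map_map)
  obtain k where k: "rep rk (replace M m F) k (rename \<sigma> P) (map h (ext M))"
  proof (rule rep_replace[OF rep m F'(1,2) map])
    show "inj_on (\<sigma> \<circ> f) (internal F)"
      using rep_internal[OF F(1)] \<sigma>(2) by (auto intro: comp_inj_on)
    show "(\<sigma> \<circ> f) ` internal F \<inter> names (edge_mset (lab M) h M) = {}"
      unfolding image_comp[symmetric] rep_internal(2)[OF F(1)] rep_names[OF rep] by (rule \<sigma>(3))
    fix k assume "rep rk (replace M m F) k
        (edge_mset (lab M) h (delete_edge M m) + edge_mset (lab F) (\<sigma> \<circ> f) F) (map h (ext M))"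
    moreover have "edges (delete_edge M m) = {}" using M(2) by simp
    moreover have "edge_mset (lab F) (\<sigma> \<circ> f) F = rename \<sigma> P"
      using F'(4) rename_edge_mset by metis
    ultimately show ?thesis using that[of k] by (simp add: edge_mset_empty)
  qed
  have "typed rk (rename \<sigma> P)"
    using der_typed(1)[OF P] by (auto simp: typed_def rename_def)
  then have "hl_sequent no_isolated rk (replace M m F) (Times M)"
    by (rule rep_hl_sequent[OF k _ M(1)])
  then have "hl no_isolated rk (replace M m F) (Times M)"
    using F(2) M(2) arg_cong[OF map, of length]
    by (intro hl.TimesR[where ms = "[m]" and F = "\<lambda>_. F"]) auto
  with k show ?thesis by (rule derI)
qed

text \<open>The freshness conditions are asymmetric because \<open>Q\<close> is inserted second and
  has to avoid the names of \<open>P\<close> as well.\<close>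

lemma der_timesR_pair:
  assumes M: "hl_type no_isolated rk (Times M)" "edges M = {a, b}" "a \<noteq> b" "inj_on h (nodes M)"
    and P: "der rk P (map h (att M a)) (lab M a)"
      "(names P - set (map h (att M a))) \<inter> h ` nodes M = {}"
    and Q: "der rk Q (map h (att M b)) (lab M b)"
      "(names Q - set (map h (att M b))) \<inter> (h ` nodes M \<union> names P) = {}"
  shows "der rk (P + Q) (map h (ext M)) (Times M)"
proof -
  have hyp: "hypergraph rk M" "no_isolated M" using M by (auto elim: hl_type_TimesE)
  then have rep: "rep rk M h (edge_mset (lab M) h M) (map h (ext M))"
    using M(4) by (simp add: rep_def)
  have fin: "finite (edges M)" using M(2) by simp
  obtain F f where F: "rep rk F f P (map h (att M a))" "hl no_isolated rk F (lab M a)"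
    using P(1) by (auto simp: der_def)
  have F': "hypergraph rk F" "no_isolated F" "map f (ext F) = map h (att M a)" "edge_mset (lab F) f F = P"
    using F(1) by (auto simp: rep_def)
  obtain G g where G: "rep rk G g Q (map h (att M b))" "hl no_isolated rk G (lab M b)"
    using Q(1) by (auto simp: der_def)
  have G': "hypergraph rk G" "no_isolated G" "map g (ext G) = map h (att M b)" "edge_mset (lab G) g G = Q"
    using G(1) by (auto simp: rep_def)
  have ab: "a \<in> edges M" "b \<in> edges M" using M by auto
  have del: "edges (delete_edge M a) = {b}" using M(2,3) by auto
  define K1 where "K1 = replace M a F"
  obtain k where k: "rep rk K1 k (add_mset (lab M b, map h (att M b)) P) (map h (ext M))"
    "map k (att K1 b) = map h (att M b)"
  proof (rule rep_replace[OF rep ab(1) F'(1-3) rep_internal(1)[OF F(1)]])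
    show "f ` internal F \<inter> names (edge_mset (lab M) h M) = {}"
      using P(2) by (simp add: rep_internal(2)[OF F(1)] rep_names[OF rep])
    fix k assume "rep rk (replace M a F) k
        (edge_mset (lab M) h (delete_edge M a) + edge_mset (lab F) f F) (map h (ext M))"
      "\<And>x. x \<in> edges M \<Longrightarrow> map k (att (replace M a F) x) = map h (att M x)"
    then show ?thesis
      using that[of k] ab F'(4) by (simp add: K1_def edge_mset_singleton[OF del])
  qed
  have b1: "b \<in> edges K1" "lab K1 b = lab M b"
    using ab M(3) fin by (auto simp: K1_def replace_old)
  have attM: "set (att M b) \<subseteq> nodes M" using hypergraph_wf[OF hyp(1)] ab by (auto simp: wf_graph_def)
  obtain k' where k': "rep rk (replace K1 b G) k' (P + Q) (map h (ext M))"
  proof (rule rep_replace[OF k(1) b1(1) G'(1,2) _ rep_internal(1)[OF G(1)]])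
    show "map g (ext G) = map k (att K1 b)" using G'(3) k(2) by simp
    show "g ` internal G \<inter> names (add_mset (lab M b, map h (att M b)) P) = {}"
      using Q(2) attM by (auto simp: rep_internal(2)[OF G(1)])
    fix k' assume "rep rk (replace K1 b G) k'
        (edge_mset (lab K1) k (delete_edge K1 b) + edge_mset (lab G) g G) (map h (ext M))"
    then show ?thesis
      using that[of k'] rep_delete[OF k(1) b1 k(2)] G'(4) by simp
  qed
  have "typed rk (P + Q)"
    using der_typed(1)[OF P(1)] der_typed(1)[OF Q(1)] by simp
  then have "hl_sequent no_isolated rk (replace K1 b G) (Times M)"
    by (rule rep_hl_sequent[OF k' _ M(1)])
  then have "hl no_isolated rk (replace K1 b G) (Times M)"
    using F(2) G(2) M(2,3) arg_cong[OF F'(3), of length] arg_cong[OF G'(3), of length]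
    by (intro hl.TimesR[where ms = "[a, b]" and F = "\<lambda>x. if x = a then F else G"])
      (auto simp: K1_def)
  with k' show ?thesis by (rule derI)
qed

lemma string_graph2_simps [simp]:
  "nodes (string_graph [a, b]) = {0, 1, 2}" "edges (string_graph [a, b]) = {0, 1}"
  "att (string_graph [a, b]) i = [i, Suc i]" "lab (string_graph [a, b]) i = [a, b] ! i"
  "ext (string_graph [a, b]) = [0, 2]"
  by (auto simp: string_graph_def numeral_2_eq_2)

lemma loop_simps [simp]:
  "nodes (loop a) = {0}" "edges (loop a) = {0}" "att (loop a) i = [0, 0]" "lab (loop a) i = a"
  "ext (loop a) = []"
  by (auto simp: loop_def)

lemma reversal_simps [simp]:
  "nodes (reversal a) = {0, 1}" "edges (reversal a) = {0}" "att (reversal a) i = [0, 1]"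
  "lab (reversal a) i = a" "ext (reversal a) = [1, 0]"
  by (auto simp: reversal_def)

lemma hypergraph_string_graph2:
  assumes "rank rk a = 2" "rank rk b = 2"
  shows "hypergraph rk (string_graph [a, b])" "no_isolated (string_graph [a, b])"
  using assms by (auto simp: hypergraph_def no_isolated_def numeral_2_eq_2)

lemma hypergraph_loop:
  assumes "rank rk a = 2"
  shows "hypergraph rk (loop a)" "no_isolated (loop a)"
  using assms by (auto simp: hypergraph_def no_isolated_def)

lemma hypergraph_reversal:
  assumes "rank rk a = 2"
  shows "hypergraph rk (reversal a)" "no_isolated (reversal a)"
  using assms by (auto simp: hypergraph_def no_isolated_def)

section \<open>The rules for translated types\<close>

locale translation =
  fixes rk :: "'p \<Rightarrow> nat" and \<iota> :: "'q \<Rightarrow> 'p"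
  assumes rank_prim: "rk (\<iota> q) = 2"
begin

abbreviation "named_walk x ws \<equiv> mset (walk (tr \<iota>) x ws)"

abbreviation "wi_type \<equiv> hl_type no_isolated rk"

lemma hl_type_Times_loop: "wi_type a \<Longrightarrow> rank rk a = 2 \<Longrightarrow> wi_type (Times (loop a))"
  by (rule hl_type.intros(3)) (auto simp: hypergraph_loop)

lemma hl_type_tr: "wi_type (tr \<iota> A)" and rank_tr [simp]: "rank rk (tr \<iota> A) = 2"
proof -
  have "wi_type (tr \<iota> A) \<and> rank rk (tr \<iota> A) = 2"
  proof (induction A)
    case (LPrim q)
    show ?case using rank_prim by (auto intro: hl_type.intros)
  next
    case (Under A B)
    have "wi_type (tr \<iota> (Under A B))"
      unfolding tr.simps
      by (rule hl_type.intros(2)[where s = 1 and d = 2])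
        (use Under hypergraph_string_graph2[of rk "tr \<iota> A" "Dollar 2"] in auto)
    then show ?case using rank_Div[of no_isolated rk _ _ 1 2] by simp
  next
    case (Over B A)
    have "wi_type (tr \<iota> (Over B A))"
      unfolding tr.simps
      by (rule hl_type.intros(2)[where s = 0 and d = 2])
        (use Over hypergraph_string_graph2[of rk "Dollar 2" "tr \<iota> A"] in auto)
    then show ?case using rank_Div[of no_isolated rk _ _ 0 2] by simp
  next
    case (Prod A B)
    then have "wi_type (tr \<iota> (Prod A B))"
      unfolding tr.simps using hypergraph_string_graph2[of rk "tr \<iota> A" "tr \<iota> B"]
      by (intro hl_type.intros(3)) auto
    then show ?case by simp
  next
    case (Rev A)
    then have "wi_type (tr \<iota> (Rev A))"
      unfolding tr.simps using hypergraph_reversal[of rk "tr \<iota> A"]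
      by (intro hl_type.intros(3)) auto
    then show ?case by simp
  next
    case (Brace A)
    have "wi_type (tr \<iota> (Brace A))"
      unfolding tr.simps bracelet_def
      by (rule hl_type.intros(2)[where s = 0 and d = 2])
        (use Brace hl_type_Times_loop[of "tr \<iota> A"] hypergraph_loop[of rk "Dollar 2"] in auto)
    then show ?case using rank_Div[of no_isolated rk _ _ 0 2] by (simp add: bracelet_def)
  qed
  then show "wi_type (tr \<iota> A)" "rank rk (tr \<iota> A) = 2" by auto
qed

lemma der_Ax: "x \<noteq> y \<Longrightarrow> der rk {#(tr \<iota> (LPrim q), [x, y])#} [x, y] (tr \<iota> (LPrim q))"
proof (rule derI)
  let ?b = "bullet rk (Prim (\<iota> q))"
  have b: "nodes ?b = {0, 1}" "ext ?b = [0, 1]"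
    using rank_prim by (auto simp: bullet_def upt_rec numeral_2_eq_2)
  assume "x \<noteq> y"
  then show rep: "rep rk ?b (\<lambda>i. [x, y] ! i) {#(tr \<iota> (LPrim q), [x, y])#} [x, y]"
    using hypergraph_bullet[of rk "Prim (\<iota> q)"] b
    by (auto simp: rep_def edge_mset_bullet lab_bullet(1) inj_on_def)
  show "hl no_isolated rk ?b (tr \<iota> (LPrim q))"
    unfolding tr.simps
    by (rule hl.Ax, rule rep_hl_sequent[OF rep]) (use hl_type_tr[of "LPrim q"] rank_prim in auto)
qed

lemma inner_node: "{Suc 0, 2} - {2} = {Suc 0}"
  by auto

text \<open>The function \<open>\<lambda>i. [u, m, v] ! i\<close> names the three nodes of the
  string graph. The indices \<open>1\<close> and \<open>0\<close> select the \<open>Dollar\<close>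
  edge and the \<open>A\<close>-edge; for \<open>der_OverL\<close> they are swapped.\<close>

lemma der_UnderL:
  assumes "der rk (add_mset (tr \<iota> B, [u, v]) M) xs L" "der rk P [u, m] (tr \<iota> A)"
    and "m \<notin> names M \<union> {u, v}" "(names P - {u, m}) \<inter> (names M \<union> {u, v}) = {}"
  shows "der rk (add_mset (tr \<iota> (Under A B), [m, v]) (M + P)) xs L"
  using der_divL_pair[of rk "tr \<iota> B" "string_graph [tr \<iota> A, Dollar 2]" 1 0 2 "\<lambda>i. [u, m, v] ! i" M xs L P]
    hl_type_tr[of "Under A B"] assms by (auto simp: inner_node insert_commute)

lemma der_OverL:
  assumes "der rk (add_mset (tr \<iota> B, [u, v]) M) xs L" "der rk P [m, v] (tr \<iota> A)"
    and "m \<notin> names M \<union> {u, v}" "(names P - {m, v}) \<inter> (names M \<union> {u, v}) = {}"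
  shows "der rk (add_mset (tr \<iota> (Over B A), [u, m]) (M + P)) xs L"
  using der_divL_pair[of rk "tr \<iota> B" "string_graph [Dollar 2, tr \<iota> A]" 0 1 2 "\<lambda>i. [u, m, v] ! i" M xs L P]
    hl_type_tr[of "Over B A"] assms by (auto simp: inner_node)

text \<open>The hyperedge of rank 0 is the whole antecedent of the premise, so there is no name with
  which the new node \<open>z\<close> could clash.\<close>

lemma der_BraceL:
  assumes "der rk {#(Times (loop (tr \<iota> A)), [])#} xs L"
  shows "der rk {#(tr \<iota> (Brace A), [z, z])#} xs L"
  using der_divL_singleton[of rk "Times (loop (tr \<iota> A))" "loop (Dollar 2)" 0 2 "\<lambda>_. z" "{#}" xs L]
    hl_type_tr[of "Brace A"] assms by (auto simp: bracelet_def)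

lemma der_UnderR:
  assumes "der rk (add_mset (tr \<iota> A, [z, x]) P) [z, y] (tr \<iota> B)"
    and "z \<notin> names P" "x \<noteq> y" "x \<in> names P" "y \<in> names P"
  shows "der rk P [x, y] (tr \<iota> (Under A B))"
proof -
  have del: "edges (delete_edge (string_graph [tr \<iota> A, Dollar 2]) (Suc 0)) = {0}" by auto
  show ?thesis
    using der_divR[of rk "tr \<iota> B" "string_graph [tr \<iota> A, Dollar 2]" 1 2 "\<lambda>i. [z, x, y] ! i" P "[x, y]" id]
      hl_type_tr[of "Under A B"] assms der_typed(1)[OF assms(1)]
    by (auto simp: edge_mset_singleton[OF del] rename_ident)
qed

lemma der_OverR:
  assumes "der rk (add_mset (tr \<iota> A, [y, z]) P) [x, z] (tr \<iota> B)"
    and "z \<notin> names P" "x \<noteq> y" "x \<in> names P" "y \<in> names P"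
  shows "der rk P [x, y] (tr \<iota> (Over B A))"
proof -
  have del: "edges (delete_edge (string_graph [Dollar 2, tr \<iota> A]) 0) = {Suc 0}" by auto
  show ?thesis
    using der_divR[of rk "tr \<iota> B" "string_graph [Dollar 2, tr \<iota> A]" 0 2 "\<lambda>i. [x, y, z] ! i" P "[x, y]" id]
      hl_type_tr[of "Over B A"] assms der_typed(1)[OF assms(1)]
    by (auto simp: edge_mset_singleton[OF del] rename_ident)
qed

text \<open>Read upwards, the ends \<open>x\<close> and \<open>y\<close> are fused into
  \<open>c\<close>, and nothing else is identified.\<close>

lemma der_BraceR:
  assumes "der rk (rename \<sigma> P) [] (Times (loop (tr \<iota> A)))" "typed rk P"
    and "x \<noteq> y" "x \<in> names P" "y \<in> names P"
    and "\<sigma> x = c" "\<sigma> y = c" "inj_on \<sigma> (names P - {x, y})" "c \<notin> \<sigma> ` (names P - {x, y})"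
  shows "der rk P [x, y] (tr \<iota> (Brace A))"
proof -
  have del: "edges (delete_edge (loop (Dollar 2)) 0) = {}" by auto
  show ?thesis
    using der_divR[of rk "Times (loop (tr \<iota> A))" "loop (Dollar 2)" 0 2 "\<lambda>_. c" P "[x, y]" \<sigma>]
      hl_type_tr[of "Brace A"] assms
    by (auto simp: edge_mset_empty[OF del] bracelet_def)
qed

lemma der_ProdL:
  assumes "der rk (add_mset (tr \<iota> A, [u, m]) (add_mset (tr \<iota> B, [m, v]) M)) xs L"
    and "m \<notin> names M \<union> {u, v} \<union> set xs"
  shows "der rk (add_mset (tr \<iota> (Prod A B), [u, v]) M) xs L"
  using der_timesL[of rk "string_graph [tr \<iota> A, tr \<iota> B]" "\<lambda>i. [u, m, v] ! i" M xs L]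
    hl_type_tr[of "Prod A B"] assms
  by (auto simp: edge_mset_pair[of "string_graph [tr \<iota> A, tr \<iota> B]" 0 1] inner_node)

lemma der_RevL:
  assumes "der rk (add_mset (tr \<iota> A, [v, u]) M) xs L"
  shows "der rk (add_mset (tr \<iota> (Rev A), [u, v]) M) xs L"
  using der_timesL[of rk "reversal (tr \<iota> A)" "\<lambda>i. [v, u] ! i" M xs L]
    hl_type_tr[of "Rev A"] assms
  by (auto simp: edge_mset_singleton[of "reversal (tr \<iota> A)" 0])

lemma der_loopL:
  assumes "der rk {#(tr \<iota> A, [z, z])#} [] L"
  shows "der rk {#(Times (loop (tr \<iota> A)), [])#} [] L"
  using der_timesL[of rk "loop (tr \<iota> A)" "\<lambda>_. z" "{#}" "[]" L]
    hl_type_Times_loop[OF hl_type_tr[of A]] assms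
  by (auto simp: edge_mset_singleton[of "loop (tr \<iota> A)" 0])

lemma der_ProdR:
  assumes "der rk P [x, m] (tr \<iota> A)" "der rk Q [m, y] (tr \<iota> B)" "x \<noteq> y"
    and "names P \<inter> names Q \<subseteq> {m}"
  shows "der rk (P + Q) [x, y] (tr \<iota> (Prod A B))"
proof -
  have "x \<noteq> m" "m \<noteq> y" "x \<in> names P" "y \<in> names Q"
    using der_typed(3,4)[OF assms(1)] der_typed(3,4)[OF assms(2)] by auto
  then have "x \<notin> names Q" "y \<notin> names P" using assms(4) by auto
  then show ?thesis
    using der_timesR_pair[of rk "string_graph [tr \<iota> A, tr \<iota> B]" 0 1 "\<lambda>i. [x, m, y] ! i" P Q]
      hl_type_tr[of "Prod A B"] assms \<open>x \<noteq> m\<close> \<open>m \<noteq> y\<close>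
    by (auto simp: inj_on_def)
qed

lemma der_RevR:
  assumes "der rk P [x, y] (tr \<iota> A)"
  shows "der rk P [y, x] (tr \<iota> (Rev A))"
  using der_timesR_singleton[of rk "reversal (tr \<iota> A)" 0 "\<lambda>i. [x, y] ! i" P "[x, y]" id]
    hl_type_tr[of "Rev A"] assms der_typed(3)[OF assms]
  by (auto simp: rename_ident)

lemma der_loopR:
  assumes "der rk P [x, y] (tr \<iota> A)"
    and "\<sigma> x = c" "\<sigma> y = c" "inj_on \<sigma> (names P - {x, y})" "c \<notin> \<sigma> ` (names P - {x, y})"
  shows "der rk (rename \<sigma> P) [] (Times (loop (tr \<iota> A)))"
  using der_timesR_singleton[of rk "loop (tr \<iota> A)" 0 "\<lambda>_. c" P "[x, y]" \<sigma>]
    hl_type_Times_loop[OF hl_type_tr[of A]] assms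
  by auto

end

section \<open>Semantic cut elimination\<close>

text \<open>One notion serves paths, with \<open>u \<noteq> v\<close>, and cycles, with
  \<open>u = v\<close>: distinctness and avoidance of \<open>N\<close> concern the inner nodes only.
  In the uses below \<open>N\<close> contains the ends.\<close>

definition fresh_walk :: "nat \<Rightarrow> ('a \<times> bool \<times> nat) list \<Rightarrow> nat \<Rightarrow> nat set \<Rightarrow> bool" where
  "fresh_walk u ws v N \<longleftrightarrow>
     ws \<noteq> [] \<and> final u ws = v \<and> distinct (inner ws) \<and> set (inner ws) \<inter> N = {}"

lemma inner_splice:
  "ws \<noteq> [] \<Longrightarrow> inner (ps @ ws @ qs) = stops ps @ inner ws @ butlast (final x ws # stops qs)"
  by (simp add: inner_def[of "ps @ ws @ qs"] stops_conv_inner[of ws x] butlast_append)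

lemma inner_append: "us \<noteq> [] \<Longrightarrow> vs \<noteq> [] \<Longrightarrow> inner (us @ vs) = inner us @ final u us # inner vs"
  by (simp add: inner_def butlast_append final_conv)

lemma inner_single [simp]: "inner [s] = []"
  by (simp add: inner_def stops_def)

lemma signs_eq_append:
  assumes "signs ws = v @ w"
  obtains vs' ws' where "ws = vs' @ ws'" "signs vs' = v" "signs ws' = w"
  using assms unfolding signs_def by (auto simp: map_eq_append_conv)

lemma signs_eq_single:
  assumes "signs ws = [(A, b)]"
  obtains y where "ws = [(A, b, y)]"
  using assms unfolding signs_def by auto

lemma fresh_walk_backward: "fresh_walk u ws v N \<Longrightarrow> fresh_walk v (backward u ws) u N"
  by (auto simp: fresh_walk_def inner_backward)

lemma names_fresh_walk:
  assumes "fresh_walk u ws v N"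
  shows "names (mset (walk t u ws)) = {u, v} \<union> set (inner ws)"
  using assms stops_conv_inner[of ws u] by (auto simp: fresh_walk_def names_walk)

lemma flip_concat: "flip (concat vs) = concat (rev (map flip vs))"
  by (induction vs) auto

section \<open>Contexts, closed sets and the interpretation of types\<close>

context translation
begin

text \<open>A context is a named graph with a gap to be filled by a path with the given signs.\<close>

definition ctx :: "('p label \<times> nat list) multiset \<Rightarrow> nat \<Rightarrow> nat \<Rightarrow> nat list \<Rightarrow> 'p label \<Rightarrow>
    ('q ltype \<times> bool) list set" where
  "ctx M u v xs L = {w. \<forall>ws. signs ws = w \<longrightarrow> fresh_walk u ws v (names M \<union> {u, v} \<union> set xs) \<longrightarrow>
     der rk (M + named_walk u ws) xs L}"

text \<open>The biorthogonal closure of phase semantics, with contexts as tests. The empty word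
  passes every test vacuously, since \<open>fresh_walk\<close> asks for a nonempty walk; it is
  removed because antecedents are nonempty.\<close>

definition cl :: "('q ltype \<times> bool) list set \<Rightarrow> ('q ltype \<times> bool) list set" where
  "cl Z = {w. w \<noteq> [] \<and> (\<forall>M u v xs L. Z \<subseteq> ctx M u v xs L \<longrightarrow> w \<in> ctx M u v xs L)}"

definition path_set :: "'q ltype \<Rightarrow> ('q ltype \<times> bool) list set" where
  "path_set A = {w. w \<noteq> [] \<and> (\<forall>x y. x \<noteq> y \<longrightarrow> w \<in> ctx {#} x y [x, y] (tr \<iota> A))}"

definition cycle_set :: "'q ltype \<Rightarrow> ('q ltype \<times> bool) list set" where
  "cycle_set A = {w. w \<noteq> [] \<and> (\<forall>z. w \<in> ctx {#} z z [] (Times (loop (tr \<iota> A))))}"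

text \<open>Signs let \<open>Rev\<close> act by turning words round, so that
  \<open>Rev (Rev A)\<close> is interpreted like \<open>A\<close>, as \<open>RRL\<close> and
  \<open>RRR\<close> demand. The product needs \<open>cl\<close>, because its one-letter word is no
  concatenation. The tests for \<open>Brace\<close> are cycles, which gives \<open>Rotate\<close>
  and \<open>AxRevBrace\<close>; they range over all \<open>D\<close>, which gives
  \<open>BraceL\<close>.\<close>

fun sem :: "'q ltype \<Rightarrow> ('q ltype \<times> bool) list set" where
  "sem (LPrim q) = path_set (LPrim q)"
| "sem (Under A B) = {w. w \<noteq> [] \<and> (\<forall>a\<in>sem A. a @ w \<in> sem B)}"
| "sem (Over B A) = {w. w \<noteq> [] \<and> (\<forall>a\<in>sem A. w @ a \<in> sem B)}"
| "sem (Prod A B) = cl {a @ b |a b. a \<in> sem A \<and> b \<in> sem B}"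
| "sem (Rev A) = {w. flip w \<in> sem A}"
| "sem (Brace A) = {w. w \<noteq> [] \<and> (\<forall>D. sem A \<subseteq> cycle_set D \<longrightarrow> w \<in> cycle_set D)}"

lemma ctxD:
  "w \<in> ctx M u v xs L \<Longrightarrow> signs ws = w \<Longrightarrow> fresh_walk u ws v (names M \<union> {u, v} \<union> set xs) \<Longrightarrow>
    der rk (M + named_walk u ws) xs L"
  by (auto simp: ctx_def)

lemma ctxI:
  "(\<And>ws. signs ws = w \<Longrightarrow> fresh_walk u ws v (names M \<union> {u, v} \<union> set xs) \<Longrightarrow>
    der rk (M + named_walk u ws) xs L) \<Longrightarrow> w \<in> ctx M u v xs L"
  by (auto simp: ctx_def)

lemma path_setD:
  assumes "w \<in> path_set A" "signs ws = w" "fresh_walk x ws y {x, y}" "x \<noteq> y"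
  shows "der rk (named_walk x ws) [x, y] (tr \<iota> A)"
  using assms ctxD[of w "{#}" x y "[x, y]" "tr \<iota> A" ws] by (auto simp: path_set_def)

lemma path_setI:
  assumes "\<And>x y ws. x \<noteq> y \<Longrightarrow> signs ws = w \<Longrightarrow> fresh_walk x ws y {x, y} \<Longrightarrow>
    der rk (named_walk x ws) [x, y] (tr \<iota> A)" "w \<noteq> []"
  shows "w \<in> path_set A"
  using assms by (auto simp: path_set_def intro!: ctxI)

lemma cycle_setD:
  assumes "w \<in> cycle_set A" "signs ws = w" "fresh_walk z ws z {z}"
  shows "der rk (named_walk z ws) [] (Times (loop (tr \<iota> A)))"
  using assms ctxD[of w "{#}" z z "[]" _ ws] by (auto simp: cycle_set_def)

lemma cycle_setI:
  assumes "\<And>z ws. signs ws = w \<Longrightarrow> fresh_walk z ws z {z} \<Longrightarrow>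
    der rk (named_walk z ws) [] (Times (loop (tr \<iota> A)))" "w \<noteq> []"
  shows "w \<in> cycle_set A"
  using assms by (auto simp: cycle_set_def intro!: ctxI)

lemma clI:
  "w \<noteq> [] \<Longrightarrow> (\<And>M u v xs L. Z \<subseteq> ctx M u v xs L \<Longrightarrow> w \<in> ctx M u v xs L) \<Longrightarrow> w \<in> cl Z"
  by (auto simp: cl_def)

lemma clD: "w \<in> cl Z \<Longrightarrow> Z \<subseteq> ctx M u v xs L \<Longrightarrow> w \<in> ctx M u v xs L"
  by (auto simp: cl_def)

lemma cl_nonempty: "w \<in> cl Z \<Longrightarrow> w \<noteq> []"
  by (auto simp: cl_def)

lemma cl_mono: "Z \<subseteq> Z' \<Longrightarrow> cl Z \<subseteq> cl Z'"
  by (auto simp: cl_def)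

lemma cl_cl: "cl (cl Z) \<subseteq> cl Z"
proof
  fix w assume w: "w \<in> cl (cl Z)"
  show "w \<in> cl Z"
  proof (rule clI)
    fix M u v xs L assume "Z \<subseteq> ctx M u v xs L"
    then have "cl Z \<subseteq> ctx M u v xs L" by (auto dest: clD)
    with w show "w \<in> ctx M u v xs L" by (rule clD)
  qed (rule cl_nonempty[OF w])
qed

lemma path_set_closed: "cl (path_set A) \<subseteq> path_set A"
proof
  fix w assume w: "w \<in> cl (path_set A)"
  have "path_set A \<subseteq> ctx {#} x y [x, y] (tr \<iota> A)" if "x \<noteq> y" for x y
    using that by (auto simp: path_set_def)
  then show "w \<in> path_set A"
    using clD[OF w] cl_nonempty[OF w] by (simp add: path_set_def)
qed

lemma cycle_set_closed: "cl (cycle_set A) \<subseteq> cycle_set A"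
proof
  fix w assume w: "w \<in> cl (cycle_set A)"
  have "cycle_set A \<subseteq> ctx {#} z z [] (Times (loop (tr \<iota> A)))" for z
    by (auto simp: cycle_set_def)
  then show "w \<in> cycle_set A"
    using clD[OF w] cl_nonempty[OF w] by (simp add: cycle_set_def)
qed

text \<open>A context for \<open>p @ w @ q\<close> becomes a context for \<open>w\<close> when the
  walks spelling \<open>p\<close> and \<open>q\<close> are moved from the gap into the graph. Closed
  sets are thus stable under fixing the surroundings of a word; the division clauses and
  \<open>ProdL\<close> depend on this.\<close>

lemma residual_closed:
  assumes "cl Z \<subseteq> Z" "w \<in> cl {w. p @ w @ q \<in> Z}"
  shows "p @ w @ q \<in> Z"
proof -
  have "w \<noteq> []" using cl_nonempty[OF assms(2)] .
  have "p @ w @ q \<in> cl Z"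
  proof (rule clI)
    fix M u v xs L assume Z: "Z \<subseteq> ctx M u v xs L"
    show "p @ w @ q \<in> ctx M u v xs L"
    proof (rule ctxI)
      fix zs assume zs: "signs zs = p @ w @ q" "fresh_walk u zs v (names M \<union> {u, v} \<union> set xs)"
      obtain ps rs where ps: "zs = ps @ rs" "signs ps = p" "signs rs = w @ q"
        using zs(1) by (rule signs_eq_append)
      obtain ws qs where ws: "rs = ws @ qs" "signs ws = w" "signs qs = q"
        using ps(3) by (rule signs_eq_append)
      define a where "a = final u ps"
      define b where "b = final a ws"
      \<comment> \<open>The enlarged context, with its gap narrowed to run from \<open>a\<close> to
        \<open>b\<close>.\<close>
      define N where "N = M + named_walk u ps + named_walk b qs"
      define S where "S = names M \<union> {u, v} \<union> set xs"
      define E where "E = names N \<union> {a, b} \<union> set xs"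
      \<comment> \<open>The inner nodes of the whole walk from \<open>b\<close> onwards. The list is
        empty if \<open>qs\<close> is, as then \<open>b\<close> is the end \<open>v\<close>.\<close>
      define B where "B = butlast (b # stops qs)"
      have "ws \<noteq> []" using ws(2) \<open>w \<noteq> []\<close> by auto
      have fv: "final b qs = v" using zs(2) ps ws by (auto simp: fresh_walk_def a_def b_def)
      have E: "E = S \<union> set (stops ps) \<union> set B"
        using fv stops_conv_inner[of ps u] stops_conv_inner[of qs b]
        by (cases "ps = []"; cases "qs = []")
          (auto simp: E_def N_def S_def B_def names_walk a_def[symmetric], auto simp: a_def)
      have "distinct (stops ps @ B)" "(set (stops ps) \<union> set B) \<inter> S = {}"
        using zs(2) inner_splice[OF \<open>ws \<noteq> []\<close>, of ps qs a]
        by (auto simp: fresh_walk_def S_def B_def b_def ps ws simp del: butlast.simps)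
      \<comment> \<open>Any filler of the narrowed gap is fresh for the enlarged context exactly if
        the whole walk is fresh for the original one; so tests can be transferred both ways.\<close>
      then have split: "fresh_walk u (ps @ ws' @ qs) v S \<longleftrightarrow> fresh_walk a ws' b E"
        if "ws' \<noteq> []" "final a ws' = b" for ws'
        using inner_splice[OF that(1), of ps qs a] that fv unfolding E
        by (auto simp: fresh_walk_def B_def a_def[symmetric] simp del: butlast.simps)
      have "{w. p @ w @ q \<in> Z} \<subseteq> ctx N a b xs L"
      proof
        fix w' assume "w' \<in> {w. p @ w @ q \<in> Z}"
        then have w': "p @ w' @ q \<in> ctx M u v xs L" using Z by auto
        show "w' \<in> ctx N a b xs L"
        proof (rule ctxI)
          fix ws' assume *: "signs ws' = w'" "fresh_walk a ws' b (names N \<union> {a, b} \<union> set xs)"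
          then have fb: "ws' \<noteq> []" "final a ws' = b" by (auto simp: fresh_walk_def)
          have "der rk (M + named_walk u (ps @ ws' @ qs)) xs L"
            by (rule ctxD[OF w']) (use * split[OF fb] ps ws in \<open>auto simp: S_def E_def\<close>)
          moreover note fb(2)
          ultimately show "der rk (N + named_walk a ws') xs L"
            by (simp add: N_def a_def ac_simps)
        qed
      qed
      then have "w \<in> ctx N a b xs L" by (rule clD[OF assms(2)])
      moreover have "fresh_walk a ws b (names N \<union> {a, b} \<union> set xs)"
        using zs(2) split[OF \<open>ws \<noteq> []\<close>] by (simp add: S_def E_def b_def ps ws)
      ultimately have "der rk (N + named_walk a ws) xs L"
        using ctxD ws(2) by blast
      then show "der rk (M + named_walk u zs) xs L"
        by (simp add: N_def a_def b_def ps ws ac_simps)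
    qed
  qed (use \<open>w \<noteq> []\<close> in simp)
  then show ?thesis using assms(1) by blast
qed

text \<open>A gap from \<open>u\<close> to \<open>v\<close> is also a gap from \<open>v\<close> to
  \<open>u\<close>: filling it with a word or, from the other end, with the flipped word yields the
  same edges.\<close>

lemma flip_closed:
  assumes "cl Z \<subseteq> Z" "w \<in> cl {w. flip w \<in> Z}"
  shows "flip w \<in> Z"
proof -
  have "flip w \<in> cl Z"
  proof (rule clI)
    fix M u v xs L assume Z: "Z \<subseteq> ctx M u v xs L"
    have reverse: "M + named_walk v (backward u ws) = M + named_walk u ws"
      if "fresh_walk u ws v N" for u v ws N
      using that mset_walk_backward[of "tr \<iota>" u ws] by (auto simp: fresh_walk_def)
    have swap: "names M \<union> {u, v} \<union> set xs = names M \<union> {v, u} \<union> set xs" by auto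
    have "{w. flip w \<in> Z} \<subseteq> ctx M v u xs L"
    proof
      fix w' assume "w' \<in> {w. flip w \<in> Z}"
      then have w': "flip w' \<in> ctx M u v xs L" using Z by auto
      show "w' \<in> ctx M v u xs L"
      proof (rule ctxI)
        fix ws assume *: "signs ws = w'" "fresh_walk v ws u (names M \<union> {v, u} \<union> set xs)"
        have "der rk (M + named_walk u (backward v ws)) xs L"
          by (rule ctxD[OF w']) (use * fresh_walk_backward[OF *(2)] swap in \<open>auto simp: signs_backward\<close>)
        then show "der rk (M + named_walk v ws) xs L" by (simp add: reverse[OF *(2)])
      qed
    qed
    then have w: "w \<in> ctx M v u xs L" by (rule clD[OF assms(2)])
    show "flip w \<in> ctx M u v xs L"
    proof (rule ctxI)
      fix ws assume *: "signs ws = flip w" "fresh_walk u ws v (names M \<union> {u, v} \<union> set xs)"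
      have "der rk (M + named_walk v (backward u ws)) xs L"
        by (rule ctxD[OF w]) (use * fresh_walk_backward[OF *(2)] swap in \<open>auto simp: signs_backward\<close>)
      then show "der rk (M + named_walk u ws) xs L" by (simp add: reverse[OF *(2)])
    qed
  qed (use cl_nonempty[OF assms(2)] in simp)
  then show ?thesis using assms(1) by blast
qed

text \<open>With no external nodes the sequent does not show where the cycle begins. Started at the
  seam \<open>m\<close> between the two pieces, the same edges spell the rotated word.\<close>

lemma cycle_set_rotate:
  assumes "v @ w \<in> cycle_set A"
  shows "w @ v \<in> cycle_set A"
proof (cases "v = [] \<or> w = []")
  case False
  show ?thesis
  proof (rule cycle_setI)
    fix z zs assume zs: "signs zs = w @ v" "fresh_walk z zs z {z}"
    obtain ws vs where s: "zs = ws @ vs" "signs ws = w" "signs vs = v"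
      using zs(1) by (rule signs_eq_append)
    have ne: "ws \<noteq> []" "vs \<noteq> []" using s False by auto
    define m where "m = final z ws"
    have fin: "final m vs = z" "final z (ws @ vs) = z"
      using zs(2) s by (auto simp: fresh_walk_def m_def)
    have "inner (ws @ vs) = inner ws @ m # inner vs" "inner (vs @ ws) = inner vs @ z # inner ws"
      using inner_append[OF ne, of z] inner_append[OF ne(2,1), of m] fin by (auto simp: m_def)
    then have fresh: "fresh_walk m (vs @ ws) m {m}"
      using zs(2) s fin ne by (auto simp: fresh_walk_def m_def)
    have "der rk (named_walk m (vs @ ws)) [] (Times (loop (tr \<iota> A)))"
      by (rule cycle_setD[OF assms _ fresh]) (use s in simp)
    then show "der rk (named_walk z zs) [] (Times (loop (tr \<iota> A)))"
      using walk_rotate(1)[OF fin(2), of "tr \<iota>"] s by (simp add: m_def add.commute)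
  qed (use False in auto)
qed (use assms in auto)

lemma cycle_set_flip:
  assumes "flip w \<in> cycle_set A"
  shows "w \<in> cycle_set A"
proof (rule cycle_setI)
  fix z ws assume ws: "signs ws = w" "fresh_walk z ws z {z}"
  have "der rk (named_walk z (backward z ws)) [] (Times (loop (tr \<iota> A)))"
    by (rule cycle_setD[OF assms]) (use ws fresh_walk_backward in \<open>auto simp: signs_backward\<close>)
  then show "der rk (named_walk z ws) [] (Times (loop (tr \<iota> A)))"
    using mset_walk_backward[of "tr \<iota>" z ws] ws(2) by (simp add: fresh_walk_def)
qed (use assms in \<open>auto simp: cycle_set_def\<close>)

lemma typed_walk: "typed rk (named_walk x ws)"
  by (induction "tr \<iota>" x ws rule: walk.induct) (auto simp: hl_type_tr)

lemma move_ident: "(\<And>v. v \<in> set (stops ws) \<Longrightarrow> f v = v) \<Longrightarrow> move f ws = ws"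
  by (induction ws) (auto simp: move_def stops_def)

text \<open>The cycle is opened by moving its start to a fresh node \<open>z'\<close>. The path
  obtained is derivable, and \<open>der_loopR\<close> fuses \<open>z'\<close> with \<open>z\<close>
  again.\<close>

lemma path_set_subset_cycle_set: "path_set A \<subseteq> cycle_set A"
proof
  fix w assume w: "w \<in> path_set A"
  show "w \<in> cycle_set A"
  proof (rule cycle_setI)
    fix z ws assume ws: "signs ws = w" "fresh_walk z ws z {z}"
    obtain z' where z': "z' \<notin> insert z (set (stops ws))"
      using ex_new_if_finite[OF infinite_UNIV_nat, of "insert z (set (stops ws))"] by auto
    have st: "stops ws = inner ws @ [z]"
      using ws(2) stops_conv_inner[of ws z] by (auto simp: fresh_walk_def)
    have fr: "fresh_walk z' ws z {z', z}"
      using ws(2) z' st by (auto simp: fresh_walk_def final_conv)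
    have P: "der rk (named_walk z' ws) [z', z] (tr \<iota> A)"
      by (rule path_setD[OF w ws(1) fr]) (use z' in auto)
    define f where "f = id(z' := z)"
    have names: "names (named_walk z' ws) - {z', z} = set (inner ws)"
      using names_fresh_walk[OF fr, of "tr \<iota>"] fr by (auto simp: fresh_walk_def)
    have "der rk (rename f (named_walk z' ws)) [] (Times (loop (tr \<iota> A)))"
      by (rule der_loopR[OF P]) (use ws(2) z' st in \<open>auto simp: f_def names fresh_walk_def inj_on_def\<close>)
    moreover have "move f ws = ws"
      by (rule move_ident) (use z' in \<open>auto simp: f_def\<close>)
    ultimately show "der rk (named_walk z ws) [] (Times (loop (tr \<iota> A)))"
      by (simp add: rename_walk) (simp add: f_def)
  qed (use w in \<open>auto simp: path_set_def\<close>)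
qed

text \<open>Redirecting the end \<open>y\<close> to \<open>x\<close> closes the path to a cycle,
  which is the premise of \<open>der_BraceR\<close>.\<close>

lemma cycle_set_subset_path_set_Brace: "cycle_set A \<subseteq> path_set (Brace A)"
proof
  fix w assume w: "w \<in> cycle_set A"
  show "w \<in> path_set (Brace A)"
  proof (rule path_setI)
    fix x y ws assume "x \<noteq> y" and ws: "signs ws = w" "fresh_walk x ws y {x, y}"
    define f where "f = id(y := x)"
    have st: "stops ws = inner ws @ [y]"
      using ws(2) stops_conv_inner[of ws x] by (auto simp: fresh_walk_def)
    have names: "names (named_walk x ws) = {x, y} \<union> set (inner ws)"
      "set (inner ws) \<inter> {x, y} = {}"
      using names_fresh_walk[OF ws(2), of "tr \<iota>"] ws(2) by (auto simp: fresh_walk_def)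
    have inner: "inner (move f ws) = inner ws"
    proof -
      have "map f (inner ws) = inner ws"
        using names(2) by (auto intro!: map_idI simp: f_def)
      then show ?thesis by (simp add: inner_def stops_move map_butlast[symmetric])
    qed
    have "fresh_walk x (move f ws) x {x}"
      using ws(2) final_move[of f x ws] \<open>x \<noteq> y\<close> inner by (auto simp: fresh_walk_def f_def)
    then have "der rk (named_walk x (move f ws)) [] (Times (loop (tr \<iota> A)))"
      by (rule cycle_setD[OF w, rotated]) (use ws(1) in \<open>simp add: signs_move\<close>)
    then have "der rk (rename f (named_walk x ws)) [] (Times (loop (tr \<iota> A)))"
      using \<open>x \<noteq> y\<close> by (simp add: rename_walk) (simp add: f_def)
    then show "der rk (named_walk x ws) [x, y] (tr \<iota> (Brace A))"
      by (rule der_BraceR[where \<sigma> = f and c = x, OF _ typed_walk \<open>x \<noteq> y\<close>])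
        (use names in \<open>auto simp: f_def inj_on_def\<close>)
  qed (use w in \<open>auto simp: cycle_set_def\<close>)
qed

lemma Nil_notin_sem [simp]: "[] \<notin> sem A"
  by (induction A) (auto simp: path_set_def cl_def)

lemma sem_nonempty: "w \<in> sem A \<Longrightarrow> w \<noteq> []"
  by auto

lemma sem_closed: "cl (sem A) \<subseteq> sem A"
proof (induction A)
  case (LPrim q)
  show ?case by (simp add: path_set_closed)
next
  case (Under A B)
  show ?case
  proof
    fix w assume w: "w \<in> cl (sem (Under A B))"
    have "a @ w @ [] \<in> sem B" if "a \<in> sem A" for a
      by (rule residual_closed[OF Under.IH(2)], rule subsetD[OF cl_mono w]) (use that in auto)
    then show "w \<in> sem (Under A B)" using cl_nonempty[OF w] by simp
  qed
next
  case (Over B A)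
  show ?case
  proof
    fix w assume w: "w \<in> cl (sem (Over B A))"
    have "[] @ w @ a \<in> sem B" if "a \<in> sem A" for a
      by (rule residual_closed[OF Over.IH(1)], rule subsetD[OF cl_mono w]) (use that in auto)
    then show "w \<in> sem (Over B A)" using cl_nonempty[OF w] by simp
  qed
next
  case (Prod A B)
  show ?case by (simp add: cl_cl)
next
  case (Rev A)
  show ?case using flip_closed[OF Rev.IH] by auto
next
  case (Brace A)
  show ?case
  proof
    fix w assume w: "w \<in> cl (sem (Brace A))"
    have "w \<in> cycle_set D" if "sem A \<subseteq> cycle_set D" for D
      by (rule subsetD[OF cycle_set_closed], rule subsetD[OF cl_mono w]) (use that in auto)
    then show "w \<in> sem (Brace A)" using cl_nonempty[OF w] by simp
  qed
qed

lemma sem_ctx: "w \<in> cl (sem A) \<Longrightarrow> w \<in> sem A"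
  using sem_closed by blast

text \<open>The two halves of Okada's lemma.\<close>

lemma sem_letter_path_set: "[(A, True)] \<in> sem A \<and> sem A \<subseteq> path_set A"
proof (induction A)
  case (LPrim q)
  have "[(LPrim q, True)] \<in> path_set (LPrim q)"
  proof (rule path_setI)
    fix x y ws assume "x \<noteq> y" "signs ws = [(LPrim q, True)]" "fresh_walk x ws y {x, y}"
    then show "der rk (named_walk x ws) [x, y] (tr \<iota> (LPrim q))"
      using der_Ax[of x y q] by (auto simp: fresh_walk_def elim!: signs_eq_single)
  qed simp
  then show ?case by simp
next
  case (Under A B)
  \<comment> \<open>As \<open>sem B\<close> is closed, only gaps accepting all of
    \<open>sem B\<close> matter. Such a gap accepts the letter \<open>B\<close> by induction, and
    \<open>der_UnderL\<close> trades that edge for a path spelling \<open>a\<close>, derivable by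
    induction for \<open>A\<close>, followed by the new letter.\<close>
  have "a @ [(Under A B, True)] \<in> sem B" if "a \<in> sem A" for a
  proof (rule sem_ctx, rule clI)
    fix M u v xs L assume "sem B \<subseteq> ctx M u v xs L"
    then have B: "[(B, True)] \<in> ctx M u v xs L" using Under by blast
    show "a @ [(Under A B, True)] \<in> ctx M u v xs L"
    proof (rule ctxI)
      fix zs assume zs: "signs zs = a @ [(Under A B, True)]"
        "fresh_walk u zs v (names M \<union> {u, v} \<union> set xs)"
      obtain ws rs where s: "zs = ws @ rs" "signs ws = a" "signs rs = [(Under A B, True)]"
        using zs(1) by (rule signs_eq_append)
      then obtain y where "rs = [(Under A B, True, y)]" by (auto elim!: signs_eq_single)
      then have rs: "rs = [(Under A B, True, v)]" using s zs(2) by (auto simp: fresh_walk_def)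
      have ne: "ws \<noteq> []" using s sem_nonempty[OF that] by auto
      define m where "m = final u ws"
      have inner: "inner zs = inner ws @ [m]"
        using inner_append[OF ne, of rs u] by (simp add: s rs m_def)
      have ws: "fresh_walk u ws m {u, m}"
        using zs(2) ne inner by (auto simp: fresh_walk_def m_def)
      have "u \<noteq> m" using zs(2) inner by (auto simp: fresh_walk_def)
      have "der rk (named_walk u ws) [u, m] (tr \<iota> A)"
        by (rule path_setD[OF _ s(2) ws \<open>u \<noteq> m\<close>]) (use Under that in blast)
      moreover have "der rk (add_mset (tr \<iota> B, [u, v]) M) xs L"
        using ctxD[OF B, of "[(B, True, v)]"] by (auto simp: fresh_walk_def)
      ultimately have "der rk (add_mset (tr \<iota> (Under A B), [m, v]) (M + named_walk u ws)) xs L"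
        using zs(2) inner names_fresh_walk[OF ws, of "tr \<iota>"]
        by (intro der_UnderL) (auto simp: fresh_walk_def)
      then show "der rk (M + named_walk u zs) xs L"
        by (simp add: s rs m_def[symmetric])
    qed
  qed simp
  moreover have "w \<in> path_set (Under A B)" if w: "w \<in> sem (Under A B)" for w
  proof (rule path_setI)
    have wB: "(A, True) # w \<in> path_set B" using w Under by auto
    fix x y ws assume "x \<noteq> y" and ws: "signs ws = w" "fresh_walk x ws y {x, y}"
    \<comment> \<open>A new start for one more edge labelled \<open>A\<close>, whose letter lies in
      \<open>sem A\<close> by induction; \<open>der_UnderR\<close> removes it again.\<close>
    obtain z where z: "z \<notin> names (named_walk x ws)"
      using ex_new_if_finite[OF infinite_UNIV_nat, of "names (named_walk x ws)"] by auto
    note names = names_fresh_walk[OF ws(2), of "tr \<iota>"]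
    let ?ws = "(A, True, x) # ws"
    have ne: "ws \<noteq> []" using ws(2) by (auto simp: fresh_walk_def)
    have "inner ?ws = x # inner ws" using ne by (simp add: inner_def)
    then have "fresh_walk z ?ws y {z, y}"
      using ws(2) z names \<open>x \<noteq> y\<close> by (auto simp: fresh_walk_def)
    then have "der rk (named_walk z ?ws) [z, y] (tr \<iota> B)"
      by (rule path_setD[OF wB, rotated]) (use ws(1) z names in auto)
    then show "der rk (named_walk x ws) [x, y] (tr \<iota> (Under A B))"
      using \<open>x \<noteq> y\<close> z names by (intro der_UnderR[of _ z]) auto
  qed (use w in simp)
  ultimately show ?case by auto
next
  case (Over B A)
  have "[(Over B A, True)] @ a \<in> sem B" if "a \<in> sem A" for a
  proof (rule sem_ctx, rule clI)
    fix M u v xs L assume "sem B \<subseteq> ctx M u v xs L"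
    then have B: "[(B, True)] \<in> ctx M u v xs L" using Over by blast
    show "[(Over B A, True)] @ a \<in> ctx M u v xs L"
    proof (rule ctxI)
      fix zs assume zs: "signs zs = [(Over B A, True)] @ a"
        "fresh_walk u zs v (names M \<union> {u, v} \<union> set xs)"
      obtain rs ws where s: "zs = rs @ ws" "signs rs = [(Over B A, True)]" "signs ws = a"
        using zs(1) by (rule signs_eq_append)
      then obtain m where rs: "rs = [(Over B A, True, m)]" by (auto elim!: signs_eq_single)
      have ne: "ws \<noteq> []" using s sem_nonempty[OF that] by auto
      have inner: "inner zs = m # inner ws"
        using inner_append[OF _ ne, of rs u] by (simp add: s rs)
      have ws: "fresh_walk m ws v {m, v}"
        using zs(2) ne inner by (auto simp: fresh_walk_def s rs)
      have "m \<noteq> v" using zs(2) inner by (auto simp: fresh_walk_def)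
      have "der rk (named_walk m ws) [m, v] (tr \<iota> A)"
        by (rule path_setD[OF _ s(3) ws \<open>m \<noteq> v\<close>]) (use Over that in blast)
      moreover have "der rk (add_mset (tr \<iota> B, [u, v]) M) xs L"
        using ctxD[OF B, of "[(B, True, v)]"] by (auto simp: fresh_walk_def)
      ultimately have "der rk (add_mset (tr \<iota> (Over B A), [u, m]) (M + named_walk m ws)) xs L"
        using zs(2) inner names_fresh_walk[OF ws, of "tr \<iota>"]
        by (intro der_OverL) (auto simp: fresh_walk_def)
      then show "der rk (M + named_walk u zs) xs L"
        by (simp add: s rs)
    qed
  qed simp
  moreover have "w \<in> path_set (Over B A)" if w: "w \<in> sem (Over B A)" for w
  proof (rule path_setI)
    have wB: "w @ [(A, True)] \<in> path_set B" using w Over by auto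
    fix x y ws assume "x \<noteq> y" and ws: "signs ws = w" "fresh_walk x ws y {x, y}"
    obtain z where z: "z \<notin> names (named_walk x ws)"
      using ex_new_if_finite[OF infinite_UNIV_nat, of "names (named_walk x ws)"] by auto
    note names = names_fresh_walk[OF ws(2), of "tr \<iota>"]
    let ?ws = "ws @ [(A, True, z)]"
    have ne: "ws \<noteq> []" and fin: "final x ws = y" using ws(2) by (auto simp: fresh_walk_def)
    have "inner ?ws = inner ws @ [y]" using inner_append[OF ne, of "[(A, True, z)]" x] fin by simp
    then have "fresh_walk x ?ws z {x, z}"
      using ws(2) z names \<open>x \<noteq> y\<close> by (auto simp: fresh_walk_def)
    then have "der rk (named_walk x ?ws) [x, z] (tr \<iota> B)"
      by (rule path_setD[OF wB, rotated]) (use ws(1) z names in auto)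
    then show "der rk (named_walk x ws) [x, y] (tr \<iota> (Over B A))"
      using \<open>x \<noteq> y\<close> z names fin by (intro der_OverR[of _ _ z]) auto
  qed (use w in simp)
  ultimately show ?case by auto
next
  case (Prod A B)
  let ?Z = "{a @ b |a b. a \<in> sem A \<and> b \<in> sem B}"
  have "[(Prod A B, True)] \<in> cl ?Z"
  proof (rule clI)
    fix M u v xs L assume "?Z \<subseteq> ctx M u v xs L"
    moreover have "[(A, True)] @ [(B, True)] \<in> ?Z" using Prod by blast
    ultimately have AB: "[(A, True), (B, True)] \<in> ctx M u v xs L" by auto
    show "[(Prod A B, True)] \<in> ctx M u v xs L"
    proof (rule ctxI)
      fix ws assume ws: "signs ws = [(Prod A B, True)]" "fresh_walk u ws v (names M \<union> {u, v} \<union> set xs)"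
      then have s: "ws = [(Prod A B, True, v)]"
        by (auto simp: fresh_walk_def elim!: signs_eq_single)
      obtain m where m: "m \<notin> names M \<union> {u, v} \<union> set xs"
        using ex_new_if_finite[OF infinite_UNIV_nat, of "names M \<union> {u, v} \<union> set xs"] by auto
      have "der rk (M + named_walk u [(A, True, m), (B, True, v)]) xs L"
        by (rule ctxD[OF AB]) (use m in \<open>auto simp: fresh_walk_def inner_def\<close>)
      then show "der rk (M + named_walk u ws) xs L"
        using der_ProdL[of A u m B v M xs L] m s by (simp add: add_mset_commute)
    qed
  qed simp
  moreover have "cl ?Z \<subseteq> path_set (Prod A B)"
  proof -
    have "?Z \<subseteq> path_set (Prod A B)"
    proof clarify
      fix a b assume a: "a \<in> sem A" and b: "b \<in> sem B"
      show "a @ b \<in> path_set (Prod A B)"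
      proof (rule path_setI)
        fix x y zs assume "x \<noteq> y" and zs: "signs zs = a @ b" "fresh_walk x zs y {x, y}"
        obtain us vs where s: "zs = us @ vs" "signs us = a" "signs vs = b"
          using zs(1) by (rule signs_eq_append)
        have ne: "us \<noteq> []" "vs \<noteq> []" using s a b by auto
        define m where "m = final x us"
        have inner: "inner zs = inner us @ m # inner vs"
          using inner_append[OF ne, of x] by (simp add: s m_def)
        have us: "fresh_walk x us m {x, m}" and vs: "fresh_walk m vs y {m, y}" and m: "x \<noteq> m" "m \<noteq> y"
          using zs(2) ne inner by (auto simp: fresh_walk_def m_def s)
        have "der rk (named_walk x us) [x, m] (tr \<iota> A)"
          by (rule path_setD[OF _ s(2) us m(1)]) (use Prod a in blast)
        moreover have "der rk (named_walk m vs) [m, y] (tr \<iota> B)"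
          by (rule path_setD[OF _ s(3) vs m(2)]) (use Prod b in blast)
        moreover have "names (named_walk x us) \<inter> names (named_walk m vs) \<subseteq> {m}"
          unfolding names_fresh_walk[OF us] names_fresh_walk[OF vs]
          using zs(2) inner \<open>x \<noteq> y\<close> by (auto simp: fresh_walk_def)
        ultimately show "der rk (named_walk x zs) [x, y] (tr \<iota> (Prod A B))"
          using der_ProdR[OF _ _ \<open>x \<noteq> y\<close>] by (simp add: s m_def[symmetric])
      qed (use sem_nonempty[OF a] in simp)
    qed
    then show ?thesis using path_set_closed cl_mono by blast
  qed
  ultimately show ?case by simp
next
  case (Rev A)
  \<comment> \<open>The flip of the letter \<open>Rev A\<close>. By \<open>der_RevL\<close>, an edge
    \<open>Rev A\<close> traversed backwards can stand wherever an edge \<open>A\<close> traversed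
    forwards can.\<close>
  have "[(Rev A, False)] \<in> sem A"
  proof (rule sem_ctx, rule clI)
    fix M u v xs L assume "sem A \<subseteq> ctx M u v xs L"
    then have A: "[(A, True)] \<in> ctx M u v xs L" using Rev by blast
    show "[(Rev A, False)] \<in> ctx M u v xs L"
    proof (rule ctxI)
      fix ws assume ws: "signs ws = [(Rev A, False)]" "fresh_walk u ws v (names M \<union> {u, v} \<union> set xs)"
      then have s: "ws = [(Rev A, False, v)]"
        by (auto simp: fresh_walk_def elim!: signs_eq_single)
      have "der rk (M + named_walk u [(A, True, v)]) xs L"
        by (rule ctxD[OF A]) (auto simp: fresh_walk_def)
      then show "der rk (M + named_walk u ws) xs L"
        using der_RevL[of A u v M xs L] s by simp
    qed
  qed simp
  moreover have "w \<in> path_set (Rev A)" if w: "flip w \<in> sem A" for w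
  proof (rule path_setI)
    fix x y ws assume "x \<noteq> y" and ws: "signs ws = w" "fresh_walk x ws y {x, y}"
    have "fresh_walk y (backward x ws) x {y, x}"
      using fresh_walk_backward[OF ws(2)] by (simp add: insert_commute)
    then have "der rk (named_walk y (backward x ws)) [y, x] (tr \<iota> A)"
      by (rule path_setD[rotated 2]) (use w ws(1) Rev \<open>x \<noteq> y\<close> in \<open>auto simp: signs_backward\<close>)
    then have "der rk (named_walk x ws) [y, x] (tr \<iota> A)"
      using mset_walk_backward[of "tr \<iota>" x ws] ws(2) by (simp add: fresh_walk_def)
    then show "der rk (named_walk x ws) [x, y] (tr \<iota> (Rev A))"
      by (rule der_RevR)
  qed (use sem_nonempty[OF w] in simp)
  ultimately show ?case by auto
next
  case (Brace A)
  have "[(Brace A, True)] \<in> cycle_set D" if "sem A \<subseteq> cycle_set D" for D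
  proof (rule cycle_setI)
    have A: "[(A, True)] \<in> cycle_set D" using that Brace by blast
    fix z ws assume ws: "signs ws = [(Brace A, True)]" "fresh_walk z ws z {z}"
    then have s: "ws = [(Brace A, True, z)]"
      by (auto simp: fresh_walk_def elim!: signs_eq_single)
    have "der rk (named_walk z [(A, True, z)]) [] (Times (loop (tr \<iota> D)))"
      by (rule cycle_setD[OF A]) (auto simp: fresh_walk_def)
    \<comment> \<open>Two left rules in a row: \<open>der_loopL\<close> hides the loop
      \<open>A\<close> in a hyperedge of rank 0, and \<open>der_BraceL\<close> exchanges this for
      the loop \<open>Brace A\<close>.\<close>
    then show "der rk (named_walk z ws) [] (Times (loop (tr \<iota> D)))"
      using der_BraceL[OF der_loopL, of A z] s by simp
  qed simp
  \<comment> \<open>So \<open>D = A\<close> is an admissible test in the clause for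
    \<open>Brace\<close>: words of \<open>sem (Brace A)\<close> label derivable cycles with
    succedent \<open>Times (loop (tr \<iota> A))\<close>, and these can be cut open into
    paths.\<close>
  moreover have "sem A \<subseteq> cycle_set A" using Brace path_set_subset_cycle_set by blast
  then have "sem (Brace A) \<subseteq> cycle_set A" by auto
  ultimately show ?case using cycle_set_subset_path_set_Brace[of A] by auto
qed

section \<open>Soundness of the Lambek calculus\<close>

abbreviation "matches \<equiv> list_all2 (\<lambda>v A. v \<in> sem A)"

definition valid :: "'q ltype list \<Rightarrow> 'q ltype \<Rightarrow> bool" where
  "valid \<Gamma> B \<longleftrightarrow> (\<forall>vs. matches vs \<Gamma> \<longrightarrow> concat vs \<in> sem B)"

lemma validI: "(\<And>vs. matches vs \<Gamma> \<Longrightarrow> concat vs \<in> sem B) \<Longrightarrow> valid \<Gamma> B"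
  by (auto simp: valid_def)

lemma validD: "valid \<Gamma> B \<Longrightarrow> matches vs \<Gamma> \<Longrightarrow> concat vs \<in> sem B"
  by (auto simp: valid_def)

lemma valid_context:
  assumes "valid (\<Gamma> @ [A] @ \<Delta>) C" "matches gs \<Gamma>"
    "matches ds \<Delta>" "w \<in> sem A"
  shows "concat gs @ w @ concat ds \<in> sem C"
  using validD[OF assms(1), of "gs @ [w] @ ds"] assms(2-) by (auto intro!: list_all2_appendI)

lemma concat_nonempty:
  "matches vs \<Gamma> \<Longrightarrow> \<Gamma> \<noteq> [] \<Longrightarrow> concat vs \<noteq> []"
  by (cases vs; cases \<Gamma>) (auto dest: sem_nonempty)

text \<open>\<open>Cut\<close> costs nothing here: the word matched with the antecedent of one
  premise is an element matching the cut type in the other. Closedness enters through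
  \<open>ProdL\<close>, and invariance of cycles through \<open>Rotate\<close> and
  \<open>AxRevBrace\<close>.\<close>

lemma lbr_valid: "lbr \<Gamma> B \<Longrightarrow> valid \<Gamma> B"
proof (induction rule: lbr.induct)
  case (Ax A)
  show ?case by (rule validI) (auto simp: list_all2_Cons2)
next
  case (UnderL \<Gamma> B \<Delta> C \<Pi> A)
  show ?case
  proof (rule validI)
    fix vs assume "matches vs (\<Gamma> @ \<Pi> @ [Under A B] @ \<Delta>)"
    then obtain gs ps w ds where vs: "vs = gs @ ps @ [w] @ ds" "matches gs \<Gamma>"
      "matches ps \<Pi>" "w \<in> sem (Under A B)" "matches ds \<Delta>"
      by (auto simp: list_all2_append2 list_all2_Cons2)
    have "concat ps @ w \<in> sem B" using validD[OF UnderL.IH(2) vs(3)] vs(4) by simp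
    from valid_context[OF UnderL.IH(1) vs(2,5) this] show "concat vs \<in> sem C" using vs(1) by simp
  qed
next
  case (UnderR \<Pi> A B)
  show ?case
  proof (rule validI)
    fix vs assume vs: "matches vs \<Pi>"
    then have "a @ concat vs \<in> sem B" if "a \<in> sem A" for a
      using validD[OF UnderR.IH, of "a # vs"] that by simp
    then show "concat vs \<in> sem (Under A B)" using concat_nonempty[OF vs UnderR.hyps(1)] by simp
  qed
next
  case (OverL \<Gamma> B \<Delta> C \<Pi> A)
  show ?case
  proof (rule validI)
    fix vs assume "matches vs (\<Gamma> @ [Over B A] @ \<Pi> @ \<Delta>)"
    then obtain gs ps w ds where vs: "vs = gs @ [w] @ ps @ ds" "matches gs \<Gamma>"
      "matches ps \<Pi>" "w \<in> sem (Over B A)" "matches ds \<Delta>"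
      by (auto simp: list_all2_append2 list_all2_Cons2)
    have "w @ concat ps \<in> sem B" using validD[OF OverL.IH(2) vs(3)] vs(4) by simp
    from valid_context[OF OverL.IH(1) vs(2,5) this] show "concat vs \<in> sem C" using vs(1) by simp
  qed
next
  case (OverR \<Pi> A B)
  show ?case
  proof (rule validI)
    fix vs assume vs: "matches vs \<Pi>"
    then have "concat vs @ a \<in> sem B" if "a \<in> sem A" for a
      using validD[OF OverR.IH, of "vs @ [a]"] that by (simp add: list_all2_appendI)
    then show "concat vs \<in> sem (Over B A)" using concat_nonempty[OF vs OverR.hyps(1)] by simp
  qed
next
  case (ProdL \<Gamma> A B \<Delta> C)
  show ?case
  proof (rule validI)
    fix vs assume "matches vs (\<Gamma> @ [Prod A B] @ \<Delta>)"
    then obtain gs w ds where vs: "vs = gs @ [w] @ ds" "matches gs \<Gamma>"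
      "w \<in> cl {a @ b |a b. a \<in> sem A \<and> b \<in> sem B}" "matches ds \<Delta>"
      by (auto simp: list_all2_append2 list_all2_Cons2)
    have "concat gs @ (a @ b) @ concat ds \<in> sem C" if "a \<in> sem A" "b \<in> sem B" for a b
      using validD[OF ProdL.IH, of "gs @ [a, b] @ ds"] vs that by (auto intro!: list_all2_appendI)
    \<comment> \<open>Concatenations are acceptable between the given surroundings;
      \<open>residual_closed\<close> extends this to their closure.\<close>
    then have "{a @ b |a b. a \<in> sem A \<and> b \<in> sem B} \<subseteq> {w. concat gs @ w @ concat ds \<in> sem C}" by blast
    then have "w \<in> cl {w. concat gs @ w @ concat ds \<in> sem C}" using vs(3) cl_mono by blast
    from residual_closed[OF sem_closed this] show "concat vs \<in> sem C" using vs(1) by simp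
  qed
next
  case (ProdR \<Pi> \<Psi> A B)
  show ?case
  proof (rule validI)
    fix vs assume "matches vs (\<Pi> @ \<Psi>)"
    then obtain ps qs where vs: "vs = ps @ qs" "matches ps \<Pi>"
      "matches qs \<Psi>"
      by (auto simp: list_all2_append2)
    have "concat ps \<in> sem A" "concat qs \<in> sem B"
      using validD ProdR.IH vs by blast+
    then have "concat ps @ concat qs \<in> cl {a @ b |a b. a \<in> sem A \<and> b \<in> sem B}"
      using sem_nonempty by (intro clI) blast+
    then show "concat vs \<in> sem (Prod A B)" using vs(1) by simp
  qed
next
  case (Cut \<Pi> A \<Gamma> \<Delta> B)
  show ?case
  proof (rule validI)
    fix vs assume "matches vs (\<Gamma> @ \<Pi> @ \<Delta>)"
    then obtain gs ps ds where vs: "vs = gs @ ps @ ds" "matches gs \<Gamma>"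
      "matches ps \<Pi>" "matches ds \<Delta>"
      by (auto simp: list_all2_append2)
    show "concat vs \<in> sem B"
      using valid_context[OF Cut.IH(2) vs(2,4) validD[OF Cut.IH(1) vs(3)]] vs(1) by simp
  qed
next
  case (RevRev \<Pi> B)
  show ?case
  proof (rule validI)
    fix vs assume "matches vs (rev (map Rev \<Pi>))"
    then have "matches (rev vs) (map Rev \<Pi>)"
      by (simp add: list_all2_rev1)
    then have "matches (rev (map flip vs)) \<Pi>"
      by (simp add: rev_map list_all2_map1 list_all2_map2)
    then show "concat vs \<in> sem (Rev B)"
      using validD[OF RevRev.IH] by (simp add: flip_concat)
  qed
next
  case (RRL \<Gamma> A \<Delta> B)
  show ?case
    using RRL.IH by (auto simp: valid_def list_all2_append2 list_all2_Cons2)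
next
  case (RRR \<Pi> A)
  then show ?case by (simp add: valid_def)
next
  case (BraceR \<Pi> A)
  then show ?case using sem_nonempty by (fastforce simp: valid_def)
next
  case (BraceL B A)
  \<comment> \<open>Consequently each \<open>cycle_set D\<close> containing \<open>sem A\<close>
    contains \<open>sem B\<close> too, and is among the tests that the words of
    \<open>sem (Brace B)\<close> pass.\<close>
  have "sem B \<subseteq> sem (Brace A)"
    using validD[OF BraceL.IH, of "[w]" for w] by auto
  then have "sem B \<subseteq> cycle_set D" if "sem A \<subseteq> cycle_set D" for D
    using that by auto
  then have "sem (Brace B) \<subseteq> sem (Brace A)" by auto
  then show ?case by (auto simp: valid_def list_all2_Cons2 simp del: sem.simps)
next
  case (Rotate \<Pi> \<Psi> A)
  show ?case
  proof (rule validI)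
    fix vs assume "matches vs (\<Psi> @ \<Pi>)"
    then obtain qs ps where vs: "vs = qs @ ps" "matches ps \<Pi>"
      "matches qs \<Psi>"
      by (auto simp: list_all2_append2)
    have "concat (ps @ qs) \<in> sem (Brace A)"
      by (rule validD[OF Rotate.IH]) (use vs in \<open>auto intro: list_all2_appendI\<close>)
    then show "concat vs \<in> sem (Brace A)" using vs(1) cycle_set_rotate by auto
  qed
next
  case (AxRevBrace A)
  \<comment> \<open>If \<open>flip w\<close> is in \<open>sem A\<close>, it passes every cycle test
    containing \<open>sem A\<close>; a cycle read backwards is the same graph, so \<open>w\<close>
    passes as well.\<close>
  have "w \<in> sem (Brace A)" if "flip w \<in> sem A" for w
    using that cycle_set_flip sem_nonempty[OF that] by auto
  then show ?case by (auto simp: valid_def list_all2_Cons2)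
qed

lemma lbr_imp_HL_WI:
  assumes "lbr As B" "As \<noteq> []"
  shows "HL_WI rk (string_graph (map (tr \<iota>) As)) (tr \<iota> B)"
proof -
  let ?n = "length As" and ?G = "string_graph (map (tr \<iota>) As)"
  define ws where "ws = map (\<lambda>k. (As ! k, True, Suc k)) [0..<?n]"
  \<comment> \<open>Each type is matched with its own one-letter word. The concatenation of these
    words labels the string graph, and \<open>sem B \<subseteq> path_set B\<close> makes that graph
    derivable.\<close>
  have "matches (map (\<lambda>A. [(A, True)]) As) As"
    using sem_letter_path_set by (auto simp: list_all2_map1 intro!: list_all2_refl)
  from validD[OF lbr_valid[OF assms(1)] this]
  have "map (\<lambda>A. (A, True)) As \<in> path_set B"
    using sem_letter_path_set[of B] by (auto simp: concat_map_singleton)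
  moreover have "signs ws = map (\<lambda>A. (A, True)) As"
    by (rule nth_equalityI) (auto simp: ws_def signs_def)
  moreover have "fresh_walk 0 ws ?n {0, ?n}"
  proof -
    have st: "stops ws = map Suc [0..<?n]" by (simp add: ws_def stops_def comp_def)
    then have "inner ws = map Suc [0..<?n - 1]"
      using assms(2) by (cases ?n) (auto simp: inner_def map_butlast[symmetric])
    moreover have "final 0 ws = ?n" "ws \<noteq> []"
      using assms(2) st by (auto simp: final_conv last_map ws_def)
    ultimately show ?thesis by (auto simp: fresh_walk_def distinct_map)
  qed
  ultimately have "der rk (named_walk 0 ws) [0, ?n] (tr \<iota> B)"
    using assms(2) by (intro path_setD) auto
  moreover have "rep rk ?G id (named_walk 0 ws) [0, ?n]"
    unfolding rep_def
  proof (intro conjI)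
    show "hypergraph rk ?G"
      using assms(2) by (auto simp: hypergraph_def string_graph_def)
    show "no_isolated ?G"
      unfolding no_isolated_def
    proof
      fix v assume v: "v \<in> nodes ?G"
      show "\<exists>e\<in>edges ?G. v \<in> set (att ?G e)"
      proof (cases v)
        case 0
        then show ?thesis using assms(2) by (intro bexI[of _ 0]) (auto simp: string_graph_def)
      next
        case (Suc i)
        then show ?thesis using v by (intro bexI[of _ i]) (auto simp: string_graph_def)
      qed
    qed
    show "edge_mset (lab ?G) id ?G = named_walk 0 ws"
    proof -
      have "edge_mset (lab ?G) id ?G = edge_mset (\<lambda>k. tr \<iota> (As ! k)) id ?G"
        by (rule edge_mset_cong) (auto simp: string_graph_def)
      then show ?thesis
        unfolding ws_def walk_string by (simp add: edge_mset_def string_graph_def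
            mset_set_upto_eq_mset_upto del: mset_upt)
    qed
  qed (auto simp: string_graph_def)
  ultimately show ?thesis unfolding HL_WI_def by (rule der_hl)
qed

end

theorem theorem10:
  fixes rk :: "'p \<Rightarrow> nat" and \<iota> :: "'q \<Rightarrow> 'p"
    and As :: "'q ltype list" and B :: "'q ltype"
  assumes "\<And>n. infinite {p. rk p = n}"
    and "bij_betw \<iota> UNIV {p. rk p = 2}"
    and "As \<noteq> []"
  shows "lbr As B \<longleftrightarrow> HL_WI rk (string_graph (map (tr \<iota>) As)) (tr \<iota> B)"
proof -
  have \<iota>: "inj \<iota>" "rk (\<iota> q) = 2" for q
    using assms(2) by (auto simp: bij_betw_def)
  then interpret translation rk \<iota> by unfold_locales
  show ?thesis
    using lbr_imp_HL_WI HL_WI_imp_lbr \<iota> assms(3) by blast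
qed

end
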